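(* Suppose $G_\infty$ is a PWIST$(\sigma,\lambda_\Pi)$ with random conductance operator $C_{G_\infty}$. For all $z\in\mathbb{C}_+=\{z\in\mathbb{C}:\operatorname{Im}z>0\}$, the random variable $$R_{\varnothing\varnothing}(z):=\langle e_\varnothing,(C_{G_\infty}-zI)^{-1}e_\varnothing\rangle$$ satisfies $R_{\varnothing\varnothing}(-\bar z)=-\overline{R_{\varnothing\varnothing}(z)}$ and the recursive distributional equation $$R_{\varnothing\varnothing}(z)\stackrel{d}{=}-\Big(z+\sigma^2R_{00}(z)+\sum_{k\in\mathbb{N}}|C(k)|^2R_{kk}(z)\Big)^{-1},$$ where for all $k\ge0$, $R_{kk}$ has the same distribution as $R_{\varnothing\varnothing}$, and $\{C(k)\}_{k\in\mathbb{N}}$ are the points of an independent Poisson random measure with intensity $\Pi(dx)$ on $\mathbb{R}\setminus\{0\}$.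
   Context: Here $\sigma\ge0$ and $\Pi$ is a symmetric measure on $\mathbb{R}\setminus\{0\}$ with $\int(1\wedge x^2)\,\Pi(dx)<\infty$. PWIST. Let $\lambda_\Pi$ be the measure on $\mathbb{R}\setminus\{0\}$ determined by $\lambda_\Pi\{x:1/x\in B\}=\Pi(B)$. A PWIST$(\sigma,\lambda_\Pi)$ (Poisson weighted infinite skeleton tree) is the random edge-weighted tree with vertex set $\mathbb{N}_0^F=\bigcup_{g\ge0}\mathbb{N}_0^g$, the finite words over $\mathbb{N}_0=\{0,1,2,\dots\}$, rooted at the empty word $\varnothing$, in which each $v$ is joined to its children $vk$, $k\in\mathbb{N}_0$. The edge $\{v,v0\}$ has nonrandom weight $1/\sigma\in(0,\infty]$. For each $v$, the edge weights from $v$ to $v1,v2,\dots$ are the points of a Poisson random measure on $\mathbb{R}\setminus\{0\}$ with intensity $\lambda_\Pi$, listed in order of increasing absolute value; if there are fewer than $k$ points, the edge $\{v,vk\}$ has weight $\infty$ (is regarded as absent). The Poisson random measures for different $v$ are independent. Conductance operator. For a graph $G$ with vertex set $V$ and edge weights $\mathcal{R}(u,v)$, define on finitely supported vectors in $L^2(V)$ the symmetric operator with matrix entries $\langle e_u,C_Ge_v\rangle=1/\mathcal{R}(u,v)$ if $u,v$ are adjacent and $0$ otherwise (with $1/\infty=0$), where $e_v$ is the standard basis vector at $v$. $C_G$ also denotes its closure, which for a PWIST is self-adjoint. If the Poisson random measure of intensity $\Pi$ has only finitely many points, the sum over $k\in\mathbb{N}$ runs over these points (the missing $C(k)$ are $0$).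 $\stackrel{d}{=}$ denotes equality in distribution. *)

theory Defs
  imports "HOL-Probability.Probability"
begin

section \<open>Unbounded operators on the space of square summable functions\<close>

definition ell2 :: "('v \<Rightarrow> complex) set" where
  "ell2 = {f. (\<lambda>v. (cmod (f v))\<^sup>2) summable_on UNIV}"

definition ell2_norm :: "('v \<Rightarrow> complex) \<Rightarrow> real" where
  "ell2_norm f = sqrt (\<Sum>\<^sub>\<infinity>v. (cmod (f v))\<^sup>2)"

definition ell2_inner :: "('v \<Rightarrow> complex) \<Rightarrow> ('v \<Rightarrow> complex) \<Rightarrow> complex" where
  "ell2_inner f g = (\<Sum>\<^sub>\<infinity>v. cnj (f v) * g v)"

definition basis_vec :: "'v \<Rightarrow> 'v \<Rightarrow> complex" where
  "basis_vec u = (\<lambda>v. if v = u then 1 else 0)"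

text \<open>A partially defined operator is represented by its graph, the set of all pairs
  \<open>(f, T f)\<close> with \<open>f\<close> in the domain of \<open>T\<close>.\<close>

type_synonym 'v ell2_op = "(('v \<Rightarrow> complex) \<times> ('v \<Rightarrow> complex)) set"

definition op_closure :: "'v ell2_op \<Rightarrow> 'v ell2_op" where
  "op_closure T = {(f, g). f \<in> ell2 \<and> g \<in> ell2 \<and>
     (\<exists>F G. (\<forall>n::nat. (F n, G n) \<in> T) \<and>
        (\<lambda>n. ell2_norm (\<lambda>v. F n v - f v)) \<longlonglongrightarrow> 0 \<and>
        (\<lambda>n. ell2_norm (\<lambda>v. G n v - g v)) \<longlonglongrightarrow> 0)}"

text \<open>The pair \<open>(f, h + z f)\<close> lies in the graph of \<open>T\<close> iff \<open>f\<close> is in the domain of \<open>T\<close> and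
  \<open>(T - z I) f = h\<close>. Hence \<open>z\<close> is in the resolvent set iff \<open>T - z I\<close> is a bijection from the
  domain of \<open>T\<close> onto the whole space; for closed \<open>T\<close> the inverse is then bounded by the closed
  graph theorem.\<close>

definition resolvent_set :: "'v ell2_op \<Rightarrow> complex set" where
  "resolvent_set T = {z. \<forall>h\<in>ell2. \<exists>!f. (f, \<lambda>v. h v + z * f v) \<in> T}"

definition resolvent :: "'v ell2_op \<Rightarrow> complex \<Rightarrow> ('v \<Rightarrow> complex) \<Rightarrow> 'v \<Rightarrow> complex" where
  "resolvent T z h = (THE f. (f, \<lambda>v. h v + z * f v) \<in> T)"

text \<open>The value 0 outside the resolvent set is a convention. It is irrelevant for self-adjoint
  \<open>T\<close> and nonreal \<open>z\<close>.\<close>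

definition resolvent_entry :: "'v ell2_op \<Rightarrow> complex \<Rightarrow> 'v \<Rightarrow> 'v \<Rightarrow> complex" where
  "resolvent_entry T z u v =
     (if z \<in> resolvent_set T then ell2_inner (basis_vec u) (resolvent T z (basis_vec v)) else 0)"


section \<open>Conductance operators\<close>

text \<open>Here \<open>1 / \<infinity> = 0\<close>, and \<open>1 / (1 / 0) = 0\<close> because \<open>1 / 0 = \<infinity>\<close> in the extended reals.\<close>

definition conductance :: "('v \<Rightarrow> 'v \<Rightarrow> bool) \<Rightarrow> ('v \<Rightarrow> 'v \<Rightarrow> ereal) \<Rightarrow> 'v \<Rightarrow> 'v \<Rightarrow> real" where
  "conductance adj W u v = (if adj u v then real_of_ereal (1 / W u v) else 0)"

text \<open>The graph of the operator on finitely supported vectors. The requirement that the image be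
  square summable is automatic as soon as every column of the conductance matrix is.\<close>

definition conductance_core :: "('v \<Rightarrow> 'v \<Rightarrow> bool) \<Rightarrow> ('v \<Rightarrow> 'v \<Rightarrow> ereal) \<Rightarrow> 'v ell2_op" where
  "conductance_core adj W = {(f, g). finite {v. f v \<noteq> 0} \<and>
     g = (\<lambda>u. \<Sum>v | f v \<noteq> 0. complex_of_real (conductance adj W u v) * f v) \<and> g \<in> ell2}"

definition conductance_op :: "('v \<Rightarrow> 'v \<Rightarrow> bool) \<Rightarrow> ('v \<Rightarrow> 'v \<Rightarrow> ereal) \<Rightarrow> 'v ell2_op" where
  "conductance_op adj W = op_closure (conductance_core adj W)"


section \<open>Poisson random measures\<close>

definition punctured_borel :: "real measure" where
  "punctured_borel = restrict_space borel (- {0})"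

definition symmetric_levy_measure :: "real measure \<Rightarrow> bool" where
  "symmetric_levy_measure \<nu> \<longleftrightarrow>
     sets \<nu> = sets punctured_borel \<and>
     (\<forall>B\<in>sets \<nu>. emeasure \<nu> (uminus ` B) = emeasure \<nu> B) \<and>
     (\<integral>\<^sup>+ x. ennreal (min 1 (x\<^sup>2)) \<partial>\<nu>) < \<infinity>"

definition reciprocal_measure :: "real measure \<Rightarrow> real measure" where
  "reciprocal_measure \<nu> = distr \<nu> punctured_borel (\<lambda>x. 1 / x)"

text \<open>A random point configuration is encoded by a sequence \<open>x 1, x 2, \<dots>\<close> of extended reals
  (index 0 is ignored). Points are counted with multiplicity, and an entry that is not a nonzero
  real number (such as \<open>\<infinity>\<close> or 0) is not a point of the punctured line, hence contributes to no
  count.\<close>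

definition point_count :: "(nat \<Rightarrow> ereal) \<Rightarrow> real set \<Rightarrow> ennreal" where
  "point_count x B = emeasure (count_space UNIV) {k. 1 \<le> k \<and> x k \<in> ereal ` B}"

text \<open>The counting measure of the points \<open>X 1, X 2, \<dots>\<close> is a Poisson random measure with
  intensity \<open>\<mu>\<close>. The Poisson weights are written out because \<open>poisson_pmf\<close> is unspecified for
  rate 0.\<close>

definition poisson_points :: "'a measure \<Rightarrow> real measure \<Rightarrow> ('a \<Rightarrow> nat \<Rightarrow> ereal) \<Rightarrow> bool" where
  "poisson_points M \<mu> X \<longleftrightarrow>
     (\<forall>k\<ge>1. (\<lambda>\<omega>. X \<omega> k) \<in> borel_measurable M) \<and>
     (\<forall>B\<in>sets \<mu>. emeasure \<mu> B < \<infinity> \<longrightarrow>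
        (\<forall>n::nat. measure M {\<omega>\<in>space M. point_count (X \<omega>) B = of_nat n} =
           measure \<mu> B ^ n / fact n * exp (- measure \<mu> B))) \<and>
     (\<forall>B\<in>sets \<mu>. emeasure \<mu> B = \<infinity> \<longrightarrow> (AE \<omega> in M. point_count (X \<omega>) B = \<infinity>)) \<and>
     (\<forall>B::nat \<Rightarrow> real set. range B \<subseteq> sets \<mu> \<and> disjoint_family B \<longrightarrow>
        prob_space.indep_vars M (\<lambda>_. borel) (\<lambda>i \<omega>. point_count (X \<omega>) (B i)) UNIV)"


section \<open>Poisson weighted infinite skeleton trees\<close>

definition word_adj :: "nat list \<Rightarrow> nat list \<Rightarrow> bool" where
  "word_adj u v \<longleftrightarrow> (\<exists>k. v = u @ [k] \<or> u = v @ [k])"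

text \<open>Ties in absolute value (possible if the intensity has atoms) may be broken in any measurable
  way. Independence over the vertices is independence of the random measures, that is of the
  families of all counts.\<close>

definition pwist :: "'a measure \<Rightarrow> real \<Rightarrow> real measure \<Rightarrow>
    ('a \<Rightarrow> nat list \<Rightarrow> nat list \<Rightarrow> ereal) \<Rightarrow> bool" where
  "pwist M \<sigma> \<Lambda> W \<longleftrightarrow>
     (\<forall>\<omega>\<in>space M. \<forall>u v. W \<omega> u v = W \<omega> v u) \<and>
     (\<forall>\<omega>\<in>space M. \<forall>v. W \<omega> v (v @ [0]) = 1 / ereal \<sigma>) \<and>
     (\<forall>v. poisson_points M \<Lambda> (\<lambda>\<omega> k. W \<omega> v (v @ [k]))) \<and>
     (\<forall>v. AE \<omega> in M. \<forall>k\<ge>1. W \<omega> v (v @ [k]) \<notin> {0, - \<infinity>} \<and>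
        \<bar>W \<omega> v (v @ [k])\<bar> \<le> \<bar>W \<omega> v (v @ [Suc k])\<bar>) \<and>
     prob_space.indep_vars M (\<lambda>_. PiM (sets \<Lambda>) (\<lambda>_. borel))
       (\<lambda>v \<omega>. \<lambda>B\<in>sets \<Lambda>. point_count (\<lambda>k. W \<omega> v (v @ [k])) B) UNIV"

definition root_resolvent :: "('a \<Rightarrow> nat list \<Rightarrow> nat list \<Rightarrow> ereal) \<Rightarrow> complex \<Rightarrow> 'a \<Rightarrow> complex" where
  "root_resolvent W z \<omega> = resolvent_entry (conductance_op word_adj (W \<omega>)) z [] []"

end

theory Submission
  imports Defs
begin

text \<open>Deleting the root of the tree leaves the subtrees of its children \<open>k\<close>, each attached to the
  root by one edge of conductance \<open>c k\<close>. The Schur complement therefore expresses the root entry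
  of the resolvent as \<open>- 1 / (z + \<Sum>k. (c k)\<^sup>2 R k)\<close> with the root entries \<open>R k\<close> of the subtrees
  (\<open>tree_resolvent_recursion\<close>). The subtrees carry independent copies of the weights and are
  independent of the weights at the root, so the recursive equation in law follows as soon as the
  resolvent exists and the labelling of the points is shown to be irrelevant.

  Existence of the resolvent is the essential self-adjointness of the random operator. For a
  symmetric relation it is equivalent to the density of the range of \<open>T - z\<close>
  (\<open>resolvent_set_iff_dense_range\<close>). Call a point at a vertex heavy if it is large or belongs to
  an overcrowded dyadic layer. The limits of the layers can be chosen such that the squares of the
  other points always have a sum below one constant (\<open>light_points_bound\<close>), while the mean number
  of heavy points is at most 1/2 (\<open>heavy_points_mean\<close>). The heavy edges then form a subcritical
  branching process, whose clusters are almost surely finite (\<open>AE_finite_kept_paths\<close>). So the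
  operator is the sum of finite blocks and a bounded operator, and such an operator is essentially
  self-adjoint (\<open>tree_resolvent_set\<close>).

  The signs of the weights do not affect the root resolvent, because on a tree they can be gauged
  away (\<open>tree_resolvent_abs\<close>). The absolute values in decreasing order are functions of the counts
  alone (\<open>rearrange_decreasing\<close>), and the law of the counts is determined by the intensity
  (\<open>tail_counts_law\<close>). This yields the independence and the equality in law of the subtrees
  although ties between points may be broken arbitrarily. For the second, arbitrary labelling
  \<open>C\<close> of the points, relabelling independent copies along a bijection from the points to their
  decreasing rearrangement does not change the law of the sum (\<open>schur_map_rearrange\<close>).

  The reflection \<open>z \<mapsto> - cnj z\<close> comes from the bipartiteness of the tree
  (\<open>tree_resolvent_reflect\<close>). Measurability of the root resolvent holds on the whole space: both the
  existence of the resolvent and its value can be read off from the residuals of countably many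
  finitely supported vectors (\<open>resolvent_set_iff_residual\<close>).\<close>

section \<open>Square summable functions\<close>

lemma L2_set_le_ell2_norm:
  assumes "f \<in> ell2" "finite F"
  shows "L2_set (\<lambda>v. cmod (f v)) F \<le> ell2_norm f"
  unfolding L2_set_def ell2_norm_def
  using assms by (intro real_sqrt_le_mono finite_sum_le_infsum) (auto simp: ell2_def)

text \<open>Membership and norm bounds are read off from finite sets of vertices, where the inequalities for
  \<open>L2_set\<close> apply.\<close>

lemma ell2I:
  assumes "\<And>F. finite F \<Longrightarrow> L2_set (\<lambda>v. cmod (f v)) F \<le> b"
  shows "f \<in> ell2" and "ell2_norm f \<le> b"
proof -
  have b: "0 \<le> b" using assms[of "{}"] by simp
  have bound: "(\<Sum>v\<in>F. (cmod (f v))\<^sup>2) \<le> b\<^sup>2" if "finite F" for F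
  proof -
    have "sqrt (\<Sum>v\<in>F. (cmod (f v))\<^sup>2) \<le> b" using assms[OF that] by (simp add: L2_set_def)
    thus ?thesis by (metis real_sqrt_le_iff b real_sqrt_unique)
  qed
  show f: "f \<in> ell2"
    unfolding ell2_def mem_Collect_eq
    by (rule nonneg_bdd_above_summable_on) (auto intro!: bdd_aboveI[of _ "b\<^sup>2"] simp: bound)
  have "(\<Sum>\<^sub>\<infinity>v. (cmod (f v))\<^sup>2) \<le> b\<^sup>2"
    using f by (intro infsum_le_finite_sums) (auto simp: bound ell2_def)
  thus "ell2_norm f \<le> b"
    unfolding ell2_norm_def using b by (metis real_sqrt_le_iff real_sqrt_unique)
qed

lemma ell2_norm_nonneg [simp]: "0 \<le> ell2_norm f"
  by (simp add: ell2_norm_def infsum_nonneg)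

lemma cmod_le_ell2_norm: "f \<in> ell2 \<Longrightarrow> cmod (f v) \<le> ell2_norm f"
  using L2_set_le_ell2_norm[of f "{v}"] by simp

lemma ell2_finite_support:
  assumes "finite S" "\<And>v. v \<notin> S \<Longrightarrow> f v = 0"
  shows "f \<in> ell2" and "ell2_norm f = L2_set (\<lambda>v. cmod (f v)) S"
proof -
  have *: "L2_set (\<lambda>v. cmod (f v)) F \<le> L2_set (\<lambda>v. cmod (f v)) S" if "finite F" for F
  proof -
    have "(\<Sum>v\<in>F. (cmod (f v))\<^sup>2) = (\<Sum>v\<in>F \<inter> S. (cmod (f v))\<^sup>2)"
      using assms that by (intro sum.mono_neutral_right) auto
    also have "\<dots> \<le> (\<Sum>v\<in>S. (cmod (f v))\<^sup>2)"
      using assms by (intro sum_mono2) auto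
    finally show ?thesis by (simp add: L2_set_def)
  qed
  show f: "f \<in> ell2" using ell2I(1)[of f] * by blast
  show "ell2_norm f = L2_set (\<lambda>v. cmod (f v)) S"
    using ell2I(2)[of f] * L2_set_le_ell2_norm[OF f assms(1)] by (intro antisym) auto
qed

lemma ell2_add:
  assumes "f \<in> ell2" "g \<in> ell2"
  shows "(\<lambda>v. f v + g v) \<in> ell2" and "ell2_norm (\<lambda>v. f v + g v) \<le> ell2_norm f + ell2_norm g"
proof -
  have *: "L2_set (\<lambda>v. cmod (f v + g v)) F \<le> ell2_norm f + ell2_norm g" if "finite F" for F
  proof -
    have "L2_set (\<lambda>v. cmod (f v + g v)) F \<le> L2_set (\<lambda>v. cmod (f v) + cmod (g v)) F"
      by (rule L2_set_mono) (auto intro: norm_triangle_ineq)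
    also have "\<dots> \<le> L2_set (\<lambda>v. cmod (f v)) F + L2_set (\<lambda>v. cmod (g v)) F"
      by (rule L2_set_triangle_ineq)
    also have "\<dots> \<le> ell2_norm f + ell2_norm g"
      using assms that by (intro add_mono L2_set_le_ell2_norm)
    finally show ?thesis .
  qed
  show "(\<lambda>v. f v + g v) \<in> ell2" "ell2_norm (\<lambda>v. f v + g v) \<le> ell2_norm f + ell2_norm g"
    using ell2I[of "\<lambda>v. f v + g v"] * by blast+
qed

lemma ell2_scale:
  assumes "f \<in> ell2"
  shows "(\<lambda>v. a * f v) \<in> ell2" and "ell2_norm (\<lambda>v. a * f v) = cmod a * ell2_norm f"
proof -
  show "(\<lambda>v. a * f v) \<in> ell2"
    using assms by (auto simp: ell2_def norm_mult power_mult_distrib intro: summable_on_cmult_right)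
  show "ell2_norm (\<lambda>v. a * f v) = cmod a * ell2_norm f"
    by (simp add: ell2_norm_def norm_mult power_mult_distrib infsum_cmult_right' real_sqrt_mult)
qed

lemma ell2_norm_cmod_cong: "(\<And>v. cmod (f v) = cmod (g v)) \<Longrightarrow> ell2_norm f = ell2_norm g"
  by (simp add: ell2_norm_def)

lemma ell2_cmod_cong: "(\<And>v. cmod (f v) = cmod (g v)) \<Longrightarrow> f \<in> ell2 \<longleftrightarrow> g \<in> ell2"
  by (simp add: ell2_def)

lemma ell2_norm_minus_commute: "ell2_norm (\<lambda>v. f v - g v) = ell2_norm (\<lambda>v. g v - f v)"
  by (rule ell2_norm_cmod_cong) (rule norm_minus_commute)

lemma ell2_diff:
  assumes "f \<in> ell2" "g \<in> ell2"
  shows "(\<lambda>v. f v - g v) \<in> ell2" and "ell2_norm (\<lambda>v. f v - g v) \<le> ell2_norm f + ell2_norm g"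
proof -
  have g: "(\<lambda>v. - g v) \<in> ell2" "ell2_norm (\<lambda>v. - g v) = ell2_norm g"
    using assms(2) ell2_cmod_cong[of "\<lambda>v. - g v" g] ell2_norm_cmod_cong[of "\<lambda>v. - g v" g] by auto
  show "(\<lambda>v. f v - g v) \<in> ell2" "ell2_norm (\<lambda>v. f v - g v) \<le> ell2_norm f + ell2_norm g"
    using ell2_add[OF assms(1) g(1)] g(2) by simp_all
qed

lemma ell2_norm_triangle_sub:
  assumes "f \<in> ell2" "g \<in> ell2" "h \<in> ell2"
  shows "ell2_norm (\<lambda>v. f v - h v) \<le> ell2_norm (\<lambda>v. f v - g v) + ell2_norm (\<lambda>v. g v - h v)"
  using ell2_add(2)[OF ell2_diff(1)[OF assms(1,2)] ell2_diff(1)[OF assms(2,3)]] by simp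

lemma ell2_norm_le_add_diff:
  assumes "f \<in> ell2" "g \<in> ell2"
  shows "ell2_norm f \<le> ell2_norm g + ell2_norm (\<lambda>v. f v - g v)"
  using ell2_add(2)[OF assms(2) ell2_diff(1)[OF assms]] by simp

lemma zero_ell2 [simp]: "(\<lambda>v. 0) \<in> ell2" "ell2_norm (\<lambda>v. 0) = 0"
  by (simp_all add: ell2_def ell2_norm_def)

lemma ell2_sum: "(\<And>i. i \<in> I \<Longrightarrow> f i \<in> ell2) \<Longrightarrow> (\<lambda>v. \<Sum>i\<in>I. f i v) \<in> ell2"
proof (induction I rule: infinite_finite_induct)
  case (insert x F)
  then show ?case using ell2_add(1)[of "f x" "\<lambda>v. \<Sum>i\<in>F. f i v"] by simp
qed simp_all

lemma ell2_norm_sum_le: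
  "(\<And>i. i \<in> I \<Longrightarrow> f i \<in> ell2) \<Longrightarrow> ell2_norm (\<lambda>v. \<Sum>i\<in>I. f i v) \<le> (\<Sum>i\<in>I. ell2_norm (f i))"
proof (induction I rule: infinite_finite_induct)
  case (insert x F)
  have "ell2_norm (\<lambda>v. f x v + (\<Sum>i\<in>F. f i v)) \<le> ell2_norm (f x) + ell2_norm (\<lambda>v. \<Sum>i\<in>F. f i v)"
    using insert.prems by (intro ell2_add ell2_sum) auto
  moreover have "ell2_norm (\<lambda>v. \<Sum>i\<in>F. f i v) \<le> (\<Sum>i\<in>F. ell2_norm (f i))"
    using insert by auto
  ultimately show ?case using insert.hyps by simp
qed simp_all

lemma basis_vec_ell2 [simp]: "basis_vec u \<in> ell2"
  by (rule ell2_finite_support(1)[of "{u}"]) (auto simp: basis_vec_def)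

lemma ell2_norm_basis_vec [simp]: "ell2_norm (basis_vec u) = 1"
  by (subst ell2_finite_support(2)[of "{u}"]) (auto simp: basis_vec_def)

lemma ell2_norm_eq_0: "f \<in> ell2 \<Longrightarrow> ell2_norm f = 0 \<Longrightarrow> f = (\<lambda>v. 0)"
  using cmod_le_ell2_norm[of f] by (force simp: fun_eq_iff)

lemma ell2_inner_basis_vec [simp]: "ell2_inner (basis_vec u) f = f u"
proof -
  have "ell2_inner (basis_vec u) f = (\<Sum>\<^sub>\<infinity>v\<in>{u}. f v)"
    unfolding ell2_inner_def by (rule infsum_cong_neutral) (auto simp: basis_vec_def)
  thus ?thesis by simp
qed

lemma ell2_cauchy_schwarz:
  assumes "f \<in> ell2" "g \<in> ell2" "finite F"
  shows "cmod (\<Sum>v\<in>F. cnj (f v) * g v) \<le> ell2_norm f * ell2_norm g"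
proof -
  have "cmod (\<Sum>v\<in>F. cnj (f v) * g v) \<le> (\<Sum>v\<in>F. \<bar>cmod (f v)\<bar> * \<bar>cmod (g v)\<bar>)"
    by (rule sum_norm_le) (simp add: norm_mult)
  also have "\<dots> \<le> L2_set (\<lambda>v. cmod (f v)) F * L2_set (\<lambda>v. cmod (g v)) F"
    by (rule L2_set_mult_ineq)
  also have "\<dots> \<le> ell2_norm f * ell2_norm g"
    using assms by (intro mult_mono L2_set_le_ell2_norm) auto
  finally show ?thesis .
qed

text \<open>Completeness: the pointwise limit of a Cauchy sequence is its limit in norm, because every
  finite partial sum of the squares passes to the limit.\<close>

lemma ell2_complete:
  fixes f :: "nat \<Rightarrow> 'v \<Rightarrow> complex"
  assumes f: "\<And>n. f n \<in> ell2"
    and cauchy: "\<And>e. e > 0 \<Longrightarrow> \<exists>N. \<forall>m\<ge>N. \<forall>n\<ge>N. ell2_norm (\<lambda>v. f m v - f n v) < e"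
  shows "\<exists>l\<in>ell2. (\<lambda>n. ell2_norm (\<lambda>v. f n v - l v)) \<longlonglongrightarrow> 0"
proof -
  have d: "(\<lambda>v. f m v - f n v) \<in> ell2" for m n using f by (intro ell2_diff)
  have "Cauchy (\<lambda>n. f n v)" for v
  proof (rule metric_CauchyI)
    fix e :: real assume "e > 0"
    then obtain N where "\<forall>m\<ge>N. \<forall>n\<ge>N. ell2_norm (\<lambda>v. f m v - f n v) < e" using cauchy by blast
    hence "\<forall>m\<ge>N. \<forall>n\<ge>N. dist (f m v) (f n v) < e"
      using cmod_le_ell2_norm[OF d, where v=v] unfolding dist_norm by (metis le_less_trans)
    thus "\<exists>N. \<forall>m\<ge>N. \<forall>n\<ge>N. dist (f m v) (f n v) < e" by blast
  qed
  hence "\<forall>v. \<exists>l. (\<lambda>n. f n v) \<longlonglongrightarrow> l" by (simp add: Cauchy_convergent_iff convergent_def)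
  then obtain l where l: "\<And>v. (\<lambda>n. f n v) \<longlonglongrightarrow> l v" by metis
  have tail: "\<exists>N. \<forall>m\<ge>N. (\<lambda>v. f m v - l v) \<in> ell2 \<and> ell2_norm (\<lambda>v. f m v - l v) \<le> e"
    if "e > 0" for e
  proof -
    obtain N where N: "\<forall>m\<ge>N. \<forall>n\<ge>N. ell2_norm (\<lambda>v. f m v - f n v) < e"
      using cauchy \<open>e > 0\<close> by blast
    have "L2_set (\<lambda>v. cmod (f m v - l v)) F \<le> e" if "m \<ge> N" "finite F" for m F
    proof -
      have "(\<lambda>n. L2_set (\<lambda>v. cmod (f m v - f n v)) F) \<longlonglongrightarrow> L2_set (\<lambda>v. cmod (f m v - l v)) F"
        unfolding L2_set_def by (intro tendsto_intros l)
      moreover have "\<forall>\<^sub>F n in sequentially. L2_set (\<lambda>v. cmod (f m v - f n v)) F \<le> e"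
        using eventually_ge_at_top[of N]
      proof eventually_elim
        case (elim n)
        thus ?case using L2_set_le_ell2_norm[OF d \<open>finite F\<close>, of m n] N \<open>m \<ge> N\<close> by force
      qed
      ultimately show ?thesis by (rule tendsto_upperbound) simp
    qed
    thus ?thesis using ell2I[of "\<lambda>v. f _ v - l v"] by meson
  qed
  obtain N where "(\<lambda>v. f N v - l v) \<in> ell2" using tail[of 1] by auto
  hence "(\<lambda>v. f N v - (f N v - l v)) \<in> ell2" by (rule ell2_diff(1)[OF f])
  hence "l \<in> ell2" by simp
  moreover have "(\<lambda>n. ell2_norm (\<lambda>v. f n v - l v)) \<longlonglongrightarrow> 0"
  proof (rule LIMSEQ_I)
    fix e :: real assume "e > 0"
    then obtain N where "\<forall>m\<ge>N. ell2_norm (\<lambda>v. f m v - l v) \<le> e / 2"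
      using tail[of "e/2"] by auto
    thus "\<exists>N. \<forall>n\<ge>N. norm (ell2_norm (\<lambda>v. f n v - l v) - 0) < e"
      using \<open>e > 0\<close> by (intro exI[of _ N]) force
  qed
  ultimately show ?thesis by blast
qed

lemma ell2_finite_approx:
  assumes "f \<in> ell2" "e > 0"
  shows "\<exists>S. finite S \<and> ell2_norm (\<lambda>v. f v - (if v \<in> S then f v else 0)) < e"
proof -
  define s where "s = (\<Sum>\<^sub>\<infinity>v. (cmod (f v))\<^sup>2)"
  have sm: "(\<lambda>v. (cmod (f v))\<^sup>2) summable_on UNIV" using assms by (simp add: ell2_def)
  hence "((\<lambda>v. (cmod (f v))\<^sup>2) has_sum s) UNIV" by (simp add: s_def)
  moreover have "s - (e/2)\<^sup>2 < s" using assms by simp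
  ultimately have "\<forall>\<^sub>F S in finite_subsets_at_top UNIV. s - (e/2)\<^sup>2 < (\<Sum>v\<in>S. (cmod (f v))\<^sup>2)"
    unfolding has_sum_def by (rule order_tendstoD)
  then obtain S where S: "finite S" "s - (e/2)\<^sup>2 < (\<Sum>v\<in>S. (cmod (f v))\<^sup>2)"
    unfolding eventually_finite_subsets_at_top by blast
  have "L2_set (\<lambda>v. cmod (f v - (if v \<in> S then f v else 0))) F \<le> e / 2" if "finite F" for F
  proof -
    have "(\<Sum>v\<in>F. (cmod (f v - (if v \<in> S then f v else 0)))\<^sup>2) = (\<Sum>v\<in>F - S. (cmod (f v))\<^sup>2)"
      using that by (intro sum.mono_neutral_cong_right) auto
    moreover have "(\<Sum>v\<in>F - S. (cmod (f v))\<^sup>2) + (\<Sum>v\<in>S. (cmod (f v))\<^sup>2) = (\<Sum>v\<in>(F - S) \<union> S. (cmod (f v))\<^sup>2)"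
      using that S by (intro sum.union_disjoint[symmetric]) auto
    moreover have "\<dots> \<le> s"
      unfolding s_def using that S by (intro finite_sum_le_infsum sm) auto
    ultimately have "(\<Sum>v\<in>F. (cmod (f v - (if v \<in> S then f v else 0)))\<^sup>2) \<le> (e/2)\<^sup>2"
      using S(2) by linarith
    thus ?thesis unfolding L2_set_def using assms(2) by (intro real_le_lsqrt) (auto intro: sum_nonneg)
  qed
  from ell2I(2)[OF this] have "ell2_norm (\<lambda>v. f v - (if v \<in> S then f v else 0)) \<le> e / 2" by simp
  thus ?thesis using S(1) assms(2) by (intro exI[of _ S]) auto
qed

section \<open>Symmetric relations and their resolvents\<close>

text \<open>The last clause says in terms of norms that \<open>\<langle>f, T f\<rangle>\<close> is real: the squared norm on the right
  is a quadratic polynomial in \<open>Im z\<close> whose linear coefficient must vanish. In this form the property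
  passes to the closure by continuity.\<close>

definition symmetric_rel :: "'v ell2_op \<Rightarrow> bool" where
  "symmetric_rel T \<longleftrightarrow> T \<subseteq> ell2 \<times> ell2 \<and> (\<lambda>v. 0, \<lambda>v. 0) \<in> T \<and>
     (\<forall>f g f' g' a. (f, g) \<in> T \<longrightarrow> (f', g') \<in> T \<longrightarrow>
        (\<lambda>v. f v + a * f' v, \<lambda>v. g v + a * g' v) \<in> T) \<and>
     (\<forall>f g z. (f, g) \<in> T \<longrightarrow> \<bar>Im z\<bar> * ell2_norm f \<le> ell2_norm (\<lambda>v. g v - z * f v))"

definition dense_range :: "'v ell2_op \<Rightarrow> complex \<Rightarrow> bool" where
  "dense_range T z \<longleftrightarrow> (\<forall>h\<in>ell2. \<forall>e>0. \<exists>f g. (f, g) \<in> T \<and> ell2_norm (\<lambda>v. g v - z * f v - h v) < e)"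

context
  fixes T :: "'v ell2_op"
  assumes T: "symmetric_rel T"
begin

lemma symmetric_rel_ell2: "(f, g) \<in> T \<Longrightarrow> f \<in> ell2" "(f, g) \<in> T \<Longrightarrow> g \<in> ell2"
  using T by (auto simp: symmetric_rel_def)

lemma symmetric_rel_zero: "(\<lambda>v. 0, \<lambda>v. 0) \<in> T"
  using T by (auto simp: symmetric_rel_def)

lemma symmetric_rel_add:
  "(f, g) \<in> T \<Longrightarrow> (f', g') \<in> T \<Longrightarrow> (\<lambda>v. f v + a * f' v, \<lambda>v. g v + a * g' v) \<in> T"
  using T by (auto simp: symmetric_rel_def)

lemma symmetric_rel_bound:
  "(f, g) \<in> T \<Longrightarrow> \<bar>Im z\<bar> * ell2_norm f \<le> ell2_norm (\<lambda>v. g v - z * f v)"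
  using T by (auto simp: symmetric_rel_def)

lemma symmetric_rel_residual_ell2:
  "(f, g) \<in> T \<Longrightarrow> (\<lambda>v. g v - z * f v) \<in> ell2"
  by (intro ell2_diff(1) ell2_scale(1) symmetric_rel_ell2)

lemma symmetric_rel_sum:
  "(\<And>i. i \<in> I \<Longrightarrow> (f i, g i) \<in> T) \<Longrightarrow>
     (\<lambda>v. \<Sum>i\<in>I. a i * f i v, \<lambda>v. \<Sum>i\<in>I. a i * g i v) \<in> T"
proof (induction I rule: infinite_finite_induct)
  case (insert x F)
  have "(\<lambda>v. (\<Sum>i\<in>F. a i * f i v) + a x * f x v, \<lambda>v. (\<Sum>i\<in>F. a i * g i v) + a x * g x v) \<in> T"
    using insert by (intro symmetric_rel_add) auto
  thus ?case using insert.hyps by (simp add: add.commute)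
qed (simp_all add: symmetric_rel_zero)

lemma symmetric_rel_resolvent_unique:
  assumes "Im z \<noteq> 0" "(f, \<lambda>v. h v + z * f v) \<in> T" "(f', \<lambda>v. h v + z * f' v) \<in> T"
  shows "f = f'"
proof -
  have "(\<lambda>v. f v + (-1) * f' v, \<lambda>v. (h v + z * f v) + (-1) * (h v + z * f' v)) \<in> T"
    by (intro symmetric_rel_add assms)
  from symmetric_rel_bound[OF this, of z]
  have "\<bar>Im z\<bar> * ell2_norm (\<lambda>v. f v - f' v) \<le> 0" by (simp add: algebra_simps)
  hence "ell2_norm (\<lambda>v. f v - f' v) \<le> 0" using assms(1) by (simp add: mult_le_0_iff)
  hence "ell2_norm (\<lambda>v. f v - f' v) = 0" by (simp add: antisym)
  moreover have "(\<lambda>v. f v - f' v) \<in> ell2" using assms by (intro ell2_diff(1) symmetric_rel_ell2)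
  ultimately show ?thesis using ell2_norm_eq_0[of "\<lambda>v. f v - f' v"] by (auto simp: fun_eq_iff)
qed

text \<open>A range that approximates every \<open>h\<close> up to a fixed fraction of its norm is dense: apply the
  approximation to the residual repeatedly.\<close>

lemma dense_range_contraction:
  assumes q: "0 \<le> q" "q < 1"
    and approx: "\<And>h e. h \<in> ell2 \<Longrightarrow> e > 0 \<Longrightarrow>
      \<exists>f g. (f, g) \<in> T \<and> ell2_norm (\<lambda>v. g v - z * f v - h v) \<le> q * ell2_norm h + e"
  shows "dense_range T z"
  unfolding dense_range_def
proof (intro ballI allI impI)
  have iter: "\<exists>f g. (f, g) \<in> T \<and> ell2_norm (\<lambda>v. g v - z * f v - h v) \<le> q ^ n * ell2_norm h + e"
    if "h \<in> ell2" "e > 0" for h e n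
    using that
  proof (induction n arbitrary: h e)
    case 0
    show ?case using symmetric_rel_zero 0 ell2_norm_cmod_cong[of "\<lambda>v. - h v" h]
      by (intro exI[of _ "\<lambda>v. 0"]) auto
  next
    case (Suc n)
    obtain f g where fg: "(f, g) \<in> T" "ell2_norm (\<lambda>v. g v - z * f v - h v) \<le> q * ell2_norm h + e/2"
      using approx[OF Suc.prems(1), of "e/2"] Suc.prems(2) by auto
    define r where "r = (\<lambda>v. h v - (g v - z * f v))"
    have r: "r \<in> ell2" unfolding r_def
      by (intro ell2_diff(1)[OF Suc.prems(1)] symmetric_rel_residual_ell2 fg)
    have rn: "ell2_norm r \<le> q * ell2_norm h + e/2"
      using fg(2) ell2_norm_minus_commute[of h "\<lambda>v. g v - z * f v"] by (simp add: r_def)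
    obtain f' g' where fg': "(f', g') \<in> T" "ell2_norm (\<lambda>v. g' v - z * f' v - r v) \<le> q ^ n * ell2_norm r + e/2"
      using Suc.IH[OF r, of "e/2"] Suc.prems(2) by auto
    have qn: "q ^ n \<le> 1" using q by (simp add: power_le_one)
    have "(\<lambda>v. f v + 1 * f' v, \<lambda>v. g v + 1 * g' v) \<in> T" by (intro symmetric_rel_add fg fg')
    moreover have "ell2_norm (\<lambda>v. (g v + 1 * g' v) - z * (f v + 1 * f' v) - h v) \<le> q ^ Suc n * ell2_norm h + e"
    proof -
      have "ell2_norm (\<lambda>v. (g v + 1 * g' v) - z * (f v + 1 * f' v) - h v) = ell2_norm (\<lambda>v. g' v - z * f' v - r v)"
        by (simp add: r_def algebra_simps)
      also have "\<dots> \<le> q ^ n * ell2_norm r + e/2" by (rule fg')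
      also have "\<dots> \<le> q ^ n * (q * ell2_norm h + e/2) + e/2"
        using rn q by (intro add_right_mono mult_left_mono) auto
      also have "\<dots> = q ^ Suc n * ell2_norm h + q ^ n * (e/2) + e/2" by (simp add: algebra_simps)
      also have "q ^ n * (e/2) \<le> 1 * (e/2)" by (rule mult_right_mono[OF qn]) (use Suc.prems(2) in simp)
      finally show ?thesis by simp
    qed
    ultimately show ?case by blast
  qed
  fix h :: "'v \<Rightarrow> complex" and e :: real
  assume h: "h \<in> ell2" "0 < e"
  have "(\<lambda>n. q ^ n * ell2_norm h) \<longlonglongrightarrow> 0 * ell2_norm h"
    using q by (intro tendsto_intros LIMSEQ_realpow_zero)
  hence "\<forall>\<^sub>F n in sequentially. q ^ n * ell2_norm h < e/2"
    using h by (intro order_tendstoD(2)[of _ "0 * ell2_norm h"]) auto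
  then obtain n where "q ^ n * ell2_norm h < e/2" by (auto simp: eventually_sequentially)
  with iter[OF h(1), of "e/2" n] h(2)
  obtain f g where "(f, g) \<in> T" "ell2_norm (\<lambda>v. g v - z * f v - h v) \<le> q ^ n * ell2_norm h + e/2" by auto
  with \<open>q ^ n * ell2_norm h < e/2\<close>
  show "\<exists>f g. (f, g) \<in> T \<and> ell2_norm (\<lambda>v. g v - z * f v - h v) < e"
    by (intro exI[of _ f] exI[of _ g]) auto
qed

text \<open>A solution of the equation at \<open>w\<close> solves the equation at \<open>z\<close> up to \<open>(w - z) f\<close>, and the norm of \<open>f\<close>
  is at most that of the right hand side divided by \<open>\<bar>Im w\<bar>\<close>.\<close>

lemma dense_range_shift:
  assumes dense: "dense_range T w" and near: "cmod (z - w) < \<bar>Im w\<bar>"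
  shows "dense_range T z"
proof -
  define q where "q = cmod (z - w) / \<bar>Im w\<bar>"
  have Im: "\<bar>Im w\<bar> > 0" using near norm_ge_zero[of "z - w"] by linarith
  have q: "0 \<le> q" "q < 1" using near Im by (auto simp: q_def)
  show ?thesis
  proof (rule dense_range_contraction[OF q])
    fix h :: "'v \<Rightarrow> complex" and e :: real assume h: "h \<in> ell2" "e > 0"
    then obtain f g where fg: "(f, g) \<in> T" "ell2_norm (\<lambda>v. g v - w * f v - h v) < e/2"
      using dense unfolding dense_range_def by (meson half_gt_zero)
    have r: "(\<lambda>v. g v - w * f v) \<in> ell2" using fg by (intro symmetric_rel_residual_ell2)
    have "ell2_norm (\<lambda>v. g v - w * f v) \<le> ell2_norm h + e/2"
      using ell2_norm_le_add_diff[OF r h(1)] fg(2) by linarith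
    hence "\<bar>Im w\<bar> * ell2_norm f \<le> ell2_norm h + e/2"
      using symmetric_rel_bound[OF fg(1), of w] by linarith
    hence fb: "ell2_norm f \<le> (ell2_norm h + e/2) / \<bar>Im w\<bar>" using Im by (simp add: field_simps)
    have "ell2_norm (\<lambda>v. g v - z * f v - h v) = ell2_norm (\<lambda>v. (g v - w * f v - h v) + (w - z) * f v)"
      by (simp add: algebra_simps)
    also have "\<dots> \<le> ell2_norm (\<lambda>v. g v - w * f v - h v) + ell2_norm (\<lambda>v. (w - z) * f v)"
      by (intro ell2_add ell2_scale ell2_diff(1)[OF r h(1)] symmetric_rel_ell2(1)[OF fg(1)])
    also have "ell2_norm (\<lambda>v. (w - z) * f v) = cmod (z - w) * ell2_norm f"
      using ell2_scale(2)[OF symmetric_rel_ell2(1)[OF fg(1)]] by (simp add: norm_minus_commute)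
    also have "\<dots> \<le> cmod (z - w) * ((ell2_norm h + e/2) / \<bar>Im w\<bar>)"
      using fb by (intro mult_left_mono) auto
    also have "\<dots> = q * ell2_norm h + q * (e/2)" by (simp add: q_def add_divide_distrib distrib_left)
    also have "q * (e/2) \<le> e/2" using q h(2) by (simp add: mult_le_cancel_right1)
    finally have "ell2_norm (\<lambda>v. g v - z * f v - h v) \<le> q * ell2_norm h + e" using fg(2) by linarith
    with fg(1) show "\<exists>f g. (f, g) \<in> T \<and> ell2_norm (\<lambda>v. g v - z * f v - h v) \<le> q * ell2_norm h + e" by blast
  qed
qed

text \<open>The discs around \<open>Re z + i y\<close> of radius \<open>y\<close> exhaust the half plane, so one shift reaches
  every nonreal point from far up.\<close>

lemma dense_range_from_far:
  assumes "Im z > 0" and "\<And>w. Im w > b \<Longrightarrow> dense_range T w"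
  shows "dense_range T z"
proof -
  define y where "y = max (b + 1) (Im z)"
  have y: "y > b" "y \<ge> Im z" by (auto simp: y_def)
  have "z - Complex (Re z) y = Complex 0 (Im z - y)" by (simp add: complex_eq_iff)
  hence "cmod (z - Complex (Re z) y) = \<bar>Im z - y\<bar>" by (simp add: cmod_def)
  hence "cmod (z - Complex (Re z) y) < \<bar>Im (Complex (Re z) y)\<bar>" using assms(1) y by simp
  moreover have "dense_range T (Complex (Re z) y)" using y by (intro assms(2)) simp
  ultimately show ?thesis using dense_range_shift by blast
qed

lemma dense_range_basisI:
  assumes "\<And>u e. e > 0 \<Longrightarrow> \<exists>f g. (f, g) \<in> T \<and> ell2_norm (\<lambda>v. g v - z * f v - basis_vec u v) < e"
  shows "dense_range T z"
  unfolding dense_range_def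
proof (intro ballI allI impI)
  fix h :: "'v \<Rightarrow> complex" and e :: real
  assume h: "h \<in> ell2" "0 < e"
  obtain S where S: "finite S" "ell2_norm (\<lambda>v. h v - (if v \<in> S then h v else 0)) < e/2"
    using ell2_finite_approx[OF h(1), of "e/2"] h(2) by auto
  define d where "d = e / 2 / (1 + (\<Sum>u\<in>S. cmod (h u)))"
  have s1: "1 + (\<Sum>u\<in>S. cmod (h u)) > 0" by (intro add_pos_nonneg sum_nonneg) auto
  hence d: "d > 0" using h(2) by (simp add: d_def)
  have "\<forall>u. \<exists>p. (fst p, snd p) \<in> T \<and> ell2_norm (\<lambda>v. snd p v - z * fst p v - basis_vec u v) < d"
    using assms[OF d] by (metis fst_conv snd_conv)
  then obtain p where p: "\<And>u. (fst (p u), snd (p u)) \<in> T"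
    "\<And>u. ell2_norm (\<lambda>v. snd (p u) v - z * fst (p u) v - basis_vec u v) < d" by metis
  define f where "f = (\<lambda>v. \<Sum>u\<in>S. h u * fst (p u) v)"
  define g where "g = (\<lambda>v. \<Sum>u\<in>S. h u * snd (p u) v)"
  define hS where "hS = (\<lambda>v. if v \<in> S then h v else 0)"
  have hS_sum: "hS v = (\<Sum>u\<in>S. h u * basis_vec u v)" for v
    using S(1) by (simp add: hS_def basis_vec_def if_distrib[of "(*) _"] sum.delta cong: if_cong)
  have fg: "(f, g) \<in> T" unfolding f_def g_def by (rule symmetric_rel_sum) (rule p(1))
  have res: "(\<lambda>v. snd (p u) v - z * fst (p u) v - basis_vec u v) \<in> ell2" for u
    by (intro ell2_diff(1) symmetric_rel_residual_ell2 p basis_vec_ell2)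
  have hS: "hS \<in> ell2" using S(1) by (intro ell2_finite_support(1)[of S]) (auto simp: hS_def)
  have "ell2_norm (\<lambda>v. g v - z * f v - hS v)
      = ell2_norm (\<lambda>v. \<Sum>u\<in>S. h u * (snd (p u) v - z * fst (p u) v - basis_vec u v))"
    by (simp add: f_def g_def hS_sum sum_distrib_left sum_subtractf right_diff_distrib mult.left_commute)
  also have "\<dots> \<le> (\<Sum>u\<in>S. ell2_norm (\<lambda>v. h u * (snd (p u) v - z * fst (p u) v - basis_vec u v)))"
    by (intro ell2_norm_sum_le ell2_scale(1) res)
  also have "\<dots> = (\<Sum>u\<in>S. cmod (h u) * ell2_norm (\<lambda>v. snd (p u) v - z * fst (p u) v - basis_vec u v))"
    by (intro sum.cong refl ell2_scale(2) res)
  also have "\<dots> \<le> (\<Sum>u\<in>S. cmod (h u) * d)"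
    by (rule sum_mono, rule mult_left_mono, rule less_imp_le[OF p(2)]) simp
  also have "\<dots> = (\<Sum>u\<in>S. cmod (h u)) * d" by (simp add: sum_distrib_right)
  also have "\<dots> \<le> (1 + (\<Sum>u\<in>S. cmod (h u))) * d"
    using d by (intro mult_right_mono) auto
  also have "\<dots> = e / 2"
    using nonzero_mult_div_cancel_left[of "1 + (\<Sum>u\<in>S. cmod (h u))" "e / 2"] s1
    unfolding d_def times_divide_eq_right by linarith
  finally have 1: "ell2_norm (\<lambda>v. g v - z * f v - hS v) \<le> e / 2" .
  have "ell2_norm (\<lambda>v. g v - z * f v - h v)
      \<le> ell2_norm (\<lambda>v. g v - z * f v - hS v) + ell2_norm (\<lambda>v. hS v - h v)"
    using hS h by (intro ell2_norm_triangle_sub symmetric_rel_residual_ell2 fg)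
  also have "ell2_norm (\<lambda>v. hS v - h v) < e/2"
    using S(2) ell2_norm_minus_commute[of h hS] by (simp add: hS_def)
  finally have "ell2_norm (\<lambda>v. g v - z * f v - h v) < e" using 1 by linarith
  thus "\<exists>f g. (f, g) \<in> T \<and> ell2_norm (\<lambda>v. g v - z * f v - h v) < e" using fg by blast
qed

end

lemma ell2_norm_tendsto:
  assumes "\<And>n. F n \<in> ell2" "f \<in> ell2" "(\<lambda>n. ell2_norm (\<lambda>v. F n v - f v)) \<longlonglongrightarrow> 0"
  shows "(\<lambda>n. ell2_norm (F n)) \<longlonglongrightarrow> ell2_norm f"
proof (rule LIM_zero_cancel, rule Lim_null_comparison[OF _ assms(3)], rule always_eventually, rule allI)
  fix n
  show "norm (ell2_norm (F n) - ell2_norm f) \<le> ell2_norm (\<lambda>v. F n v - f v)"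
    using ell2_norm_le_add_diff[OF assms(1)[of n] assms(2)] ell2_norm_le_add_diff[OF assms(2) assms(1)[of n]]
      ell2_norm_minus_commute[of f "F n"] by auto
qed

lemma ell2_tendsto_lincomb:
  assumes "\<And>n. F n \<in> ell2" "f \<in> ell2" "(\<lambda>n. ell2_norm (\<lambda>v. F n v - f v)) \<longlonglongrightarrow> 0"
    and "\<And>n. G n \<in> ell2" "g \<in> ell2" "(\<lambda>n. ell2_norm (\<lambda>v. G n v - g v)) \<longlonglongrightarrow> 0"
  shows "(\<lambda>n. ell2_norm (\<lambda>v. (F n v + a * G n v) - (f v + a * g v))) \<longlonglongrightarrow> 0"
proof (rule Lim_null_comparison[OF always_eventually])
  show "(\<lambda>n. ell2_norm (\<lambda>v. F n v - f v) + cmod a * ell2_norm (\<lambda>v. G n v - g v)) \<longlonglongrightarrow> 0"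
    by (rule tendsto_eq_intros assms refl)+ simp
  show "\<forall>n. norm (ell2_norm (\<lambda>v. (F n v + a * G n v) - (f v + a * g v)))
      \<le> ell2_norm (\<lambda>v. F n v - f v) + cmod a * ell2_norm (\<lambda>v. G n v - g v)"
  proof
    fix n
    have "ell2_norm (\<lambda>v. (F n v - f v) + a * (G n v - g v))
        \<le> ell2_norm (\<lambda>v. F n v - f v) + ell2_norm (\<lambda>v. a * (G n v - g v))"
      by (intro ell2_add ell2_scale ell2_diff assms)
    also have "ell2_norm (\<lambda>v. a * (G n v - g v)) = cmod a * ell2_norm (\<lambda>v. G n v - g v)"
      by (intro ell2_scale ell2_diff assms)
    finally show "norm (ell2_norm (\<lambda>v. (F n v + a * G n v) - (f v + a * g v)))
      \<le> ell2_norm (\<lambda>v. F n v - f v) + cmod a * ell2_norm (\<lambda>v. G n v - g v)"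
      by (simp add: algebra_simps)
  qed
qed

lemma subset_op_closure:
  assumes "symmetric_rel T" "(f, g) \<in> T"
  shows "(f, g) \<in> op_closure T"
  unfolding op_closure_def mem_Collect_eq prod.case
  using assms symmetric_rel_ell2[OF assms] by (intro conjI exI[of _ "\<lambda>_. f"] exI[of _ "\<lambda>_. g"]) simp_all

lemma symmetric_rel_closure:
  assumes T: "symmetric_rel T"
  shows "symmetric_rel (op_closure T)"
  unfolding symmetric_rel_def
proof (intro conjI allI impI)
  show "op_closure T \<subseteq> ell2 \<times> ell2" by (auto simp: op_closure_def)
  show "(\<lambda>v. 0, \<lambda>v. 0) \<in> op_closure T" by (rule subset_op_closure[OF T symmetric_rel_zero[OF T]])
next
  fix f g f' g' a
  assume "(f, g) \<in> op_closure T"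
  then obtain F G where F: "f \<in> ell2" "g \<in> ell2" "\<And>n::nat. (F n, G n) \<in> T"
    "(\<lambda>n. ell2_norm (\<lambda>v. F n v - f v)) \<longlonglongrightarrow> 0" "(\<lambda>n. ell2_norm (\<lambda>v. G n v - g v)) \<longlonglongrightarrow> 0"
    by (auto simp: op_closure_def)
  assume "(f', g') \<in> op_closure T"
  then obtain F' G' where F': "f' \<in> ell2" "g' \<in> ell2" "\<And>n::nat. (F' n, G' n) \<in> T"
    "(\<lambda>n. ell2_norm (\<lambda>v. F' n v - f' v)) \<longlonglongrightarrow> 0" "(\<lambda>n. ell2_norm (\<lambda>v. G' n v - g' v)) \<longlonglongrightarrow> 0"
    by (auto simp: op_closure_def)
  note E = symmetric_rel_ell2[OF T F(3)] symmetric_rel_ell2[OF T F'(3)]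
  show "(\<lambda>v. f v + a * f' v, \<lambda>v. g v + a * g' v) \<in> op_closure T"
    unfolding op_closure_def mem_Collect_eq prod.case
  proof (intro conjI exI allI)
    show "(\<lambda>v. f v + a * f' v) \<in> ell2" "(\<lambda>v. g v + a * g' v) \<in> ell2"
      by (intro ell2_add(1) ell2_scale(1) F F')+
    show "(\<lambda>v. F n v + a * F' n v, \<lambda>v. G n v + a * G' n v) \<in> T" for n
      by (intro symmetric_rel_add T F F')
    show "(\<lambda>n. ell2_norm (\<lambda>v. F n v + a * F' n v - (f v + a * f' v))) \<longlonglongrightarrow> 0"
      by (intro ell2_tendsto_lincomb F F' E)
    show "(\<lambda>n. ell2_norm (\<lambda>v. G n v + a * G' n v - (g v + a * g' v))) \<longlonglongrightarrow> 0"
      by (intro ell2_tendsto_lincomb F F' E)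
  qed
next
  fix f g z
  assume "(f, g) \<in> op_closure T"
  then obtain F G where F: "f \<in> ell2" "g \<in> ell2" "\<And>n::nat. (F n, G n) \<in> T"
    "(\<lambda>n. ell2_norm (\<lambda>v. F n v - f v)) \<longlonglongrightarrow> 0" "(\<lambda>n. ell2_norm (\<lambda>v. G n v - g v)) \<longlonglongrightarrow> 0"
    by (auto simp: op_closure_def)
  note E = symmetric_rel_ell2[OF T F(3)]
  have "(\<lambda>n. ell2_norm (F n)) \<longlonglongrightarrow> ell2_norm f" by (intro ell2_norm_tendsto F E)
  hence 1: "(\<lambda>n. \<bar>Im z\<bar> * ell2_norm (F n)) \<longlonglongrightarrow> \<bar>Im z\<bar> * ell2_norm f" by (intro tendsto_intros)
  have "(\<lambda>n. ell2_norm (\<lambda>v. G n v + (-z) * F n v)) \<longlonglongrightarrow> ell2_norm (\<lambda>v. g v + (-z) * f v)"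
    by (intro ell2_norm_tendsto ell2_tendsto_lincomb F E ell2_add(1) ell2_scale(1))
  hence 2: "(\<lambda>n. ell2_norm (\<lambda>v. G n v - z * F n v)) \<longlonglongrightarrow> ell2_norm (\<lambda>v. g v - z * f v)" by simp
  show "\<bar>Im z\<bar> * ell2_norm f \<le> ell2_norm (\<lambda>v. g v - z * f v)"
    by (rule LIMSEQ_le[OF 1 2]) (use symmetric_rel_bound[OF T F(3)] in auto)
qed

text \<open>Surjectivity of the closed operator and density of the range of the original one are the
  same, since the lower bound makes preimages of a convergent sequence a Cauchy sequence.\<close>

lemma resolvent_set_iff_dense_range:
  assumes T: "symmetric_rel T" and z: "Im z \<noteq> 0"
  shows "z \<in> resolvent_set (op_closure T) \<longleftrightarrow> dense_range T z"
proof
  assume res: "z \<in> resolvent_set (op_closure T)"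
  show "dense_range T z"
    unfolding dense_range_def
  proof (intro ballI allI impI)
    fix h :: "'a \<Rightarrow> complex" and e :: real assume "h \<in> ell2" "0 < e"
    then obtain f where "(f, \<lambda>v. h v + z * f v) \<in> op_closure T"
      using res unfolding resolvent_set_def by blast
    then obtain F G where F: "f \<in> ell2" "(\<lambda>v. h v + z * f v) \<in> ell2" "\<And>n::nat. (F n, G n) \<in> T"
      "(\<lambda>n. ell2_norm (\<lambda>v. F n v - f v)) \<longlonglongrightarrow> 0" "(\<lambda>n. ell2_norm (\<lambda>v. G n v - (h v + z * f v))) \<longlonglongrightarrow> 0"
      by (auto simp: op_closure_def)
    have "(\<lambda>n. ell2_norm (\<lambda>v. G n v + (-z) * F n v - ((h v + z * f v) + (-z) * f v))) \<longlonglongrightarrow> 0"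
      by (intro ell2_tendsto_lincomb F symmetric_rel_ell2(1)[OF T F(3)] symmetric_rel_ell2(2)[OF T F(3)])
    hence "(\<lambda>n. ell2_norm (\<lambda>v. G n v - z * F n v - h v)) \<longlonglongrightarrow> 0" by simp
    hence "\<forall>\<^sub>F n in sequentially. ell2_norm (\<lambda>v. G n v - z * F n v - h v) < e"
      using \<open>0 < e\<close> by (rule order_tendstoD(2))
    then obtain n where "ell2_norm (\<lambda>v. G n v - z * F n v - h v) < e"
      by (auto simp: eventually_sequentially)
    thus "\<exists>f g. (f, g) \<in> T \<and> ell2_norm (\<lambda>v. g v - z * f v - h v) < e" using F(3) by blast
  qed
next
  assume dense: "dense_range T z"
  show "z \<in> resolvent_set (op_closure T)"
    unfolding resolvent_set_def mem_Collect_eq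
  proof (intro ballI)
    fix h :: "'a \<Rightarrow> complex" assume h: "h \<in> ell2"
    have "\<exists>p. (fst p, snd p) \<in> T \<and> ell2_norm (\<lambda>v. snd p v - z * fst p v - h v) < 1 / Suc n" for n
      using dense h unfolding dense_range_def by (metis fst_conv snd_conv of_nat_0_less_iff zero_less_Suc zero_less_divide_1_iff)
    then obtain p where p: "\<And>n. (fst (p n), snd (p n)) \<in> T"
      "\<And>n. ell2_norm (\<lambda>v. snd (p n) v - z * fst (p n) v - h v) < 1 / Suc n" by metis
    define F where "F n = fst (p n)" for n
    define G where "G n = snd (p n)" for n
    define r where "r n = (\<lambda>v. G n v - z * F n v)" for n
    have FG: "(F n, G n) \<in> T" for n using p by (simp add: F_def G_def)
    note E = symmetric_rel_ell2[OF T FG]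
    have r: "r n \<in> ell2" for n unfolding r_def by (rule symmetric_rel_residual_ell2[OF T FG])
    have small: "ell2_norm (\<lambda>v. r n v - h v) < 1 / Suc n" for n
      using p(2) by (simp add: r_def F_def G_def)
    have r0: "(\<lambda>n. ell2_norm (\<lambda>v. r n v - h v)) \<longlonglongrightarrow> 0"
    proof (rule Lim_null_comparison[OF always_eventually])
      show "(\<lambda>n. 1 / real (Suc n)) \<longlonglongrightarrow> 0" by (rule LIMSEQ_Suc[OF lim_1_over_n])
      show "\<forall>n. norm (ell2_norm (\<lambda>v. r n v - h v)) \<le> 1 / real (Suc n)" using small by (simp add: less_imp_le)
    qed
    have bd: "\<bar>Im z\<bar> * ell2_norm (\<lambda>v. F m v - F n v) \<le> 1 / Suc m + 1 / Suc n" for m n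
    proof -
      have "(\<lambda>v. F m v + (-1) * F n v, \<lambda>v. G m v + (-1) * G n v) \<in> T" by (intro symmetric_rel_add T FG)
      from symmetric_rel_bound[OF T this, of z]
      have "\<bar>Im z\<bar> * ell2_norm (\<lambda>v. F m v - F n v) \<le> ell2_norm (\<lambda>v. r m v - r n v)"
        by (simp add: r_def algebra_simps)
      also have "\<dots> \<le> ell2_norm (\<lambda>v. r m v - h v) + ell2_norm (\<lambda>v. h v - r n v)"
        by (intro ell2_norm_triangle_sub r h)
      also have "\<dots> \<le> 1 / Suc m + 1 / Suc n"
        using small[of m] small[of n] ell2_norm_minus_commute[of h "r n"] by linarith
      finally show ?thesis .
    qed
    have "\<exists>l\<in>ell2. (\<lambda>n. ell2_norm (\<lambda>v. F n v - l v)) \<longlonglongrightarrow> 0"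
    proof (rule ell2_complete[OF E(1)])
      fix e :: real assume "e > 0"
      hence "\<bar>Im z\<bar> * e / 2 > 0" using z by auto
      then obtain N where N: "1 / Suc N < \<bar>Im z\<bar> * e / 2" using nat_approx_posE by blast
      have "ell2_norm (\<lambda>v. F m v - F n v) < e" if "m \<ge> N" "n \<ge> N" for m n
      proof -
        have "1 / Suc m \<le> 1 / real (Suc N)" "1 / Suc n \<le> 1 / real (Suc N)"
          using that by (auto intro!: frac_le)
        hence "\<bar>Im z\<bar> * ell2_norm (\<lambda>v. F m v - F n v) < \<bar>Im z\<bar> * e" using bd[of m n] N by linarith
        thus ?thesis using z by simp
      qed
      thus "\<exists>N. \<forall>m\<ge>N. \<forall>n\<ge>N. ell2_norm (\<lambda>v. F m v - F n v) < e" by blast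
    qed
    then obtain f where f: "f \<in> ell2" "(\<lambda>n. ell2_norm (\<lambda>v. F n v - f v)) \<longlonglongrightarrow> 0" by blast
    have "(\<lambda>n. ell2_norm (\<lambda>v. (r n v + z * F n v) - (h v + z * f v))) \<longlonglongrightarrow> 0"
      by (intro ell2_tendsto_lincomb r h r0 f E)
    hence "(\<lambda>n. ell2_norm (\<lambda>v. G n v - (h v + z * f v))) \<longlonglongrightarrow> 0" by (simp add: r_def)
    hence "(f, \<lambda>v. h v + z * f v) \<in> op_closure T"
      unfolding op_closure_def mem_Collect_eq prod.case
      by (intro conjI exI[of _ F] exI[of _ G] f ell2_add(1) ell2_scale(1) h allI FG)
    thus "\<exists>!f. (f, \<lambda>v. h v + z * f v) \<in> op_closure T"
      using symmetric_rel_resolvent_unique[OF symmetric_rel_closure[OF T] z] by blast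
  qed
qed

lemma resolvent_mem:
  assumes "z \<in> resolvent_set T" "h \<in> ell2"
  shows "(resolvent T z h, \<lambda>v. h v + z * resolvent T z h v) \<in> T"
  using assms theI'[of "\<lambda>f. (f, \<lambda>v. h v + z * f v) \<in> T"]
  unfolding resolvent_def resolvent_set_def by blast

lemma resolvent_eqI:
  assumes "z \<in> resolvent_set T" "h \<in> ell2" "(f, \<lambda>v. h v + z * f v) \<in> T"
  shows "resolvent T z h = f"
  using assms unfolding resolvent_def resolvent_set_def by (intro the1_equality) auto

lemma resolvent_entry_eq:
  "z \<in> resolvent_set T \<Longrightarrow> resolvent_entry T z u v = resolvent T z (basis_vec v) u"
  by (simp add: resolvent_entry_def)

text \<open>An entry of the resolvent can be computed from any vectors whose images under \<open>T - z\<close> approach a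
  multiple of a basis vector, because the lower bound turns small residuals into small errors.\<close>

lemma resolvent_entry_approx:
  fixes T :: "'v ell2_op" and u v :: 'v
  assumes T: "symmetric_rel T" and z: "z \<in> resolvent_set T" and fg: "(f, g) \<in> T"
  shows "\<bar>Im z\<bar> * cmod (f u - a * resolvent_entry T z u v) \<le> ell2_norm (\<lambda>w. g w - z * f w - a * basis_vec v w)"
proof -
  let ?r = "resolvent T z (basis_vec v)"
  have r: "(?r, \<lambda>w. basis_vec v w + z * ?r w) \<in> T" by (rule resolvent_mem[OF z basis_vec_ell2])
  have "(\<lambda>w. f w + (-a) * ?r w, \<lambda>w. g w + (-a) * (basis_vec v w + z * ?r w)) \<in> T"
    by (intro symmetric_rel_add T fg r)
  note d = symmetric_rel_bound[OF T this, of z] symmetric_rel_ell2(1)[OF T this]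
  have "\<bar>Im z\<bar> * cmod (f u - a * ?r u) \<le> \<bar>Im z\<bar> * ell2_norm (\<lambda>w. f w + (-a) * ?r w)"
    using cmod_le_ell2_norm[OF d(2), of u] by (intro mult_left_mono) auto
  also have "\<dots> \<le> ell2_norm (\<lambda>w. g w - z * f w - a * basis_vec v w)"
    using d(1) by (simp add: algebra_simps)
  finally show ?thesis using z by (simp add: resolvent_entry_eq)
qed

lemma cmod_resolvent_entry_le:
  fixes u v :: 'v
  assumes T: "symmetric_rel T" and "Im z \<noteq> 0"
  shows "cmod (resolvent_entry T z u v) \<le> 1 / \<bar>Im z\<bar>"
proof (cases "z \<in> resolvent_set T")
  case True
  have "\<bar>Im z\<bar> * cmod (resolvent_entry T z u v) \<le> 1"
    using resolvent_entry_approx[OF T True symmetric_rel_zero[OF T], where u=u and a=1 and v=v]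
      ell2_norm_cmod_cong[of "\<lambda>w. - basis_vec v w" "basis_vec v"] by simp
  thus ?thesis using assms(2) by (simp add: field_simps)
qed (simp add: resolvent_entry_def)

lemma op_closureI:
  assumes "f \<in> ell2" "g \<in> ell2" "\<And>n::nat. (F n, G n) \<in> T"
    "(\<lambda>n. ell2_norm (\<lambda>v. F n v - f v)) \<longlonglongrightarrow> 0" "(\<lambda>n. ell2_norm (\<lambda>v. G n v - g v)) \<longlonglongrightarrow> 0"
  shows "(f, g) \<in> op_closure T"
  using assms unfolding op_closure_def by blast

section \<open>Operators given by symmetric matrices\<close>

definition mat_apply :: "('v \<Rightarrow> 'v \<Rightarrow> real) \<Rightarrow> ('v \<Rightarrow> complex) \<Rightarrow> 'v \<Rightarrow> complex" where
  "mat_apply A f = (\<lambda>u. \<Sum>v | f v \<noteq> 0. complex_of_real (A u v) * f v)"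

definition mat_core :: "('v \<Rightarrow> 'v \<Rightarrow> real) \<Rightarrow> 'v ell2_op" where
  "mat_core A = {(f, g). finite {v. f v \<noteq> 0} \<and> g = mat_apply A f \<and> g \<in> ell2}"

lemma conductance_core_eq: "conductance_core adj W = mat_core (conductance adj W)"
  by (simp add: conductance_core_def mat_core_def mat_apply_def)

lemma mat_apply_superset:
  assumes "finite S" "\<And>v. v \<notin> S \<Longrightarrow> f v = 0"
  shows "mat_apply A f u = (\<Sum>v\<in>S. complex_of_real (A u v) * f v)"
  unfolding mat_apply_def using assms by (intro sum.mono_neutral_left) auto

lemma mat_apply_basis_vec: "mat_apply A (basis_vec u) = (\<lambda>v. complex_of_real (A v u))"
  by (rule ext, subst mat_apply_superset[of "{u}"]) (auto simp: basis_vec_def)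

lemma mat_apply_add:
  assumes "finite {v. f v \<noteq> 0}" "finite {v. g v \<noteq> 0}"
  shows "mat_apply A (\<lambda>v. f v + a * g v) u = mat_apply A f u + a * mat_apply A g u"
proof -
  let ?S = "{v. f v \<noteq> 0} \<union> {v. g v \<noteq> 0}"
  have "mat_apply A (\<lambda>v. f v + a * g v) u = (\<Sum>v\<in>?S. complex_of_real (A u v) * (f v + a * g v))"
    using assms by (intro mat_apply_superset) auto
  moreover have "mat_apply A f u = (\<Sum>v\<in>?S. complex_of_real (A u v) * f v)"
    using assms by (intro mat_apply_superset) auto
  moreover have "mat_apply A g u = (\<Sum>v\<in>?S. complex_of_real (A u v) * g v)"
    using assms by (intro mat_apply_superset) auto
  ultimately show ?thesis by (simp add: distrib_left sum.distrib sum_distrib_left mult.left_commute)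
qed

text \<open>For finitely supported \<open>f\<close> the form \<open>\<langle>f, A f\<rangle>\<close> is a finite double sum that equals its conjugate.\<close>

lemma symmetric_rel_mat_core:
  assumes A: "\<And>u v. A u v = A v u"
  shows "symmetric_rel (mat_core A)"
  unfolding symmetric_rel_def
proof (intro conjI allI impI)
  show "mat_core A \<subseteq> ell2 \<times> ell2"
    using ell2_finite_support(1) by (fastforce simp: mat_core_def)
  show "(\<lambda>v. 0, \<lambda>v. 0) \<in> mat_core A" by (simp add: mat_core_def mat_apply_def)
next
  fix f g f' g' a assume fg: "(f, g) \<in> mat_core A" "(f', g') \<in> mat_core A"
  have "finite {v. f v + a * f' v \<noteq> 0}"
    by (rule finite_subset[of _ "{v. f v \<noteq> 0} \<union> {v. f' v \<noteq> 0}"]) (use fg in \<open>auto simp: mat_core_def\<close>)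
  moreover have "(\<lambda>v. g v + a * g' v) \<in> ell2"
    using fg by (intro ell2_add(1) ell2_scale(1)) (auto simp: mat_core_def)
  ultimately show "(\<lambda>v. f v + a * f' v, \<lambda>v. g v + a * g' v) \<in> mat_core A"
    using fg by (auto simp: mat_core_def mat_apply_add)
next
  fix f g z assume fg: "(f, g) \<in> mat_core A"
  define S where "S = {v. f v \<noteq> 0}"
  have S: "finite S" and g: "g = mat_apply A f" "g \<in> ell2" using fg by (auto simp: mat_core_def S_def)
  have f: "f \<in> ell2" using S by (intro ell2_finite_support(1)[of S]) (auto simp: S_def)
  have r: "(\<lambda>v. g v - z * f v) \<in> ell2" by (intro ell2_diff(1) ell2_scale(1) f g)
  define q where "q = (\<Sum>u\<in>S. \<Sum>v\<in>S. complex_of_real (A u v) * cnj (f u) * f v)"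
  have "cnj q = (\<Sum>u\<in>S. \<Sum>v\<in>S. complex_of_real (A v u) * cnj (f v) * f u)"
    unfolding q_def using A by (simp add: mult_ac)
  also have "\<dots> = q" unfolding q_def by (rule sum.swap)
  finally have "Im q = 0" by (simp add: complex_eq_iff)
  have "(\<Sum>u\<in>S. cnj (f u) * (g u - z * f u)) = q - z * (\<Sum>u\<in>S. cnj (f u) * f u)"
    unfolding g q_def mat_apply_def S_def[symmetric]
    by (simp add: right_diff_distrib sum_subtractf sum_distrib_left mult_ac)
  also have "(\<Sum>u\<in>S. cnj (f u) * f u) = complex_of_real ((ell2_norm f)\<^sup>2)"
  proof -
    have "(ell2_norm f)\<^sup>2 = (\<Sum>u\<in>S. (cmod (f u))\<^sup>2)"
      using S by (subst ell2_finite_support(2)[of S]) (auto simp: S_def L2_set_def sum_nonneg)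
    moreover have "complex_of_real ((cmod (f u))\<^sup>2) = cnj (f u) * f u" for u
      by (subst complex_norm_square) (rule mult.commute)
    ultimately show ?thesis by (simp only: of_real_sum)
  qed
  finally have e1: "\<bar>Im (\<Sum>u\<in>S. cnj (f u) * (g u - z * f u))\<bar> = \<bar>Im z\<bar> * (ell2_norm f)\<^sup>2"
    using \<open>Im q = 0\<close> by (simp only: minus_complex.sel times_complex.sel Re_complex_of_real Im_complex_of_real)
      (simp add: abs_mult)
  have e2: "\<bar>Im (\<Sum>u\<in>S. cnj (f u) * (g u - z * f u))\<bar> \<le> ell2_norm f * ell2_norm (\<lambda>v. g v - z * f v)"
    using ell2_cauchy_schwarz[OF f r S] abs_Im_le_cmod order_trans by blast
  have "\<bar>Im z\<bar> * (ell2_norm f)\<^sup>2 = ell2_norm f * (\<bar>Im z\<bar> * ell2_norm f)"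
    by (simp add: power2_eq_square mult_ac)
  with e1 e2 have *: "ell2_norm f * (\<bar>Im z\<bar> * ell2_norm f) \<le> ell2_norm f * ell2_norm (\<lambda>v. g v - z * f v)"
    by linarith
  show "\<bar>Im z\<bar> * ell2_norm f \<le> ell2_norm (\<lambda>v. g v - z * f v)"
  proof (cases "ell2_norm f = 0")
    case False
    hence "ell2_norm f > 0" using ell2_norm_nonneg[of f] by linarith
    with * show ?thesis by simp
  qed simp
qed

text \<open>Conjugating with diagonal signs, complex conjugation and a change of sign of the matrix all
  arise from isometries of the space; \<open>t\<close> is the sign of the matrix and \<open>\<theta>\<close> is the identity or
  complex conjugation.\<close>

lemma resolvent_entry_twist:
  fixes s :: "'v \<Rightarrow> real" and t :: real and \<theta> :: "complex \<Rightarrow> complex"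
  assumes s: "\<And>v. s v = 1 \<or> s v = -1" and t: "t = 1 \<or> t = -1"
    and \<theta>: "\<theta> = id \<or> \<theta> = cnj"
    and A': "\<And>u v. A' u v = t * s u * s v * A u v" and o: "s o' = 1"
  shows "resolvent_entry (op_closure (mat_core A')) (t * \<theta> z) o' o'
       = t * \<theta> (resolvent_entry (op_closure (mat_core A)) z o' o')"
proof -
  have \<theta>_simps: "\<theta> (x + y) = \<theta> x + \<theta> y" "\<theta> (x * y) = \<theta> x * \<theta> y" "\<theta> (x - y) = \<theta> x - \<theta> y"
    "\<theta> (complex_of_real r) = complex_of_real r" "\<theta> (\<theta> x) = x" "cmod (\<theta> x) = cmod x"
    "\<theta> (sum k I) = (\<Sum>i\<in>I. \<theta> (k i))" "\<theta> x = 0 \<longleftrightarrow> x = 0" "\<theta> 0 = 0" "\<theta> 1 = 1"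
    for x y r k and I :: "'v set"
    using \<theta> by auto
  \<comment> \<open>\<open>J\<close> acts on the arguments and \<open>K\<close> on the values; the factor \<open>t\<close> sits in \<open>J\<close> so that \<open>K\<close> fixes
    the basis vector at \<open>o'\<close>.\<close>
  define J where "J f = (\<lambda>v. complex_of_real (t * s v) * \<theta> (f v))" for f
  define K where "K f = (\<lambda>v. complex_of_real (s v) * \<theta> (f v))" for f
  have st: "s v * s v = 1" "t * t = 1" "\<bar>s v\<bar> = 1" "\<bar>t\<bar> = 1" "s v \<noteq> 0" "t \<noteq> 0" for v
    using s[of v] t by auto
  have cst: "complex_of_real (s v) * complex_of_real (s v) = 1" "complex_of_real t * complex_of_real t = 1" for v
    by (metis st(1) of_real_mult of_real_1) (metis st(2) of_real_mult of_real_1)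
  have JJ: "J (J f) = f" and KK: "K (K f) = f" for f
    unfolding J_def K_def fun_eq_iff using cst by (simp_all add: \<theta>_simps) (metis mult.assoc mult.left_commute mult_1)+
  have norms: "cmod (J f v - J g v) = cmod (f v - g v)" "cmod (K f v - K g v) = cmod (f v - g v)"
    "cmod (J f v) = cmod (f v)" "cmod (K f v) = cmod (f v)" for f g v
  proof -
    have "cmod (\<theta> x - \<theta> y) = cmod (x - y)" for x y by (metis \<theta>_simps(3,6))
    thus "cmod (J f v - J g v) = cmod (f v - g v)" "cmod (K f v - K g v) = cmod (f v - g v)"
      unfolding J_def K_def right_diff_distrib[symmetric] using st by (simp_all add: norm_mult)
    show "cmod (J f v) = cmod (f v)" "cmod (K f v) = cmod (f v)"
      unfolding J_def K_def using st by (simp_all add: norm_mult \<theta>_simps)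
  qed
  have core: "(J f, K g) \<in> mat_core B'"
    if B': "\<And>u v. B' u v = t * s u * s v * B u v" and fg: "(f, g) \<in> mat_core B" for B B' f g
  proof -
    have supp: "{v. J f v \<noteq> 0} = {v. f v \<noteq> 0}"
      by (auto simp: J_def st \<theta>_simps)
    have "mat_apply B' (J f) u = K (mat_apply B f) u" for u
    proof -
      have "complex_of_real (B' u v) * J f v = complex_of_real (s u) * (complex_of_real (B u v) * \<theta> (f v))" for v
      proof -
        have "complex_of_real (B' u v) * J f v = (complex_of_real t * complex_of_real t) *
            (complex_of_real (s v) * complex_of_real (s v)) * (complex_of_real (s u) * (complex_of_real (B u v) * \<theta> (f v)))"
          by (simp add: J_def B')
        thus ?thesis by (simp only: cst mult_1)
      qed
      thus ?thesis unfolding mat_apply_def supp K_def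
        by (simp add: \<theta>_simps sum_distrib_left)
    qed
    moreover have "K g \<in> ell2" using fg ell2_cmod_cong[of "K g" g] by (auto simp: norms mat_core_def)
    ultimately show ?thesis using fg supp by (auto simp: mat_core_def)
  qed
  have clos: "(J f, K g) \<in> op_closure (mat_core B')"
    if B': "\<And>u v. B' u v = t * s u * s v * B u v" and fg: "(f, g) \<in> op_closure (mat_core B)" for B B' f g
  proof -
    obtain F G where F: "f \<in> ell2" "g \<in> ell2" "\<And>n::nat. (F n, G n) \<in> mat_core B"
    "(\<lambda>n. ell2_norm (\<lambda>v. F n v - f v)) \<longlonglongrightarrow> 0" "(\<lambda>n. ell2_norm (\<lambda>v. G n v - g v)) \<longlonglongrightarrow> 0"
      using fg by (auto simp: op_closure_def)
    have "ell2_norm (\<lambda>v. J (F n) v - J f v) = ell2_norm (\<lambda>v. F n v - f v)"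
      "ell2_norm (\<lambda>v. K (G n) v - K g v) = ell2_norm (\<lambda>v. G n v - g v)" for n
      by (intro ell2_norm_cmod_cong norms)+
    moreover have "J f \<in> ell2" "K g \<in> ell2"
      using F(1,2) ell2_cmod_cong[of "J f" f] ell2_cmod_cong[of "K g" g] by (auto simp: norms)
    moreover have "(J (F n), K (G n)) \<in> mat_core B'" for n by (rule core[OF B' F(3)])
    ultimately show ?thesis using F(4,5) by (intro op_closureI[of _ _ "\<lambda>n. J (F n)" "\<lambda>n. K (G n)"]) simp_all
  qed
  have A: "A u v = t * s u * s v * A' u v" for u v
    using s[of u] s[of v] t by (auto simp: A')
  let ?T = "op_closure (mat_core A)" and ?T' = "op_closure (mat_core A')"
  let ?w = "t * \<theta> z"
  have K_line: "K (\<lambda>v. h v + z * f v) = (\<lambda>v. K h v + ?w * J f v)" for h f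
  proof
    fix v
    have "K (\<lambda>v. h v + z * f v) v = K h v + \<theta> z * (complex_of_real (s v) * \<theta> (f v))"
      by (simp add: K_def \<theta>_simps algebra_simps)
    also have "\<dots> = K h v + (complex_of_real t * complex_of_real t) * (\<theta> z * (complex_of_real (s v) * \<theta> (f v)))"
      by (simp only: cst mult_1)
    also have "\<dots> = K h v + ?w * J f v" by (simp add: J_def)
    finally show "K (\<lambda>v. h v + z * f v) v = K h v + ?w * J f v" .
  qed
  have iff: "(f, \<lambda>v. h v + z * f v) \<in> ?T \<longleftrightarrow> (J f, \<lambda>v. K h v + ?w * J f v) \<in> ?T'" for f h
    using clos[OF A', of f "\<lambda>v. h v + z * f v"] clos[OF A, of "J f" "K (\<lambda>v. h v + z * f v)"]
    by (auto simp: K_line[symmetric] JJ KK)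
  have ell2_K: "K h \<in> ell2 \<longleftrightarrow> h \<in> ell2" for h
    using ell2_cmod_cong[of "K h" h] by (simp add: norms)
  have ex1: "(\<exists>!f. (f, \<lambda>v. h v + z * f v) \<in> ?T) \<longleftrightarrow> (\<exists>!f. (f, \<lambda>v. K h v + ?w * f v) \<in> ?T')" for h
  proof -
    have *: "(\<exists>!f. P (J f)) \<longleftrightarrow> (\<exists>!f. P f)" for P
    proof
      assume "\<exists>!f. P (J f)"
      then obtain f where f: "P (J f)" "\<And>g. P (J g) \<Longrightarrow> g = f" by blast
      show "\<exists>!f. P f"
      proof (rule ex1I[of P, OF f(1)])
        fix g assume "P g"
        hence "J g = f" using f(2)[of "J g"] by (simp add: JJ)
        thus "g = J f" using JJ by metis
      qed
    next
      assume "\<exists>!f. P f"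
      then obtain f where f: "P f" "\<And>g. P g \<Longrightarrow> g = f" by blast
      show "\<exists>!f. P (J f)"
      proof (rule ex1I[of _ "J f"])
        show "P (J (J f))" using f(1) by (simp add: JJ)
        fix g assume "P (J g)"
        hence "J g = f" by (rule f(2))
        thus "g = J f" using JJ by metis
      qed
    qed
    show ?thesis
      using *[of "\<lambda>f. (f, \<lambda>v. K h v + ?w * f v) \<in> ?T'"] by (simp only: iff)
  qed
  have res: "z \<in> resolvent_set ?T \<longleftrightarrow> ?w \<in> resolvent_set ?T'"
  proof -
    have "(\<forall>h\<in>ell2. Q (K h)) \<longleftrightarrow> (\<forall>h\<in>ell2. Q h)" for Q
    proof (intro iffI ballI)
      fix h :: "'v \<Rightarrow> complex" assume "\<forall>h\<in>ell2. Q (K h)" "h \<in> ell2"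
      hence "Q (K (K h))" using ell2_K by blast
      thus "Q h" by (simp only: KK)
    next
      fix h :: "'v \<Rightarrow> complex" assume "\<forall>h\<in>ell2. Q h" "h \<in> ell2"
      thus "Q (K h)" using ell2_K by blast
    qed
    from this[of "\<lambda>h. \<exists>!f. (f, \<lambda>v. h v + ?w * f v) \<in> ?T'"] show ?thesis
      unfolding resolvent_set_def mem_Collect_eq ex1 by simp
  qed
  show ?thesis
  proof (cases "z \<in> resolvent_set ?T")
    case True
    let ?r = "resolvent ?T z (basis_vec o')"
    have K0: "K (basis_vec o') = basis_vec o'" by (auto simp: K_def basis_vec_def o \<theta>_simps)
    have "(?r, \<lambda>v. basis_vec o' v + z * ?r v) \<in> ?T" by (rule resolvent_mem[OF True basis_vec_ell2])
    hence "(J ?r, \<lambda>v. basis_vec o' v + ?w * J ?r v) \<in> ?T'" using iff K0 by metis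
    hence "resolvent ?T' ?w (basis_vec o') = J ?r"
      using True res by (intro resolvent_eqI) auto
    thus ?thesis using True res by (simp add: resolvent_entry_eq J_def o)
  next
    case False
    thus ?thesis using res by (simp add: resolvent_entry_def \<theta>_simps)
  qed
qed

section \<open>Tree matrices\<close>

text \<open>The weight \<open>c v k\<close> belongs to the edge between \<open>v\<close> and its child \<open>v @ [k]\<close>.\<close>

definition tree_matrix :: "(nat list \<Rightarrow> nat \<Rightarrow> real) \<Rightarrow> nat list \<Rightarrow> nat list \<Rightarrow> real" where
  "tree_matrix c u v = (if u \<noteq> [] \<and> butlast u = v then c v (last u)
     else if v \<noteq> [] \<and> butlast v = u then c u (last v) else 0)"

definition tree_rel :: "(nat list \<Rightarrow> nat \<Rightarrow> real) \<Rightarrow> nat list ell2_op" where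
  "tree_rel c = mat_core (tree_matrix c)"

definition tree_resolvent :: "complex \<Rightarrow> (nat list \<Rightarrow> nat \<Rightarrow> real) \<Rightarrow> complex" where
  "tree_resolvent z c = resolvent_entry (op_closure (tree_rel c)) z [] []"


lemma tree_matrix_commute: "tree_matrix c u v = tree_matrix c v u"
  by (cases u rule: rev_cases; cases v rule: rev_cases) (auto simp: tree_matrix_def butlast_append)

lemma tree_matrix_child [simp]: "tree_matrix c u (u @ [k]) = c u k" "tree_matrix c (u @ [k]) u = c u k"
proof -
  have "butlast u \<noteq> u @ [k]" by (auto dest: arg_cong[where f = length])
  thus "tree_matrix c u (u @ [k]) = c u k" "tree_matrix c (u @ [k]) u = c u k"
    by (auto simp: tree_matrix_def)
qed

lemma tree_matrix_Nil_Cons [simp]: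
  "tree_matrix c [] [] = 0"
  "tree_matrix c [] (k # v) = (if v = [] then c [] k else 0)"
  "tree_matrix c (k # v) [] = (if v = [] then c [] k else 0)"
  by (auto simp: tree_matrix_def)

lemma tree_matrix_Cons_Cons [simp]:
  "tree_matrix c (k # u) (l # v) = (if k = l then tree_matrix (\<lambda>w. c (k # w)) u v else 0)"
  by (auto simp: tree_matrix_def)

lemma symmetric_tree_rel: "symmetric_rel (tree_rel c)"
  unfolding tree_rel_def by (rule symmetric_rel_mat_core) (rule tree_matrix_commute)

lemma symmetric_tree_closure: "symmetric_rel (op_closure (tree_rel c))"
  by (intro symmetric_rel_closure symmetric_tree_rel)

lemma cmod_tree_resolvent_le: "Im z > 0 \<Longrightarrow> cmod (tree_resolvent z c) \<le> 1 / Im z"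
  using cmod_resolvent_entry_le[OF symmetric_tree_closure, of z] by (simp add: tree_resolvent_def)

lemma conductance_eq_tree_matrix:
  assumes "\<And>u v. W u v = W v u"
  shows "conductance word_adj W = tree_matrix (\<lambda>u k. real_of_ereal (1 / W u (u @ [k])))"
proof (intro ext)
  fix u v
  consider k where "v = u @ [k]" | k where "u = v @ [k]" | "\<not> word_adj u v"
    by (auto simp: word_adj_def)
  thus "conductance word_adj W u v = tree_matrix (\<lambda>u k. real_of_ereal (1 / W u (u @ [k]))) u v"
  proof cases
    case 3
    hence "tree_matrix (\<lambda>u k. real_of_ereal (1 / W u (u @ [k]))) u v = 0"
      unfolding tree_matrix_def word_adj_def by (metis append_butlast_last_id)
    thus ?thesis using 3 by (simp add: conductance_def)
  qed (auto simp: conductance_def word_adj_def assms[of "v @ _" v])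
qed

lemma root_resolvent_eq_tree_resolvent:
  assumes "\<And>u v. W \<omega> u v = W \<omega> v u"
  shows "root_resolvent W z \<omega> = tree_resolvent z (\<lambda>u k. real_of_ereal (1 / W \<omega> u (u @ [k])))"
  unfolding root_resolvent_def tree_resolvent_def conductance_op_def conductance_core_eq tree_rel_def
  by (subst conductance_eq_tree_matrix) (use assms in auto)

text \<open>A tree is bipartite, so changing the sign of every odd level turns the matrix into its
  negative.\<close>

lemma tree_resolvent_reflect: "tree_resolvent (- cnj z) c = - cnj (tree_resolvent z c)"
proof -
  have "tree_matrix c u v = -1 * (-1) ^ length u * (-1) ^ length v * tree_matrix c u v" for u v
  proof -
    consider k where "v = u @ [k]" | k where "u = v @ [k]" | "tree_matrix c u v = 0"
      unfolding tree_matrix_def by (metis append_butlast_last_id)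
    thus ?thesis by cases (auto simp flip: power_add)
  qed
  moreover have "(-1) ^ length v = (1::real) \<or> (-1) ^ length v = (-1::real)" for v :: "nat list"
    by (cases "even (length v)") auto
  ultimately show ?thesis
    using resolvent_entry_twist[of "\<lambda>v. (-1) ^ length v" "-1" cnj "tree_matrix c" "tree_matrix c" "[]" z]
    unfolding tree_resolvent_def tree_rel_def by simp
qed

text \<open>On a tree the signs of the weights can be removed by a diagonal sign matrix: the sign at a
  vertex is the product of the signs along the path from the root.\<close>

lemma tree_resolvent_abs: "tree_resolvent z (\<lambda>u k. \<bar>c u k\<bar>) = tree_resolvent z c"
proof -
  define sg where "sg x = (if x < 0 then -1 else 1 :: real)" for x :: real
  define s where "s u = (\<Prod>i<length u. sg (c (take i u) (u ! i)))" for u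
  have s_Nil: "s [] = 1" by (simp add: s_def)
  have s_snoc: "s (u @ [k]) = s u * sg (c u k)" for u k
  proof -
    have "(\<Prod>i<length u. sg (c (take i (u @ [k])) ((u @ [k]) ! i))) = s u"
      unfolding s_def by (intro prod.cong) (auto simp: nth_append)
    thus ?thesis by (simp add: s_def)
  qed
  have s_sign: "s u = 1 \<or> s u = -1" for u
    by (induction u rule: rev_induct) (auto simp: s_Nil s_snoc sg_def)
  have ss: "s u * s u = 1" for u using s_sign[of u] by auto
  have sg: "sg x * x = \<bar>x\<bar>" for x by (auto simp: sg_def)
  have "tree_matrix (\<lambda>u k. \<bar>c u k\<bar>) u v = 1 * s u * s v * tree_matrix c u v" for u v
  proof -
    consider k where "v = u @ [k]" | k where "u = v @ [k]" | "u = [] \<or> butlast u \<noteq> v" "v = [] \<or> butlast v \<noteq> u"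
      by (metis append_butlast_last_id)
    thus ?thesis
    proof cases
      case (1 k)
      have "1 * s u * s v * tree_matrix c u v = (s u * s u) * (sg (c u k) * c u k)" using 1 by (simp add: s_snoc)
      thus ?thesis using 1 by (simp only: ss sg tree_matrix_child mult_1)
    next
      case (2 k)
      have "1 * s u * s v * tree_matrix c u v = (s v * s v) * (sg (c v k) * c v k)" using 2 by (simp add: s_snoc)
      thus ?thesis using 2 by (simp only: ss sg tree_matrix_child mult_1)
    next
      case 3
      thus ?thesis by (auto simp: tree_matrix_def)
    qed
  qed
  thus ?thesis
    using resolvent_entry_twist[of s 1 id "tree_matrix (\<lambda>u k. \<bar>c u k\<bar>)" "tree_matrix c" "[]" z] s_sign s_Nil
    unfolding tree_resolvent_def tree_rel_def by simp
qed

section \<open>The Schur complement at the root\<close>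

lemma ell2_reindex:
  assumes "inj \<phi>" "\<And>x. f (\<phi> x) = g x" "\<And>u. u \<notin> range \<phi> \<Longrightarrow> f u = 0"
  shows "f \<in> ell2 \<longleftrightarrow> g \<in> ell2" and "ell2_norm f = ell2_norm g"
proof -
  have "(\<lambda>v. (cmod (f v))\<^sup>2) summable_on UNIV \<longleftrightarrow> (\<lambda>v. (cmod (f v))\<^sup>2) summable_on range \<phi>"
    using assms(3) by (intro summable_on_cong_neutral) auto
  also have "\<dots> \<longleftrightarrow> (\<lambda>v. (cmod (g v))\<^sup>2) summable_on UNIV"
    by (subst summable_on_reindex[OF assms(1)]) (simp add: o_def assms(2))
  finally show "f \<in> ell2 \<longleftrightarrow> g \<in> ell2" by (simp add: ell2_def)
  have "(\<Sum>\<^sub>\<infinity>v. (cmod (f v))\<^sup>2) = (\<Sum>\<^sub>\<infinity>v\<in>range \<phi>. (cmod (f v))\<^sup>2)"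
    using assms(3) by (intro infsum_cong_neutral) auto
  also have "\<dots> = (\<Sum>\<^sub>\<infinity>v. (cmod (g v))\<^sup>2)"
    by (subst infsum_reindex[OF assms(1)]) (simp add: o_def assms(2))
  finally show "ell2_norm f = ell2_norm g" by (simp add: ell2_norm_def)
qed

definition graft :: "nat \<Rightarrow> (nat list \<Rightarrow> complex) \<Rightarrow> nat list \<Rightarrow> complex" where
  "graft k f u = (case u of [] \<Rightarrow> 0 | l # w \<Rightarrow> if l = k then f w else 0)"

definition star :: "(nat \<Rightarrow> complex) \<Rightarrow> nat list \<Rightarrow> complex" where
  "star x u = (case u of [] \<Rightarrow> 0 | l # w \<Rightarrow> if w = [] then x l else 0)"

lemma graft_simps [simp]: "graft k f [] = 0" "graft k f (l # w) = (if l = k then f w else 0)"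
  by (auto simp: graft_def)

lemma star_simps [simp]: "star x [] = 0" "star x (l # w) = (if w = [] then x l else 0)"
  by (auto simp: star_def)

lemma graft_ell2: "graft k f \<in> ell2 \<longleftrightarrow> f \<in> ell2" "ell2_norm (graft k f) = ell2_norm f"
proof -
  have "inj (Cons k)" by simp
  moreover have "graft k f u = 0" if "u \<notin> range (Cons k)" for u
    using that by (cases u) auto
  ultimately show "graft k f \<in> ell2 \<longleftrightarrow> f \<in> ell2" "ell2_norm (graft k f) = ell2_norm f"
    by (intro ell2_reindex[of "Cons k"]; simp)+
qed

lemma star_ell2: "star x \<in> ell2 \<longleftrightarrow> x \<in> ell2" "ell2_norm (star x) = ell2_norm x"
proof -
  have "inj (\<lambda>k. [k])" by (auto simp: inj_def)
  moreover have "star x u = 0" if "u \<notin> range (\<lambda>k. [k])" for u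
    using that by (cases u) auto
  ultimately show "star x \<in> ell2 \<longleftrightarrow> x \<in> ell2" "ell2_norm (star x) = ell2_norm x"
    by (intro ell2_reindex[of "\<lambda>k. [k]"]; simp)+
qed

lemma ell2_nat_tail:
  assumes "x \<in> ell2"
  shows "(\<lambda>n. ell2_norm (\<lambda>k. if k < n then 0 else x k)) \<longlonglongrightarrow> (0::real)"
proof -
  let ?g = "\<lambda>k::nat. (cmod (x k))\<^sup>2"
  have s: "?g summable_on UNIV" using assms by (simp add: ell2_def)
  hence "?g sums (\<Sum>\<^sub>\<infinity>k. ?g k)" by (intro has_sum_imp_sums) simp
  hence "(\<lambda>n. sqrt ((\<Sum>\<^sub>\<infinity>k. ?g k) - (\<Sum>k<n. ?g k))) \<longlonglongrightarrow> sqrt ((\<Sum>\<^sub>\<infinity>k. ?g k) - (\<Sum>\<^sub>\<infinity>k. ?g k))"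
    unfolding sums_def by (intro tendsto_intros)
  moreover have "ell2_norm (\<lambda>k. if k < n then 0 else x k) = sqrt ((\<Sum>\<^sub>\<infinity>k. ?g k) - (\<Sum>k<n. ?g k))" for n
  proof -
    have "(\<Sum>\<^sub>\<infinity>k. (cmod (if k < n then 0 else x k))\<^sup>2) = (\<Sum>\<^sub>\<infinity>k\<in>UNIV - {..<n}. ?g k)"
      by (intro infsum_cong_neutral) auto
    also have "\<dots> = (\<Sum>\<^sub>\<infinity>k. ?g k) - (\<Sum>k<n. ?g k)"
      using s by (subst infsum_Diff) (auto intro: summable_on_subset_banach)
    finally show ?thesis by (simp add: ell2_norm_def)
  qed
  ultimately show ?thesis by simp
qed

context
  fixes c :: "nat list \<Rightarrow> nat \<Rightarrow> real"
begin

text \<open>The only edge leaving the \<open>k\<close>-th subtree joins its root to the root of the whole tree, which gives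
  the additional term at the root.\<close>

lemma graft_core:
  fixes f g :: "nat list \<Rightarrow> complex"
  assumes "(f, g) \<in> tree_rel (\<lambda>w. c (k # w))"
  shows "(graft k f, \<lambda>u. graft k g u + (c [] k * f []) * basis_vec [] u) \<in> tree_rel c"
proof -
  define S where "S = {v. f v \<noteq> 0}"
  have S: "finite S" and g: "g = mat_apply (tree_matrix (\<lambda>w. c (k # w))) f" "g \<in> ell2"
    using assms by (auto simp: tree_rel_def mat_core_def S_def)
  have supp: "graft k f u = 0" if "u \<notin> Cons k ` S" for u
    using that by (cases u) (auto simp: S_def)
  have app: "mat_apply (tree_matrix c) (graft k f) u = (\<Sum>v\<in>S. tree_matrix c u (k # v) * f v)" for u
    using S supp by (subst mat_apply_superset[of "Cons k ` S"]) (auto simp: sum.reindex)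
  have "mat_apply (tree_matrix c) (graft k f) u = graft k g u + (c [] k * f []) * basis_vec [] u" for u
  proof (cases u)
    case Nil
    have "(\<Sum>v\<in>S. tree_matrix c [] (k # v) * f v) = (\<Sum>v\<in>S. if v = [] then c [] k * f [] else 0)"
      by (intro sum.cong) auto
    also have "\<dots> = c [] k * f []" using S by (auto simp: sum.delta S_def)
    finally show ?thesis using Nil by (simp add: app basis_vec_def)
  next
    case (Cons l w)
    thus ?thesis unfolding app using S
      by (auto simp: basis_vec_def g(1) mat_apply_def S_def)
  qed
  moreover have "finite {u. graft k f u \<noteq> 0}"
    by (rule finite_subset[of _ "Cons k ` S"]) (use supp S in auto)
  moreover have "(\<lambda>u. graft k g u + (c [] k * f []) * basis_vec [] u) \<in> ell2"
    using g(2) by (intro ell2_add(1) ell2_scale(1)) (auto simp: graft_ell2)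
  ultimately show ?thesis by (auto simp: tree_rel_def mat_core_def)
qed

lemma graft_closure:
  fixes f g :: "nat list \<Rightarrow> complex"
  assumes "(f, g) \<in> op_closure (tree_rel (\<lambda>w. c (k # w)))"
  shows "(graft k f, \<lambda>u. graft k g u + (c [] k * f []) * basis_vec [] u) \<in> op_closure (tree_rel c)"
proof -
  obtain F G where F: "f \<in> ell2" "g \<in> ell2" "\<And>n::nat. (F n, G n) \<in> tree_rel (\<lambda>w. c (k # w))"
    "(\<lambda>n. ell2_norm (\<lambda>v. F n v - f v)) \<longlonglongrightarrow> 0" "(\<lambda>n. ell2_norm (\<lambda>v. G n v - g v)) \<longlonglongrightarrow> 0"
    using assms by (auto simp: op_closure_def)
  note E = symmetric_rel_ell2[OF symmetric_tree_rel F(3)]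
  have graft_diff: "graft k p u - graft k q u = graft k (\<lambda>v. p v - q v) u" for p q u
    by (cases u) auto
  have at_root: "(\<lambda>n. ell2_norm (\<lambda>u. F n [] * basis_vec ([] :: nat list) u - f [] * basis_vec [] u)) \<longlonglongrightarrow> 0"
  proof (rule Lim_null_comparison[OF always_eventually F(4)], rule allI)
    fix n
    have "ell2_norm (\<lambda>u. (F n [] - f []) * basis_vec ([] :: nat list) u) = cmod (F n [] - f [])"
      by (subst ell2_scale(2)) auto
    thus "norm (ell2_norm (\<lambda>u. F n [] * basis_vec ([] :: nat list) u - f [] * basis_vec [] u)) \<le> ell2_norm (\<lambda>v. F n v - f v)"
      using cmod_le_ell2_norm[OF ell2_diff(1)[OF E(1) F(1)], of n "[]"] by (simp add: left_diff_distrib)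
  qed
  have "(\<lambda>n. ell2_norm (\<lambda>u. graft k (G n) u - graft k g u)) \<longlonglongrightarrow> 0"
    using F(5) by (simp add: graft_diff graft_ell2)
  hence "(\<lambda>n. ell2_norm (\<lambda>u. (graft k (G n) u + c [] k * (F n [] * basis_vec [] u))
      - (graft k g u + c [] k * (f [] * basis_vec [] u)))) \<longlonglongrightarrow> 0"
    using F E by (intro ell2_tendsto_lincomb at_root) (auto simp: graft_ell2 ell2_scale)
  moreover have "(\<lambda>n. ell2_norm (\<lambda>u. graft k (F n) u - graft k f u)) \<longlonglongrightarrow> 0"
    using F(4) by (simp add: graft_diff graft_ell2)
  moreover have "(graft k (F n), \<lambda>u. graft k (G n) u + c [] k * (F n [] * basis_vec [] u)) \<in> tree_rel c" for n
    using graft_core[OF F(3)] by (simp add: mult.assoc)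
  moreover have "graft k f \<in> ell2" "(\<lambda>u. graft k g u + c [] k * (f [] * basis_vec [] u)) \<in> ell2"
    using F by (auto simp: graft_ell2 intro!: ell2_add(1) ell2_scale(1))
  ultimately have "(graft k f, \<lambda>u. graft k g u + c [] k * (f [] * basis_vec [] u)) \<in> op_closure (tree_rel c)"
    by (intro op_closureI[of _ _ "\<lambda>n. graft k (F n)" "\<lambda>n u. graft k (G n) u + c [] k * (F n [] * basis_vec [] u)"])
  thus ?thesis by (simp add: mult.assoc)
qed

text \<open>Let \<open>\<psi> k\<close> be the resolvent vector at the root of the \<open>k\<close>-th subtree and \<open>e\<close> the basis vector
  at the root. The operator minus \<open>z\<close> maps \<open>e - \<Sum>k<n. c k \<psi> k\<close>, whose value at the root is 1, to the
  multiple \<open>-(z + \<Sum>k<n. (c k)\<^sup>2 R k)\<close> of \<open>e\<close> up to an error that is supported by the children from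
  \<open>n\<close> on and tends to 0. Hence \<open>1 = -(z + \<Sum>k. (c k)\<^sup>2 R k) R\<close> for the root entry \<open>R\<close>.\<close>

proposition tree_resolvent_recursion:
  assumes z: "Im z > 0"
    and sum: "(\<lambda>k. (c [] k)\<^sup>2) summable_on UNIV"
    and root: "z \<in> resolvent_set (op_closure (tree_rel c))"
    and sub: "\<And>k. z \<in> resolvent_set (op_closure (tree_rel (\<lambda>w. c (k # w))))"
  shows "tree_resolvent z c
    = - inverse (z + (\<Sum>\<^sub>\<infinity>k. complex_of_real ((c [] k)\<^sup>2) * tree_resolvent z (\<lambda>w. c (k # w))))"
proof -
  define R where "R k = tree_resolvent z (\<lambda>w. c (k # w))" for k
  define \<psi> where "\<psi> k = resolvent (op_closure (tree_rel (\<lambda>w. c (k # w)))) z (basis_vec [])" for k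
  let ?T = "op_closure (tree_rel c)"
  let ?e = "basis_vec [] :: nat list \<Rightarrow> complex"
  have \<psi>: "(\<psi> k, \<lambda>u. ?e u + z * \<psi> k u) \<in> op_closure (tree_rel (\<lambda>w. c (k # w)))" for k
    unfolding \<psi>_def by (intro resolvent_mem[OF sub]) simp
  have R: "\<psi> k [] = R k" for k
    unfolding \<psi>_def R_def tree_resolvent_def by (simp add: resolvent_entry_eq[OF sub])
  have "(\<lambda>k. (c [] k)\<^sup>2 * (1 / Im z)) summable_on UNIV"
    using sum by (rule summable_on_cmult_left)
  hence Rs: "(\<lambda>k. complex_of_real ((c [] k)\<^sup>2) * R k) summable_on UNIV"
  proof (rule abs_summable_summable[OF summable_on_comparison_test])
    show "norm (complex_of_real ((c [] k)\<^sup>2) * R k) \<le> (c [] k)\<^sup>2 * (1 / Im z)" for k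
    proof -
      have "norm (complex_of_real ((c [] k)\<^sup>2) * R k) = (c [] k)\<^sup>2 * cmod (R k)"
        by (simp add: norm_mult norm_power)
      also have "\<dots> \<le> (c [] k)\<^sup>2 * (1 / Im z)"
        unfolding R_def by (intro mult_left_mono cmod_tree_resolvent_le z) simp
      finally show ?thesis .
    qed
  qed auto
  define s where "s = (\<Sum>\<^sub>\<infinity>k. complex_of_real ((c [] k)\<^sup>2) * R k)"
  define w where "w = z + s"
  have col: "(\<lambda>k. complex_of_real (c [] k)) \<in> ell2"
    using sum by (simp add: ell2_def)
  have "(?e, star (\<lambda>k. complex_of_real (c [] k))) \<in> tree_rel c"
  proof -
    have "mat_apply (tree_matrix c) ?e u = star (\<lambda>k. complex_of_real (c [] k)) u" for u
      by (cases u) (auto simp: mat_apply_basis_vec)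
    moreover have "finite {v. ?e v \<noteq> 0}"
      by (rule finite_subset[of _ "{[]}"]) (auto simp: basis_vec_def)
    ultimately show ?thesis
      using col by (auto simp: tree_rel_def mat_core_def star_ell2)
  qed
  hence e: "(?e, star (\<lambda>k. complex_of_real (c [] k))) \<in> ?T"
    by (rule subset_op_closure[OF symmetric_tree_rel])
  have bound: "Im z * cmod (1 + w * tree_resolvent z c)
      \<le> ell2_norm (\<lambda>k. if k < n then 0 else complex_of_real (c [] k))
        + cmod (s - (\<Sum>k<n. complex_of_real ((c [] k)\<^sup>2) * R k))" for n
  proof -
    define f where "f = (\<lambda>u. ?e u + (-1) * (\<Sum>k<n. complex_of_real (c [] k) * graft k (\<psi> k) u))"
    define g where "g = (\<lambda>u. star (\<lambda>k. complex_of_real (c [] k)) u + (-1) * (\<Sum>k<n. complex_of_real (c [] k) *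
      (graft k (\<lambda>u. ?e u + z * \<psi> k u) u + (c [] k * \<psi> k []) * ?e u)))"
    have fg: "(f, g) \<in> ?T" unfolding f_def g_def
      by (intro symmetric_rel_add symmetric_rel_sum symmetric_tree_closure e graft_closure \<psi>)
    have f0: "f [] = 1" by (simp add: f_def basis_vec_def)
    have res: "g u - z * f u - (-w) * ?e u
        = star (\<lambda>k. if k < n then 0 else complex_of_real (c [] k)) u
          + (s - (\<Sum>k<n. complex_of_real ((c [] k)\<^sup>2) * R k)) * ?e u" for u
    proof (cases u)
      case Nil
      thus ?thesis by (simp add: g_def f_def w_def R basis_vec_def power2_eq_square mult.assoc)
    next
      case (Cons l v)
      have "(\<Sum>k<n. complex_of_real (c [] k) * graft k (\<lambda>u. ?e u + z * \<psi> k u) u)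
          = (\<Sum>k<n. if k = l then complex_of_real (c [] l) * (?e v + z * \<psi> l v) else 0)"
        using Cons by (intro sum.cong) auto
      moreover have "(\<Sum>k<n. complex_of_real (c [] k) * graft k (\<psi> k) u)
          = (\<Sum>k<n. if k = l then complex_of_real (c [] l) * \<psi> l v else 0)"
        using Cons by (intro sum.cong) auto
      ultimately show ?thesis using Cons
        by (auto simp: g_def f_def basis_vec_def algebra_simps)
    qed
    have "Im z * cmod (1 + w * tree_resolvent z c) = \<bar>Im z\<bar> * cmod (f [] - (-w) * tree_resolvent z c)"
      using z by (simp add: f0)
    also have "\<dots> \<le> ell2_norm (\<lambda>u. g u - z * f u - (-w) * ?e u)"
      unfolding tree_resolvent_def by (intro resolvent_entry_approx symmetric_tree_closure root fg)
    also have "\<dots> \<le> ell2_norm (star (\<lambda>k. if k < n then 0 else complex_of_real (c [] k)))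
        + ell2_norm (\<lambda>u. (s - (\<Sum>k<n. complex_of_real ((c [] k)\<^sup>2) * R k)) * ?e u)"
      unfolding res
    proof (intro ell2_add(2) ell2_scale(1) basis_vec_ell2)
      have "(\<lambda>k. (cmod (if k < n then 0 else complex_of_real (c [] k)))\<^sup>2) summable_on UNIV"
        by (rule summable_on_comparison_test[OF sum]) auto
      thus "star (\<lambda>k. if k < n then 0 else complex_of_real (c [] k)) \<in> ell2"
        by (subst star_ell2(1)) (simp add: ell2_def)
    qed
    finally show ?thesis by (simp add: star_ell2 ell2_scale)
  qed
  have "(\<lambda>n. ell2_norm (\<lambda>k. if k < n then 0 else complex_of_real (c [] k))
        + cmod (s - (\<Sum>k<n. complex_of_real ((c [] k)\<^sup>2) * R k))) \<longlonglongrightarrow> 0 + cmod (s - s)"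
    using has_sum_imp_sums[of "\<lambda>k. complex_of_real ((c [] k)\<^sup>2) * R k" s] Rs
    unfolding sums_def s_def by (intro tendsto_intros ell2_nat_tail col) simp
  hence "Im z * cmod (1 + w * tree_resolvent z c) \<le> 0 + cmod (s - s)"
    by (rule LIMSEQ_le_const) (use bound in blast)
  hence "Im z * cmod (1 + w * tree_resolvent z c) \<le> 0" by simp
  hence "1 + w * tree_resolvent z c = 0" using z by (simp add: mult_le_0_iff)
  hence wR: "w * (- tree_resolvent z c) = 1" by (metis add_eq_0_iff2 mult_minus_right)
  hence "inverse w = - tree_resolvent z c" by (rule inverse_unique)
  thus ?thesis by (simp add: w_def s_def R_def)
qed

end

section \<open>Essential self-adjointness\<close>

definition bounded_matrix :: "('v \<Rightarrow> 'v \<Rightarrow> real) \<Rightarrow> real \<Rightarrow> bool" where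
  "bounded_matrix B b \<longleftrightarrow> (\<forall>f. finite {v. f v \<noteq> 0} \<longrightarrow>
     mat_apply B f \<in> ell2 \<and> ell2_norm (mat_apply B f) \<le> b * ell2_norm f)"

lemma mat_apply_add_matrix:
  "mat_apply (\<lambda>u v. A u v + B u v) f u = mat_apply A f u + mat_apply B f u"
  by (simp add: mat_apply_def distrib_right sum.distrib)

text \<open>Far from the real axis the bounded part is a small perturbation, and one shift leads from there
  to any other point of the half plane.\<close>

lemma dense_range_perturbation:
  assumes A: "\<And>u v. A u v = A v u" and B: "\<And>u v. B u v = B v u"
    and dense: "\<And>w. Im w > 0 \<Longrightarrow> dense_range (mat_core A) w"
    and b: "bounded_matrix B b" "b \<ge> 0" and z: "Im z > 0"
  shows "dense_range (mat_core (\<lambda>u v. A u v + B u v)) z"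
proof -
  let ?T = "mat_core (\<lambda>u v. A u v + B u v)"
  have T: "symmetric_rel ?T" by (rule symmetric_rel_mat_core) (simp add: A B)
  have TA: "symmetric_rel (mat_core A)" by (rule symmetric_rel_mat_core) (rule A)
  show ?thesis
  proof (rule dense_range_from_far[OF T z, of b])
    fix w assume w: "Im w > b"
    define q where "q = b / Im w"
    have q: "0 \<le> q" "q < 1" using w b by (auto simp: q_def)
    show "dense_range ?T w"
    proof (rule dense_range_contraction[OF T q])
      fix h :: "'a \<Rightarrow> complex" and e :: real assume h: "h \<in> ell2" "e > 0"
      obtain f g where fg: "(f, g) \<in> mat_core A" "ell2_norm (\<lambda>v. g v - w * f v - h v) < e/2"
        using dense[of w] w b h unfolding dense_range_def by (meson half_gt_zero le_less_trans)
      have g: "g = mat_apply A f" "g \<in> ell2" "finite {v. f v \<noteq> 0}" using fg(1) by (auto simp: mat_core_def)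
      have Bf: "mat_apply B f \<in> ell2" "ell2_norm (mat_apply B f) \<le> b * ell2_norm f"
        using b(1) g(3) by (auto simp: bounded_matrix_def)
      have r: "(\<lambda>v. g v - w * f v) \<in> ell2" using fg by (intro symmetric_rel_residual_ell2[OF TA])
      have "ell2_norm (\<lambda>v. g v - w * f v) \<le> ell2_norm h + e/2"
        using ell2_norm_le_add_diff[OF r h(1)] fg(2) by linarith
      hence "Im w * ell2_norm f \<le> ell2_norm h + e/2"
        using symmetric_rel_bound[OF TA fg(1), of w] w b by linarith
      hence "ell2_norm f \<le> (ell2_norm h + e/2) / Im w" using w b by (simp add: field_simps)
      hence "b * ell2_norm f \<le> b * ((ell2_norm h + e/2) / Im w)" using b by (intro mult_left_mono) auto
      also have "\<dots> = q * ell2_norm h + q * (e/2)" by (simp add: q_def add_divide_distrib distrib_left)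
      also have "q * (e/2) \<le> 1 * (e/2)" using q h(2) by (intro mult_right_mono) auto
      finally have small: "ell2_norm (mat_apply B f) \<le> q * ell2_norm h + e/2" using Bf(2) by linarith
      define g' where "g' = (\<lambda>v. g v + mat_apply B f v)"
      have "g' \<in> ell2" unfolding g'_def by (intro ell2_add(1) g Bf)
      hence "(f, g') \<in> ?T" using g by (auto simp: mat_core_def g'_def mat_apply_add_matrix)
      moreover have "ell2_norm (\<lambda>v. g' v - w * f v - h v) \<le> q * ell2_norm h + e"
      proof -
        have "ell2_norm (\<lambda>v. g' v - w * f v - h v) = ell2_norm (\<lambda>v. (g v - w * f v - h v) + mat_apply B f v)"
          by (simp add: g'_def algebra_simps)
        also have "\<dots> \<le> ell2_norm (\<lambda>v. g v - w * f v - h v) + ell2_norm (mat_apply B f)"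
          by (intro ell2_add ell2_diff(1)[OF r h(1)] Bf)
        finally show ?thesis using small fg(2) by linarith
      qed
      ultimately show "\<exists>f g. (f, g) \<in> ?T \<and> ell2_norm (\<lambda>v. g v - w * f v - h v) \<le> q * ell2_norm h + e"
        by blast
    qed
  qed
qed

lemma dense_range_finiteI:
  assumes T: "symmetric_rel T"
    and "\<And>h e S. finite S \<Longrightarrow> (\<And>v. v \<notin> S \<Longrightarrow> h v = 0) \<Longrightarrow> e > 0 \<Longrightarrow>
      \<exists>f g. (f, g) \<in> T \<and> ell2_norm (\<lambda>v. g v - z * f v - h v) < e"
  shows "dense_range T z"
  by (rule dense_range_basisI[OF T]) (rule assms(2)[of "{_}"]; simp add: basis_vec_def)

lemma dense_range_zero_matrix:
  assumes "Im z > 0"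
  shows "dense_range (mat_core (\<lambda>u v :: 'v. 0)) z"
proof (rule dense_range_finiteI)
  show "symmetric_rel (mat_core (\<lambda>u v :: 'v. 0))" by (rule symmetric_rel_mat_core) simp
next
  fix h :: "'v \<Rightarrow> complex" and e :: real and S assume h: "finite S" "\<And>v. v \<notin> S \<Longrightarrow> h v = 0" "e > 0"
  have z: "z \<noteq> 0" using assms by auto
  have "{v. - h v / z \<noteq> 0} \<subseteq> S" using h(2) by auto
  hence "(\<lambda>v. - h v / z, \<lambda>v. 0) \<in> mat_core (\<lambda>u v :: 'v. 0)"
    using h(1) finite_subset by (auto simp: mat_core_def mat_apply_def)
  thus "\<exists>f g. (f, g) \<in> mat_core (\<lambda>u v. 0) \<and> ell2_norm (\<lambda>v. g v - z * f v - h v) < e"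
    using z h(3) by (intro exI[of _ "\<lambda>v. - h v / z"] exI[of _ "\<lambda>v. 0"]) simp
qed

lemma bounded_finite_matrix:
  assumes S: "finite S"
  shows "bounded_matrix (\<lambda>u v. if u \<in> S \<and> v \<in> S then A u v else 0) (\<Sum>u\<in>S. \<Sum>v\<in>S. \<bar>A u v\<bar>)"
  unfolding bounded_matrix_def
proof (intro allI impI)
  fix f :: "'a \<Rightarrow> complex" assume f: "finite {v. f v \<noteq> 0}"
  let ?A = "\<lambda>u v. if u \<in> S \<and> v \<in> S then A u v else 0"
  have fe: "f \<in> ell2" using ell2_finite_support(1)[OF f] by simp
  have 0: "mat_apply ?A f u = 0" if "u \<notin> S" for u using that by (simp add: mat_apply_def)
  have app: "mat_apply ?A f u = (\<Sum>v\<in>S. complex_of_real (A u v) * f v)" if "u \<in> S" for u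
  proof -
    have "mat_apply ?A f u = (\<Sum>v\<in>S \<union> {v. f v \<noteq> 0}. complex_of_real (?A u v) * f v)"
      using f S by (intro mat_apply_superset) auto
    also have "\<dots> = (\<Sum>v\<in>S. complex_of_real (?A u v) * f v)"
      using f S by (intro sum.mono_neutral_right) auto
    finally show ?thesis using that by simp
  qed
  have "ell2_norm (mat_apply ?A f) = L2_set (\<lambda>u. cmod (mat_apply ?A f u)) S"
    by (rule ell2_finite_support(2)[OF S 0])
  also have "\<dots> \<le> (\<Sum>u\<in>S. cmod (mat_apply ?A f u))" by (rule L2_set_le_sum) simp
  also have "\<dots> \<le> (\<Sum>u\<in>S. \<Sum>v\<in>S. \<bar>A u v\<bar> * ell2_norm f)"
  proof (rule sum_mono)
    fix u assume "u \<in> S"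
    show "cmod (mat_apply ?A f u) \<le> (\<Sum>v\<in>S. \<bar>A u v\<bar> * ell2_norm f)"
      unfolding app[OF \<open>u \<in> S\<close>]
      by (rule sum_norm_le) (auto simp: norm_mult intro!: mult_left_mono cmod_le_ell2_norm fe)
  qed
  finally show "mat_apply ?A f \<in> ell2 \<and> ell2_norm (mat_apply ?A f) \<le> (\<Sum>u\<in>S. \<Sum>v\<in>S. \<bar>A u v\<bar>) * ell2_norm f"
    using ell2_finite_support(1)[OF S 0] by (simp add: sum_distrib_right)
qed

text \<open>A matrix all of whose finite sets of vertices are contained in finite invariant sets is a sum
  of finite blocks.\<close>

lemma dense_range_finite_blocks:
  fixes A :: "'v \<Rightarrow> 'v \<Rightarrow> real"
  assumes A: "\<And>u v. A u v = A v u"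
    and blocks: "\<And>F. finite F \<Longrightarrow> \<exists>S. finite S \<and> F \<subseteq> S \<and> (\<forall>v\<in>S. \<forall>u. A u v \<noteq> 0 \<longrightarrow> u \<in> S)"
    and z: "Im z > 0"
  shows "dense_range (mat_core A) z"
proof (rule dense_range_finiteI)
  show "symmetric_rel (mat_core A)" by (rule symmetric_rel_mat_core) (rule A)
next
  fix h :: "'v \<Rightarrow> complex" and e :: real and F
  assume h: "finite F" "\<And>v. v \<notin> F \<Longrightarrow> h v = 0" "e > 0"
  obtain S where S: "finite S" "F \<subseteq> S" "\<And>u v. v \<in> S \<Longrightarrow> A u v \<noteq> 0 \<Longrightarrow> u \<in> S"
    using blocks[OF h(1)] by blast
  let ?A = "\<lambda>u v. if u \<in> S \<and> v \<in> S then A u v else 0"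
  have he: "h \<in> ell2" using h by (intro ell2_finite_support(1)[of F])
  have "dense_range (mat_core (\<lambda>u v. 0 + ?A u v)) z"
    using z by (intro dense_range_perturbation[OF _ _ dense_range_zero_matrix bounded_finite_matrix[OF S(1)]])
      (auto simp: A intro!: sum_nonneg)
  hence "dense_range (mat_core ?A) z" by simp
  then obtain f g where fg: "(f, g) \<in> mat_core ?A" "ell2_norm (\<lambda>v. g v - z * f v - h v) < e"
    using he h(3) unfolding dense_range_def by blast
  have f: "finite {v. f v \<noteq> 0}" "g = mat_apply ?A f" "g \<in> ell2" using fg(1) by (auto simp: mat_core_def)
  have fe: "f \<in> ell2" using ell2_finite_support(1)[OF f(1)] by simp
  \<comment> \<open>The values of \<open>f\<close> outside \<open>S\<close> only increase the residual; after cutting them off, the block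
    and the full matrix agree.\<close>
  define f' where "f' v = (if v \<in> S then f v else 0)" for v
  have g0: "g u = 0" if "u \<notin> S" for u using that by (simp add: f(2) mat_apply_def)
  have hS: "h u = 0" if "u \<notin> S" for u using that h(2) S(2) by blast
  have app: "mat_apply A f' u = g u" for u
  proof (cases "u \<in> S")
    case True
    have "g u = (\<Sum>v\<in>S \<union> {v. f v \<noteq> 0}. complex_of_real (?A u v) * f v)"
      unfolding f(2) using f(1) S(1) by (intro mat_apply_superset) auto
    also have "\<dots> = (\<Sum>v\<in>S. complex_of_real (A u v) * f' v)"
      using f S(1) True by (intro sum.mono_neutral_cong_right) (auto simp: f'_def)
    also have "\<dots> = mat_apply A f' u"
      using S(1) by (intro mat_apply_superset[symmetric]) (auto simp: f'_def)
    finally show ?thesis by simp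
  next
    case False
    have "mat_apply A f' u = (\<Sum>v\<in>S. complex_of_real (A u v) * f' v)"
      using S(1) by (intro mat_apply_superset) (auto simp: f'_def)
    also have "\<dots> = 0" using S(3) False by (intro sum.neutral) auto
    finally show ?thesis using g0[OF False] by simp
  qed
  have "finite {v. f' v \<noteq> 0}" by (rule finite_subset[OF _ S(1)]) (auto simp: f'_def)
  hence core: "(f', g) \<in> mat_core A" using app f(3) by (auto simp: mat_core_def fun_eq_iff)
  have "ell2_norm (\<lambda>v. g v - z * f' v - h v) \<le> ell2_norm (\<lambda>v. g v - z * f v - h v)"
  proof (rule ell2I(2))
    fix E :: "'v set" assume "finite E"
    have "L2_set (\<lambda>v. cmod (g v - z * f' v - h v)) E \<le> L2_set (\<lambda>v. cmod (g v - z * f v - h v)) E"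
      using g0 hS by (intro L2_set_mono) (auto simp: f'_def)
    also have "\<dots> \<le> ell2_norm (\<lambda>v. g v - z * f v - h v)"
      by (intro L2_set_le_ell2_norm ell2_diff(1) ell2_scale(1) f fe he \<open>finite E\<close>)
    finally show "L2_set (\<lambda>v. cmod (g v - z * f' v - h v)) E \<le> \<dots>" .
  qed
  thus "\<exists>f g. (f, g) \<in> mat_core A \<and> ell2_norm (\<lambda>v. g v - z * f v - h v) < e"
    using core fg(2) by (intro exI[of _ f'] exI[of _ g]) auto
qed

text \<open>The image at \<open>u\<close> consists of the term \<open>p u\<close> from the parent of \<open>u\<close> and the terms \<open>d u\<close> from its
  children. Each vertex has one parent, so the squares of both parts sum up to at most \<open>\<kappa>\<close> times the
  squared norm.\<close>

lemma bounded_tree_matrix: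
  assumes \<kappa>: "\<And>v F. finite F \<Longrightarrow> (\<Sum>k\<in>F. (b v k)\<^sup>2) \<le> \<kappa>"
  shows "bounded_matrix (tree_matrix b) (2 * sqrt \<kappa>)"
  unfolding bounded_matrix_def
proof (intro allI impI)
  fix f :: "nat list \<Rightarrow> complex" assume fin: "finite {v. f v \<noteq> 0}"
  have \<kappa>0: "\<kappa> \<ge> 0" using \<kappa>[of "{}"] by simp
  have fe: "f \<in> ell2" using ell2_finite_support(1)[OF fin] by simp
  have sum_f: "(\<Sum>v\<in>F. (cmod (f v))\<^sup>2) \<le> (ell2_norm f)\<^sup>2" if "finite F" for F
    using L2_set_le_ell2_norm[OF fe that] unfolding L2_set_def by (simp add: sqrt_le_D)
  define C where "C u = {k. f (u @ [k]) \<noteq> 0}" for u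
  have C: "finite (C u)" for u
    unfolding C_def by (rule finite_imageD[of "\<lambda>k. u @ [k]"]) (auto simp: inj_on_def intro: finite_subset[OF _ fin])
  define p where "p u = (if u = [] then 0 else complex_of_real (b (butlast u) (last u)) * f (butlast u))" for u
  define d where "d u = (\<Sum>k\<in>C u. complex_of_real (b u k) * f (u @ [k]))" for u
  have split: "mat_apply (tree_matrix b) f u = p u + d u" for u
  proof -
    let ?P = "if u = [] then {} else {butlast u}"
    let ?K = "(\<lambda>k. u @ [k]) ` C u"
    have disj: "?P \<inter> ?K = {}" by (auto dest: arg_cong[where f = length])
    have "mat_apply (tree_matrix b) f u = (\<Sum>v\<in>?P \<union> ?K \<union> {v. f v \<noteq> 0}. complex_of_real (tree_matrix b u v) * f v)"
      using fin C by (intro mat_apply_superset) auto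
    also have "\<dots> = (\<Sum>v\<in>?P \<union> ?K. complex_of_real (tree_matrix b u v) * f v)"
    proof (rule sum.mono_neutral_right)
      show "\<forall>v\<in>?P \<union> ?K \<union> {v. f v \<noteq> 0} - (?P \<union> ?K). complex_of_real (tree_matrix b u v) * f v = 0"
      proof
        fix v assume v: "v \<in> ?P \<union> ?K \<union> {v. f v \<noteq> 0} - (?P \<union> ?K)"
        have "v \<noteq> u @ [k]" for k using v by (auto simp: C_def)
        hence "\<not> (v \<noteq> [] \<and> butlast v = u)" by (metis append_butlast_last_id)
        thus "complex_of_real (tree_matrix b u v) * f v = 0"
          using v by (auto simp: tree_matrix_def)
      qed
    qed (use fin C in auto)
    also have "\<dots> = (\<Sum>v\<in>?P. complex_of_real (tree_matrix b u v) * f v)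
        + (\<Sum>v\<in>?K. complex_of_real (tree_matrix b u v) * f v)"
      using C by (intro sum.union_disjoint disj) auto
    also have "(\<Sum>v\<in>?K. complex_of_real (tree_matrix b u v) * f v) = d u"
      unfolding d_def by (subst sum.reindex) (auto simp: inj_on_def)
    also have "(\<Sum>v\<in>?P. complex_of_real (tree_matrix b u v) * f v) = p u"
      by (simp add: p_def tree_matrix_def)
    finally show ?thesis .
  qed
  have "L2_set (\<lambda>u. cmod (p u)) E \<le> sqrt \<kappa> * ell2_norm f" if E: "finite E" for E
  proof -
    define X where "X v = {u\<in>E - {[]}. butlast u = v}" for v
    have "(\<Sum>u\<in>E. (cmod (p u))\<^sup>2) = (\<Sum>u\<in>E - {[]}. (cmod (p u))\<^sup>2)"
      using E by (intro sum.mono_neutral_right) (auto simp: p_def)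
    also have "\<dots> = (\<Sum>v\<in>butlast ` (E - {[]}). \<Sum>u\<in>X v. (cmod (p u))\<^sup>2)"
      unfolding X_def using E by (intro sum.image_gen) auto
    also have "\<dots> \<le> (\<Sum>v\<in>butlast ` (E - {[]}). \<kappa> * (cmod (f v))\<^sup>2)"
    proof (rule sum_mono)
      fix v
      have inj: "inj_on last (X v)"
        by (rule inj_onI) (metis (mono_tags, lifting) X_def append_butlast_last_id DiffD2 mem_Collect_eq singletonI)
      have "(\<Sum>u\<in>X v. (cmod (p u))\<^sup>2) = (\<Sum>u\<in>X v. (b v (last u))\<^sup>2 * (cmod (f v))\<^sup>2)"
        by (intro sum.cong) (auto simp: X_def p_def norm_mult power_mult_distrib)
      also have "\<dots> = (\<Sum>k\<in>last ` X v. (b v k)\<^sup>2) * (cmod (f v))\<^sup>2"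
        by (simp add: sum.reindex[OF inj] sum_distrib_right)
      also have "\<dots> \<le> \<kappa> * (cmod (f v))\<^sup>2"
        using E by (intro mult_right_mono \<kappa>) (auto simp: X_def)
      finally show "(\<Sum>u\<in>X v. (cmod (p u))\<^sup>2) \<le> \<kappa> * (cmod (f v))\<^sup>2" .
    qed
    also have "\<dots> = \<kappa> * (\<Sum>v\<in>butlast ` (E - {[]}). (cmod (f v))\<^sup>2)" by (simp add: sum_distrib_left)
    also have "\<dots> \<le> \<kappa> * (ell2_norm f)\<^sup>2" using E \<kappa>0 by (intro mult_left_mono sum_f) auto
    finally have "sqrt (\<Sum>u\<in>E. (cmod (p u))\<^sup>2) \<le> sqrt (\<kappa> * (ell2_norm f)\<^sup>2)" by (rule real_sqrt_le_mono)
    thus ?thesis by (simp add: L2_set_def real_sqrt_mult)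
  qed
  hence p: "p \<in> ell2 \<and> ell2_norm p \<le> sqrt \<kappa> * ell2_norm f" using ell2I[of p] by blast
  have "L2_set (\<lambda>u. cmod (d u)) E \<le> sqrt \<kappa> * ell2_norm f" if E: "finite E" for E
  proof -
    have "(\<Sum>u\<in>E. (cmod (d u))\<^sup>2) \<le> (\<Sum>u\<in>E. \<kappa> * (\<Sum>k\<in>C u. (cmod (f (u @ [k])))\<^sup>2))"
    proof (rule sum_mono)
      fix u
      have "cmod (d u) \<le> (\<Sum>k\<in>C u. \<bar>b u k\<bar> * \<bar>cmod (f (u @ [k]))\<bar>)"
        unfolding d_def by (rule sum_norm_le) (simp add: norm_mult)
      also have "\<dots> \<le> L2_set (b u) (C u) * L2_set (\<lambda>k. cmod (f (u @ [k]))) (C u)"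
        by (rule L2_set_mult_ineq)
      finally have "(cmod (d u))\<^sup>2 \<le> (L2_set (b u) (C u) * L2_set (\<lambda>k. cmod (f (u @ [k]))) (C u))\<^sup>2"
        by (rule power_mono) simp
      also have "\<dots> = (\<Sum>k\<in>C u. (b u k)\<^sup>2) * (\<Sum>k\<in>C u. (cmod (f (u @ [k])))\<^sup>2)"
        by (simp add: L2_set_def power_mult_distrib sum_nonneg)
      also have "\<dots> \<le> \<kappa> * (\<Sum>k\<in>C u. (cmod (f (u @ [k])))\<^sup>2)"
        using C by (intro mult_right_mono \<kappa> sum_nonneg) auto
      finally show "(cmod (d u))\<^sup>2 \<le> \<kappa> * (\<Sum>k\<in>C u. (cmod (f (u @ [k])))\<^sup>2)" .
    qed
    also have "\<dots> = \<kappa> * (\<Sum>x\<in>Sigma E C. (cmod (f (fst x @ [snd x])))\<^sup>2)"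
      using E C by (simp add: sum_distrib_left sum.Sigma case_prod_beta)
    also have "(\<Sum>x\<in>Sigma E C. (cmod (f (fst x @ [snd x])))\<^sup>2)
        = (\<Sum>v\<in>(\<lambda>x. fst x @ [snd x]) ` Sigma E C. (cmod (f v))\<^sup>2)"
      by (subst sum.reindex) (auto simp: inj_on_def)
    also have "\<kappa> * \<dots> \<le> \<kappa> * (ell2_norm f)\<^sup>2"
      using E C \<kappa>0 by (intro mult_left_mono sum_f) auto
    finally have "sqrt (\<Sum>u\<in>E. (cmod (d u))\<^sup>2) \<le> sqrt (\<kappa> * (ell2_norm f)\<^sup>2)" by (rule real_sqrt_le_mono)
    thus ?thesis by (simp add: L2_set_def real_sqrt_mult)
  qed
  hence d: "d \<in> ell2 \<and> ell2_norm d \<le> sqrt \<kappa> * ell2_norm f" using ell2I[of d] by blast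
  have "mat_apply (tree_matrix b) f = (\<lambda>u. p u + d u)" using split by auto
  thus "mat_apply (tree_matrix b) f \<in> ell2 \<and> ell2_norm (mat_apply (tree_matrix b) f) \<le> 2 * sqrt \<kappa> * ell2_norm f"
    using p d ell2_add[of p d] by auto
qed

fun kept_path :: "(nat list \<Rightarrow> nat set) \<Rightarrow> nat list \<Rightarrow> nat list \<Rightarrow> bool" where
  "kept_path K v [] = True"
| "kept_path K v (k # w) = (k \<in> K v \<and> kept_path K (v @ [k]) w)"

lemma kept_path_snoc: "kept_path K v (w @ [k]) \<longleftrightarrow> kept_path K v w \<and> k \<in> K (v @ w)"
  by (induction w arbitrary: v) auto

text \<open>Keeping only the edges to the children in \<open>K\<close> cuts the tree into finite blocks, and the
  removed edges form a bounded matrix.\<close>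

proposition tree_resolvent_set:
  assumes removed: "\<And>v F. finite F \<Longrightarrow> F \<inter> K v = {} \<Longrightarrow> (\<Sum>k\<in>F. (c v k)\<^sup>2) \<le> \<kappa>"
    and kept: "\<And>v. finite {w. kept_path K v w}"
    and z: "Im z > 0"
  shows "z \<in> resolvent_set (op_closure (tree_rel c))"
proof -
  define a where "a v k = (if k \<in> K v then c v k else 0)" for v k
  define b where "b v k = (if k \<in> K v then 0 else c v k)" for v k
  have \<kappa>0: "\<kappa> \<ge> 0" using removed[of "{}"] by simp
  have b: "(\<Sum>k\<in>F. (b v k)\<^sup>2) \<le> \<kappa>" if "finite F" for v F
  proof -
    have "(\<Sum>k\<in>F. (b v k)\<^sup>2) = (\<Sum>k\<in>F - K v. (c v k)\<^sup>2)"
      using that by (intro sum.mono_neutral_cong_right) (auto simp: b_def)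
    also have "\<dots> \<le> \<kappa>" using that by (intro removed) auto
    finally show ?thesis .
  qed
  have "tree_matrix c = (\<lambda>u v. tree_matrix a u v + tree_matrix b u v)"
    by (auto simp: fun_eq_iff tree_matrix_def a_def b_def)
  moreover have "dense_range (mat_core (\<lambda>u v. tree_matrix a u v + tree_matrix b u v)) z"
  proof (rule dense_range_perturbation[OF tree_matrix_commute tree_matrix_commute _ bounded_tree_matrix[OF b] _ z])
    show "0 \<le> 2 * sqrt \<kappa>" using \<kappa>0 by simp
  next
    fix w :: complex assume w: "Im w > 0"
    show "dense_range (mat_core (tree_matrix a)) w"
    proof (rule dense_range_finite_blocks[OF tree_matrix_commute _ w])
      fix F :: "nat list set" assume F: "finite F"
      \<comment> \<open>Adding the ancestors first makes the set closed under parents; then the kept descendants are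
        added.\<close>
      define P where "P = (\<Union>v\<in>F. (\<lambda>n. take n v) ` {..length v})"
      define S where "S = (\<Union>v\<in>P. (\<lambda>w. v @ w) ` {w. kept_path K v w})"
      have P_butlast: "butlast u \<in> P" if u: "u \<in> P" for u
      proof -
        obtain v n where v: "v \<in> F" "n \<le> length v" "u = take n v"
          using u by (auto simp: P_def)
        have "butlast u = take (n - 1) v" using v by (simp add: butlast_take)
        thus ?thesis using v unfolding P_def by (intro UN_I[of v]) auto
      qed
      have "finite S" unfolding S_def P_def using F kept by auto
      moreover have "F \<subseteq> S"
      proof
        fix v assume "v \<in> F"
        hence "v \<in> P" unfolding P_def by (intro UN_I[of v]) (auto intro: image_eqI[of _ _ "length v"])
        thus "v \<in> S" unfolding S_def by (intro UN_I[of v]) (auto intro: image_eqI[of _ _ "[]"])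
      qed
      moreover have "u \<in> S" if "v \<in> S" "tree_matrix a u v \<noteq> 0" for u v
      proof -
        obtain r w where r: "r \<in> P" "kept_path K r w" "v = r @ w" using \<open>v \<in> S\<close> by (auto simp: S_def)
        consider k where "u = v @ [k]" "a v k \<noteq> 0" | k where "v = u @ [k]" "a u k \<noteq> 0"
        proof (cases "u \<noteq> [] \<and> butlast u = v")
          case True
          hence "u = v @ [last u]" by auto
          thus ?thesis using True \<open>tree_matrix a u v \<noteq> 0\<close> by (intro that(1)[of "last u"]) (auto simp: tree_matrix_def)
        next
          case False
          hence "v \<noteq> [] \<and> butlast v = u" using \<open>tree_matrix a u v \<noteq> 0\<close> by (auto simp: tree_matrix_def split: if_splits)
          moreover from this have "v = u @ [last v]" by auto
          ultimately show ?thesis using False \<open>tree_matrix a u v \<noteq> 0\<close> by (intro that(2)[of "last v"]) (auto simp: tree_matrix_def)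
        qed
        thus ?thesis
        proof cases
          case 1
          hence "kept_path K r (w @ [k])" using r by (auto simp: kept_path_snoc a_def split: if_splits)
          thus ?thesis using r 1 unfolding S_def by (intro UN_I[of r]) auto
        next
          case 2
          show ?thesis
          proof (cases w rule: rev_cases)
            case Nil
            hence "butlast r = u" using r(3) 2 by (metis append_Nil2 butlast_snoc)
            hence "u \<in> P" using P_butlast[OF r(1)] by simp
            thus ?thesis unfolding S_def by (intro UN_I[of u]) (auto intro: image_eqI[of _ _ "[]"])
          next
            case (snoc w' l)
            hence "u = r @ w'" "kept_path K r w'" using r 2 by (auto simp: kept_path_snoc)
            thus ?thesis using r(1) unfolding S_def by (intro UN_I[of r]) auto
          qed
        qed
      qed
      ultimately show "\<exists>S. finite S \<and> F \<subseteq> S \<and> (\<forall>v\<in>S. \<forall>u. tree_matrix a u v \<noteq> 0 \<longrightarrow> u \<in> S)" by blast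
    qed
  qed
  ultimately have "dense_range (tree_rel c) z" by (simp add: tree_rel_def)
  thus ?thesis using z by (subst resolvent_set_iff_dense_range[OF symmetric_tree_rel]) auto
qed

section \<open>Measurability of the root resolvent\<close>

definition weight_space :: "(nat list \<Rightarrow> nat \<Rightarrow> real) measure" where
  "weight_space = PiM UNIV (\<lambda>_. PiM UNIV (\<lambda>_. borel))"

lemma measurable_weight: "(\<lambda>c. c u k) \<in> borel_measurable weight_space"
  unfolding weight_space_def
  by (rule measurable_compose[OF measurable_component_singleton[of u] measurable_component_singleton[of k]]) auto

lemma measurable_tree_matrix: "(\<lambda>c. tree_matrix c u v) \<in> borel_measurable weight_space"
proof -
  note [measurable] = measurable_weight
  show ?thesis unfolding tree_matrix_def by measurable
qed

lemma ell2_dominated: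
  assumes "f \<in> ell2" "\<And>v. cmod (g v) \<le> a * cmod (f v)"
  shows "g \<in> ell2"
proof -
  have "(\<lambda>v. a * f v) \<in> ell2" by (rule ell2_scale(1)[OF assms(1)])
  hence "(\<lambda>v. (cmod (a * f v))\<^sup>2) summable_on UNIV" by (simp add: ell2_def)
  moreover have "(cmod (g v))\<^sup>2 \<le> (cmod (a * f v))\<^sup>2" for v
  proof (rule power_mono)
    have "a * cmod (f v) \<le> \<bar>a\<bar> * cmod (f v)" by (intro mult_right_mono) auto
    thus "cmod (g v) \<le> cmod (a * f v)" using assms(2)[of v] by (simp add: norm_mult)
  qed simp
  ultimately show ?thesis unfolding ell2_def mem_Collect_eq
    by (rule summable_on_comparison_test) auto
qed

text \<open>In a tree only finitely many vertices are adjacent to \<open>v\<close> and to another vertex of a given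
  finite set. Hence the image of a finitely supported vector can only be square summable if each
  column in its support is.\<close>

lemma tree_rel_column_ell2:
  assumes fg: "(f, g) \<in> tree_rel c" and v: "f v \<noteq> 0"
  shows "(\<lambda>u. complex_of_real (tree_matrix c u v)) \<in> ell2"
proof -
  define S where "S = {w. f w \<noteq> 0}"
  have S: "finite S" and g: "g \<in> ell2" "\<And>u. g u = (\<Sum>w\<in>S. complex_of_real (tree_matrix c u w) * f w)"
    using fg by (auto simp: tree_rel_def mat_core_def mat_apply_def S_def)
  \<comment> \<open>A common neighbour of \<open>v\<close> and another vertex \<open>w\<close> is the parent of \<open>v\<close> or the parent of \<open>w\<close>.\<close>
  define N where "N = insert (butlast v) (butlast ` S)"
  have N: "finite N" using S by (simp add: N_def)
  have single: "tree_matrix c u v = 0 \<or> (\<forall>w\<in>S - {v}. tree_matrix c u w = 0)" if "u \<notin> N" for u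
  proof (rule disjCI)
    assume "\<not> (\<forall>w\<in>S - {v}. tree_matrix c u w = 0)"
    then obtain w where w: "w \<in> S" "w \<noteq> v" "tree_matrix c u w \<noteq> 0" by blast
    have "u \<noteq> butlast w" "u \<noteq> butlast v" using that w(1) by (auto simp: N_def)
    hence "butlast u = w" "u \<noteq> []" using w(3) by (auto simp: tree_matrix_def split: if_splits)
    thus "tree_matrix c u v = 0" using \<open>w \<noteq> v\<close> \<open>u \<noteq> butlast v\<close> by (auto simp: tree_matrix_def)
  qed
  define col where "col u = complex_of_real (tree_matrix c u v)" for u
  have 1: "(\<lambda>u. if u \<in> N then col u else 0) \<in> ell2" using N by (intro ell2_finite_support(1)[of N]) auto
  have 2: "(\<lambda>u. if u \<in> N then 0 else col u) \<in> ell2"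
  proof (rule ell2_dominated[OF g(1), of _ "1 / cmod (f v)"])
    fix u
    show "cmod (if u \<in> N then 0 else col u) \<le> 1 / cmod (f v) * cmod (g u)"
    proof (cases "u \<in> N \<or> col u = 0")
      case False
      hence "\<forall>w\<in>S - {v}. tree_matrix c u w = 0" using single by (auto simp: col_def)
      hence "g u = (\<Sum>w\<in>{v}. complex_of_real (tree_matrix c u w) * f w)"
        unfolding g(2) using S v by (intro sum.mono_neutral_right) (auto simp: S_def)
      thus ?thesis using v False by (simp add: col_def norm_mult)
    qed auto
  qed
  have "(\<lambda>u. (if u \<in> N then col u else 0) + (if u \<in> N then 0 else col u)) = col" by auto
  thus ?thesis using ell2_add(1)[OF 1 2] unfolding col_def by simp
qed

definition rat_vec :: "('v \<times> rat \<times> rat) list \<Rightarrow> 'v \<Rightarrow> complex" where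
  "rat_vec l v = (\<Sum>(w, a, b)\<leftarrow>l. if w = v then Complex (of_rat a) (of_rat b) else 0)"

lemma finite_rat_vec_support: "finite {v. rat_vec l v \<noteq> 0}"
proof (rule finite_subset)
  show "{v. rat_vec l v \<noteq> 0} \<subseteq> fst ` set l"
  proof
    fix v assume "v \<in> {v. rat_vec l v \<noteq> 0}"
    moreover have "rat_vec l v = 0" if "v \<notin> fst ` set l"
      using that by (induction l) (auto simp: rat_vec_def)
    ultimately show "v \<in> fst ` set l" by blast
  qed
qed simp

lemma rat_vec_approx:
  assumes S: "finite S" and d: "d > 0"
  shows "\<exists>l. (\<forall>v\<in>S. cmod (rat_vec l v - f v) < d) \<and> (\<forall>v. v \<notin> S \<longrightarrow> rat_vec l v = 0)"
proof -
  have "\<exists>q::rat. \<bar>of_rat q - x\<bar> < d / 2" for x :: real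
  proof -
    obtain q :: rat where "x - d/2 < of_rat q" "of_rat q < x + d/2"
      using of_rat_dense[of "x - d/2" "x + d/2"] d by auto
    hence "\<bar>of_rat q - x\<bar> < d / 2" by linarith
    thus ?thesis by blast
  qed
  then obtain r :: "real \<Rightarrow> rat" where r: "\<And>x. \<bar>of_rat (r x) - x\<bar> < d / 2" by metis
  obtain xs where xs: "set xs = S" "distinct xs" using finite_distinct_list[OF S] by blast
  define l where "l = map (\<lambda>w. (w, r (Re (f w)), r (Im (f w)))) xs"
  have l: "rat_vec l v = (if v \<in> S then Complex (of_rat (r (Re (f v)))) (of_rat (r (Im (f v)))) else 0)" for v
  proof -
    have "rat_vec l v = (\<Sum>w\<leftarrow>xs. if w = v then Complex (of_rat (r (Re (f w)))) (of_rat (r (Im (f w)))) else 0)"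
      by (simp add: rat_vec_def l_def o_def)
    also have "\<dots> = (\<Sum>w\<in>S. if w = v then Complex (of_rat (r (Re (f w)))) (of_rat (r (Im (f w)))) else 0)"
      using xs by (simp add: sum_list_distinct_conv_sum_set)
    finally show ?thesis using S by (simp add: sum.delta)
  qed
  have "cmod (rat_vec l v - f v) < d" if "v \<in> S" for v
  proof -
    have "cmod (rat_vec l v - f v) \<le> \<bar>Re (rat_vec l v - f v)\<bar> + \<bar>Im (rat_vec l v - f v)\<bar>"
      by (rule cmod_le)
    thus ?thesis using that r[of "Re (f v)"] r[of "Im (f v)"] by (simp add: l)
  qed
  thus ?thesis using l by (intro exI[of _ l]) auto
qed

lemma tree_rel_rat_approx:
  assumes fg: "(f, g) \<in> tree_rel c" and h: "h \<in> ell2" and e: "e > 0"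
    and close: "ell2_norm (\<lambda>v. g v - z * f v - h v) < e"
  shows "\<exists>l. (rat_vec l, mat_apply (tree_matrix c) (rat_vec l)) \<in> tree_rel c \<and>
    ell2_norm (\<lambda>v. mat_apply (tree_matrix c) (rat_vec l) v - z * rat_vec l v - h v) < e"
proof -
  define S where "S = {w. f w \<noteq> 0}"
  have S: "finite S" and g: "g \<in> ell2" "g = mat_apply (tree_matrix c) f"
    using fg by (auto simp: tree_rel_def mat_core_def S_def)
  define col where "col v = (\<lambda>u. complex_of_real (tree_matrix c u v))" for v
  define k where "k v = (\<lambda>u. col v u - z * basis_vec v u)" for v
  have col: "col v \<in> ell2" if "v \<in> S" for v
    unfolding col_def using that by (intro tree_rel_column_ell2[OF fg]) (simp add: S_def)
  have k: "k v \<in> ell2" if "v \<in> S" for v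
    unfolding k_def using that by (intro ell2_diff(1) col ell2_scale(1)) auto
  define m where "m = 1 + (\<Sum>v\<in>S. ell2_norm (k v))"
  have m: "m > 0" unfolding m_def by (intro add_pos_nonneg sum_nonneg) auto
  define gap where "gap = e - ell2_norm (\<lambda>v. g v - z * f v - h v)"
  have gap: "gap > 0" using close by (simp add: gap_def)
  obtain l where l: "\<And>v. v \<in> S \<Longrightarrow> cmod (rat_vec l v - f v) < gap / m" "\<And>v. v \<notin> S \<Longrightarrow> rat_vec l v = 0"
    using rat_vec_approx[OF S, of "gap / m" f] gap m by auto
  define q where "q = rat_vec l"
  have q: "q v = 0" if "v \<notin> S" for v using l(2) that by (simp add: q_def)
  have app: "mat_apply (tree_matrix c) p u = (\<Sum>v\<in>S. p v * col v u)" if "\<And>v. v \<notin> S \<Longrightarrow> p v = 0" for p u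
    using S that by (subst mat_apply_superset[of S]) (auto simp: col_def mult.commute)
  have f0: "f v = 0" if "v \<notin> S" for v using that by (simp add: S_def)
  have diff: "(mat_apply (tree_matrix c) q u - z * q u) - (g u - z * f u) = (\<Sum>v\<in>S. (q v - f v) * k v u)" for u
  proof -
    have pt: "p u = (\<Sum>v\<in>S. p v * basis_vec v u)" if "\<And>v. v \<notin> S \<Longrightarrow> p v = 0" for p :: "nat list \<Rightarrow> complex"
      using S that by (simp add: basis_vec_def if_distrib[of "(*) _"] sum.delta' cong: if_cong)
    have "z * q u = (\<Sum>v\<in>S. z * (q v * basis_vec v u))" "z * f u = (\<Sum>v\<in>S. z * (f v * basis_vec v u))"
      using pt[of q, OF q] pt[of f, OF f0] by (simp_all add: sum_distrib_left)
    moreover have "mat_apply (tree_matrix c) q u = (\<Sum>v\<in>S. q v * col v u)" by (rule app) (rule q)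
    moreover have "g u = (\<Sum>v\<in>S. f v * col v u)" unfolding g(2) by (rule app) (rule f0)
    ultimately show ?thesis by (simp add: k_def sum_subtractf sum.distrib algebra_simps)
  qed
  have core: "(q, mat_apply (tree_matrix c) q) \<in> tree_rel c"
  proof -
    have "mat_apply (tree_matrix c) q = (\<lambda>u. \<Sum>v\<in>S. q v * col v u)"
      by (rule ext, rule app) (rule q)
    hence "mat_apply (tree_matrix c) q \<in> ell2" by (auto intro!: ell2_sum ell2_scale(1) col)
    thus ?thesis using finite_rat_vec_support[of l] by (simp add: tree_rel_def mat_core_def q_def)
  qed
  have res: "(\<lambda>u. g u - z * f u) \<in> ell2" by (rule symmetric_rel_residual_ell2[OF symmetric_tree_rel fg])
  have "ell2_norm (\<lambda>u. mat_apply (tree_matrix c) q u - z * q u - h u)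
      = ell2_norm (\<lambda>u. (g u - z * f u - h u) + (\<Sum>v\<in>S. (q v - f v) * k v u))"
    unfolding diff[symmetric] by (simp add: algebra_simps)
  also have "\<dots> \<le> ell2_norm (\<lambda>u. g u - z * f u - h u) + ell2_norm (\<lambda>u. \<Sum>v\<in>S. (q v - f v) * k v u)"
    by (intro ell2_add(2) ell2_diff(1)[OF res h] ell2_sum ell2_scale(1) k)
  also have "ell2_norm (\<lambda>u. \<Sum>v\<in>S. (q v - f v) * k v u) \<le> (\<Sum>v\<in>S. ell2_norm (\<lambda>u. (q v - f v) * k v u))"
    by (intro ell2_norm_sum_le ell2_scale(1) k)
  also have "\<dots> = (\<Sum>v\<in>S. cmod (q v - f v) * ell2_norm (k v))" by (intro sum.cong ell2_scale(2) k refl)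
  also have "\<dots> \<le> (\<Sum>v\<in>S. gap / m * ell2_norm (k v))"
    using l(1) by (intro sum_mono mult_right_mono ell2_norm_nonneg) (auto simp: q_def less_imp_le)
  also have "\<dots> = gap / m * (\<Sum>v\<in>S. ell2_norm (k v))" by (simp add: sum_distrib_left)
  also have "\<dots> < gap / m * m" unfolding m_def[symmetric] using gap m by (intro mult_strict_left_mono) (auto simp: m_def)
  also have "\<dots> = gap" using m by simp
  finally have "ell2_norm (\<lambda>u. mat_apply (tree_matrix c) q u - z * q u - h u) < e" by (simp add: gap_def)
  with core show ?thesis unfolding q_def by blast
qed

lemma nn_integral_ell2:
  fixes f :: "'v :: countable \<Rightarrow> complex"
  shows "f \<in> ell2 \<Longrightarrow> (\<integral>\<^sup>+v. ennreal ((cmod (f v))\<^sup>2) \<partial>count_space UNIV) = ennreal ((ell2_norm f)\<^sup>2)"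
    and "(\<integral>\<^sup>+v. ennreal ((cmod (f v))\<^sup>2) \<partial>count_space UNIV) < \<infinity> \<Longrightarrow> f \<in> ell2"
proof -
  assume "f \<in> ell2"
  hence "(\<lambda>v. norm ((cmod (f v))\<^sup>2)) summable_on UNIV" by (simp add: ell2_def)
  hence s: "Infinite_Set_Sum.abs_summable_on (\<lambda>v. (cmod (f v))\<^sup>2) UNIV" by (simp only: abs_summable_equivalent)
  have "(\<integral>\<^sup>+v. ennreal ((cmod (f v))\<^sup>2) \<partial>count_space UNIV) = ennreal (infsetsum (\<lambda>v. (cmod (f v))\<^sup>2) UNIV)"
    by (rule nn_integral_conv_infsetsum[OF s]) simp
  also have "\<dots> = ennreal (\<Sum>\<^sub>\<infinity>v. (cmod (f v))\<^sup>2)" by (simp add: infsetsum_infsum[OF s])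
  finally show "(\<integral>\<^sup>+v. ennreal ((cmod (f v))\<^sup>2) \<partial>count_space UNIV) = ennreal ((ell2_norm f)\<^sup>2)"
    by (simp add: ell2_norm_def infsum_nonneg)
next
  assume "(\<integral>\<^sup>+v. ennreal ((cmod (f v))\<^sup>2) \<partial>count_space UNIV) < \<infinity>"
  hence "integrable (count_space UNIV) (\<lambda>v. (cmod (f v))\<^sup>2)"
    by (intro integrableI_bounded) auto
  hence "Infinite_Set_Sum.abs_summable_on (\<lambda>v. (cmod (f v))\<^sup>2) UNIV"
    by (simp add: Infinite_Set_Sum.abs_summable_on_def)
  hence "(\<lambda>v. norm ((cmod (f v))\<^sup>2)) summable_on UNIV" by (simp only: abs_summable_equivalent)
  thus "f \<in> ell2" by (simp add: ell2_def)
qed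

text \<open>For finitely supported \<open>f\<close> the value is infinite exactly if the image of \<open>f\<close> is not square
  summable, so that one measurable function records both the domain of the operator and the size of
  the residual.\<close>

definition residual_sq :: "complex \<Rightarrow> (nat list \<Rightarrow> nat \<Rightarrow> real) \<Rightarrow> (nat list \<Rightarrow> complex) \<Rightarrow> nat list \<Rightarrow> ennreal" where
  "residual_sq z c f u = (\<integral>\<^sup>+v. ennreal ((cmod (mat_apply (tree_matrix c) f v - z * f v - basis_vec u v))\<^sup>2) \<partial>count_space UNIV)"

lemma measurable_residual_sq: "(\<lambda>c. residual_sq z c f u) \<in> borel_measurable weight_space"
proof -
  interpret sigma_finite_measure "count_space (UNIV :: nat list set)"
    by (rule sigma_finite_measure_count_space)
  note [measurable] = measurable_tree_matrix
  show ?thesis unfolding residual_sq_def mat_apply_def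
    by (rule borel_measurable_nn_integral, subst measurable_pair_swap_iff, rule measurable_pair_measure_countable1)
      (auto simp: case_prod_beta)
qed

lemma residual_sq_less_iff:
  assumes f: "finite {v. f v \<noteq> 0}" and e: "e > 0"
  shows "residual_sq z c f u < ennreal (e\<^sup>2) \<longleftrightarrow>
    (f, mat_apply (tree_matrix c) f) \<in> tree_rel c \<and>
    ell2_norm (\<lambda>v. mat_apply (tree_matrix c) f v - z * f v - basis_vec u v) < e"
proof -
  let ?r = "\<lambda>v. mat_apply (tree_matrix c) f v - z * f v - basis_vec u v"
  have fe: "f \<in> ell2" using ell2_finite_support(1)[OF f] by simp
  have iff: "mat_apply (tree_matrix c) f \<in> ell2 \<longleftrightarrow> ?r \<in> ell2"
  proof
    assume "mat_apply (tree_matrix c) f \<in> ell2"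
    thus "?r \<in> ell2" by (intro ell2_diff(1) ell2_scale(1) fe basis_vec_ell2)
  next
    assume "?r \<in> ell2"
    hence "(\<lambda>v. ?r v + (z * f v + basis_vec u v)) \<in> ell2"
      by (intro ell2_add(1) ell2_scale(1) fe basis_vec_ell2)
    thus "mat_apply (tree_matrix c) f \<in> ell2" by simp
  qed
  show ?thesis
  proof (cases "?r \<in> ell2")
    case True
    have "residual_sq z c f u = ennreal ((ell2_norm ?r)\<^sup>2)"
      unfolding residual_sq_def by (rule nn_integral_ell2(1)[OF True])
    moreover have "(ell2_norm ?r)\<^sup>2 < e\<^sup>2 \<longleftrightarrow> ell2_norm ?r < e"
      using e ell2_norm_nonneg[of ?r] by (smt (verit) power2_less_imp_less power_strict_mono zero_less_numeral)
    ultimately show ?thesis using iff True f by (auto simp: tree_rel_def mat_core_def ennreal_less_iff)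
  next
    case False
    hence "\<not> residual_sq z c f u < \<infinity>" using nn_integral_ell2(2)[of ?r] unfolding residual_sq_def by blast
    hence "\<not> residual_sq z c f u < ennreal (e\<^sup>2)" by (metis ennreal_less_top infinity_ennreal_def less_trans)
    thus ?thesis using iff False by (auto simp: tree_rel_def mat_core_def)
  qed
qed

text \<open>Density of the range can be tested with countably many vectors, and these vectors also
  approximate the resolvent.\<close>

lemma resolvent_set_iff_residual:
  assumes z: "Im z > 0"
  shows "z \<in> resolvent_set (op_closure (tree_rel c)) \<longleftrightarrow>
    (\<forall>u. \<forall>n. \<exists>j. residual_sq z c (rat_vec (from_nat j)) u < ennreal ((1 / Suc n)\<^sup>2))"
proof -
  have "z \<in> resolvent_set (op_closure (tree_rel c)) \<longleftrightarrow> dense_range (tree_rel c) z"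
    using z by (intro resolvent_set_iff_dense_range symmetric_tree_rel) auto
  also have "\<dots> \<longleftrightarrow> (\<forall>u. \<forall>n. \<exists>j. residual_sq z c (rat_vec (from_nat j)) u < ennreal ((1 / Suc n)\<^sup>2))"
  proof (intro iffI allI)
    fix u :: "nat list" and n :: nat assume "dense_range (tree_rel c) z"
    then obtain f g where "(f, g) \<in> tree_rel c" "ell2_norm (\<lambda>v. g v - z * f v - basis_vec u v) < 1 / Suc n"
      unfolding dense_range_def using basis_vec_ell2[of u]
      by (meson of_nat_0_less_iff zero_less_Suc zero_less_divide_1_iff)
    then obtain l where "(rat_vec l, mat_apply (tree_matrix c) (rat_vec l)) \<in> tree_rel c \<and>
        ell2_norm (\<lambda>v. mat_apply (tree_matrix c) (rat_vec l) v - z * rat_vec l v - basis_vec u v) < 1 / Suc n"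
      using tree_rel_rat_approx[of f g c "basis_vec u" "1 / Suc n" z] by auto
    hence "residual_sq z c (rat_vec l) u < ennreal ((1 / Suc n)\<^sup>2)"
      by (subst residual_sq_less_iff[OF finite_rat_vec_support]) auto
    thus "\<exists>j. residual_sq z c (rat_vec (from_nat j)) u < ennreal ((1 / Suc n)\<^sup>2)"
      by (intro exI[of _ "to_nat l"]) simp
  next
    assume *: "\<forall>u. \<forall>n. \<exists>j. residual_sq z c (rat_vec (from_nat j)) u < ennreal ((1 / Suc n)\<^sup>2)"
    show "dense_range (tree_rel c) z"
    proof (rule dense_range_basisI[OF symmetric_tree_rel])
      fix u :: "nat list" and e :: real assume "e > 0"
      then obtain n where n: "1 / Suc n < e" using nat_approx_posE by blast
      obtain j where "residual_sq z c (rat_vec (from_nat j)) u < ennreal ((1 / Suc n)\<^sup>2)" using * by blast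
      hence "(rat_vec (from_nat j), mat_apply (tree_matrix c) (rat_vec (from_nat j))) \<in> tree_rel c \<and>
        ell2_norm (\<lambda>v. mat_apply (tree_matrix c) (rat_vec (from_nat j)) v - z * rat_vec (from_nat j) v - basis_vec u v) < 1 / Suc n"
        by (subst (asm) residual_sq_less_iff[OF finite_rat_vec_support]) auto
      thus "\<exists>f g. (f, g) \<in> tree_rel c \<and> ell2_norm (\<lambda>v. g v - z * f v - basis_vec u v) < e"
        using n less_trans by blast
    qed
  qed
  finally show ?thesis .
qed

proposition measurable_tree_resolvent:
  assumes z: "Im z > 0"
  shows "tree_resolvent z \<in> borel_measurable weight_space"
proof -
  let ?P = "\<lambda>c. \<forall>u. \<forall>n. \<exists>j. residual_sq z c (rat_vec (from_nat j)) u < ennreal ((1 / Suc n)\<^sup>2)"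
  note [measurable] = measurable_residual_sq
  define J where "J n c = (LEAST j. residual_sq z c (rat_vec (from_nat j)) [] < ennreal ((1 / Suc n)\<^sup>2))" for n c
  have J [measurable]: "J n \<in> measurable weight_space (count_space UNIV)" for n
    unfolding J_def by measurable
  have P [measurable]: "Measurable.pred weight_space ?P" by measurable
  define s where "s n c = (if ?P c then rat_vec (from_nat (J n c)) ([] :: nat list) else 0 :: complex)" for n c
  show ?thesis
  proof (rule borel_measurable_LIMSEQ_metric[of s])
    fix n
    have "(\<lambda>c. rat_vec (from_nat (J n c)) ([] :: nat list) :: complex) \<in> borel_measurable weight_space"
      by (rule measurable_compose[OF J]) simp
    thus "s n \<in> borel_measurable weight_space" unfolding s_def by measurable
  next
    fix c :: "nat list \<Rightarrow> nat \<Rightarrow> real"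
    show "(\<lambda>n. s n c) \<longlonglongrightarrow> tree_resolvent z c"
    proof (cases "?P c")
      case True
      have res: "z \<in> resolvent_set (op_closure (tree_rel c))" using True resolvent_set_iff_residual[OF z] by blast
      have "norm (s n c - tree_resolvent z c) \<le> 1 / Im z * (1 / Suc n)" for n
      proof -
        let ?f = "rat_vec (from_nat (J n c)) :: nat list \<Rightarrow> complex"
        have "residual_sq z c ?f [] < ennreal ((1 / Suc n)\<^sup>2)"
          unfolding J_def by (rule LeastI_ex) (use True in blast)
        hence f: "(?f, mat_apply (tree_matrix c) ?f) \<in> tree_rel c"
          "ell2_norm (\<lambda>v. mat_apply (tree_matrix c) ?f v - z * ?f v - basis_vec [] v) < 1 / Suc n"
          by (subst (asm) residual_sq_less_iff[OF finite_rat_vec_support]; simp)+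
        have "\<bar>Im z\<bar> * cmod (?f [] - 1 * tree_resolvent z c)
            \<le> ell2_norm (\<lambda>v. mat_apply (tree_matrix c) ?f v - z * ?f v - 1 * basis_vec [] v)"
          unfolding tree_resolvent_def
          by (intro resolvent_entry_approx symmetric_tree_closure res subset_op_closure symmetric_tree_rel f)
        hence "Im z * cmod (?f [] - tree_resolvent z c) \<le> 1 / Suc n" using f(2) z by simp
        hence "cmod (?f [] - tree_resolvent z c) \<le> 1 / Suc n / Im z"
          using z by (simp only: pos_le_divide_eq mult.commute)
        thus ?thesis using True by (simp add: s_def mult.commute)
      qed
      hence bound: "\<forall>n. norm (s n c - tree_resolvent z c) \<le> 1 / Im z * (1 / Suc n)" by blast
      have "(\<lambda>n. 1 / Im z * (1 / real (Suc n))) \<longlonglongrightarrow> 1 / Im z * 0"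
        by (intro tendsto_intros LIMSEQ_Suc[OF lim_1_over_n])
      hence "(\<lambda>n. 1 / Im z * (1 / real (Suc n))) \<longlonglongrightarrow> 0" by simp
      with always_eventually[OF bound] have "(\<lambda>n. s n c - tree_resolvent z c) \<longlonglongrightarrow> 0"
        by (rule Lim_null_comparison)
      thus ?thesis by (rule LIM_zero_cancel)
    next
      case False
      hence "z \<notin> resolvent_set (op_closure (tree_rel c))" using resolvent_set_iff_residual[OF z] by blast
      moreover have "s n c = 0" for n using False by (simp only: s_def if_False)
      ultimately show ?thesis by (simp add: tree_resolvent_def resolvent_entry_def)
    qed
  qed
qed

section \<open>Points of a Poisson random measure\<close>

text \<open>The index 0 is reserved for the nonrandom edge and does not count as a point.\<close>

definition weight_count :: "(nat \<Rightarrow> real) \<Rightarrow> real set \<Rightarrow> ennreal" where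
  "weight_count d I = emeasure (count_space UNIV) {k. 1 \<le> k \<and> d k \<in> I}"

lemma measurable_weight_count:
  assumes [measurable]: "I \<in> sets borel" "\<And>k. (\<lambda>\<omega>. d \<omega> k) \<in> borel_measurable M"
  shows "(\<lambda>\<omega>. weight_count (d \<omega>) I) \<in> borel_measurable M"
proof -
  have "weight_count (d \<omega>) I = (\<Sum>k. if 1 \<le> k \<and> d \<omega> k \<in> I then 1 else 0)" for \<omega>
  proof -
    have "weight_count (d \<omega>) I = (\<integral>\<^sup>+k. indicator {k. 1 \<le> k \<and> d \<omega> k \<in> I} k \<partial>count_space UNIV)"
      by (simp add: weight_count_def)
    also have "\<dots> = (\<Sum>k. indicator {k. 1 \<le> k \<and> d \<omega> k \<in> I} k)"
      by (rule nn_integral_count_space_nat)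
    finally show ?thesis by (simp add: indicator_def of_bool_def)
  qed
  thus ?thesis by simp measurable
qed

lemma weight_count_eq_point_count:
  "weight_count (\<lambda>k. \<bar>C k\<bar>) I = point_count (\<lambda>k. ereal (C k)) {x. \<bar>x\<bar> \<in> I}"
  unfolding weight_count_def point_count_def by (rule arg_cong[where f = "emeasure _"]) auto

definition levy_mass :: "real measure \<Rightarrow> real set \<Rightarrow> real" where
  "levy_mass \<nu> I = measure \<nu> {x. \<bar>x\<bar> \<in> I}"

context
  fixes \<nu> :: "real measure"
  assumes \<nu>: "symmetric_levy_measure \<nu>"
begin

lemma levy_sets: "sets \<nu> = sets punctured_borel" and levy_space: "space \<nu> = - {0}"
proof -
  show s: "sets \<nu> = sets punctured_borel" using \<nu> by (simp add: symmetric_levy_measure_def)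
  show "space \<nu> = - {0}" using sets_eq_imp_space_eq[OF s] by (simp add: punctured_borel_def space_restrict_space)
qed

lemma levy_setsI: "B \<in> sets borel \<Longrightarrow> 0 \<notin> B \<Longrightarrow> B \<in> sets \<nu>"
  unfolding levy_sets punctured_borel_def by (subst sets_restrict_space_iff) auto

lemma levy_abs_set: "I \<in> sets borel \<Longrightarrow> I \<subseteq> {0<..} \<Longrightarrow> {x. \<bar>x\<bar> \<in> I} \<in> sets \<nu>"
proof (rule levy_setsI)
  assume [measurable]: "I \<in> sets borel"
  show "{x. \<bar>x\<bar> \<in> I} \<in> sets borel" by measurable
qed auto

lemma levy_measurable: "f \<in> borel_measurable borel \<Longrightarrow> f \<in> borel_measurable \<nu>"
  unfolding measurable_cong_sets[OF levy_sets refl] punctured_borel_def by (rule measurable_restrict_space1)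

lemma levy_integral: "(\<integral>\<^sup>+ x. ennreal (min 1 (x\<^sup>2)) \<partial>\<nu>) < \<infinity>"
  using \<nu> by (simp add: symmetric_levy_measure_def)

lemma levy_emeasure_finite:
  assumes I: "I \<in> sets borel" "I \<subseteq> {t..}" and t: "t > 0"
  shows "emeasure \<nu> {x. \<bar>x\<bar> \<in> I} < \<infinity>"
proof -
  have B: "{x. \<bar>x\<bar> \<in> I} \<in> sets \<nu>" using I t by (intro levy_abs_set) auto
  define m where "m = min 1 (t\<^sup>2)"
  have m: "m > 0" using t by (simp add: m_def)
  have "ennreal m * emeasure \<nu> {x. \<bar>x\<bar> \<in> I} = (\<integral>\<^sup>+ x. ennreal m * indicator {x. \<bar>x\<bar> \<in> I} x \<partial>\<nu>)"
    using B by (simp add: nn_integral_cmult_indicator)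
  also have "\<dots> \<le> (\<integral>\<^sup>+ x. ennreal (min 1 (x\<^sup>2)) \<partial>\<nu>)"
  proof (rule nn_integral_mono)
    fix x :: real
    show "ennreal m * indicator {x. \<bar>x\<bar> \<in> I} x \<le> ennreal (min 1 (x\<^sup>2))"
    proof (cases "\<bar>x\<bar> \<in> I")
      case True
      hence "t \<le> \<bar>x\<bar>" using I by auto
      hence "t\<^sup>2 \<le> x\<^sup>2" using t by (simp add: abs_le_square_iff[symmetric])
      thus ?thesis using True by (auto simp: m_def intro!: ennreal_leI)
    qed simp
  qed
  also have "\<dots> < \<infinity>" by (rule levy_integral)
  finally show ?thesis using m by (auto simp: ennreal_mult_less_top)
qed

lemma levy_mass_eq:
  assumes "I \<in> sets borel" "I \<subseteq> {t..}" "t > 0"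
  shows "emeasure \<nu> {x. \<bar>x\<bar> \<in> I} = ennreal (levy_mass \<nu> I)"
  using levy_emeasure_finite[OF assms] unfolding levy_mass_def by (intro emeasure_eq_ennreal_measure) auto

end

section \<open>Poisson moments\<close>

lemma (in prob_space) AE_poisson_finite:
  fixes N :: "'a \<Rightarrow> ennreal"
  assumes N: "N \<in> borel_measurable M" and l: "l \<ge> 0"
    and pmf: "\<And>n::nat. prob {\<omega>\<in>space M. N \<omega> = of_nat n} = l ^ n / fact n * exp (- l)"
  shows "AE \<omega> in M. \<exists>n::nat. N \<omega> = of_nat n"
proof -
  have [measurable]: "N \<in> borel_measurable M" by fact
  let ?A = "\<lambda>n::nat. {\<omega>\<in>space M. N \<omega> = of_nat n}"
  have "(\<lambda>n. prob (?A n)) sums prob (\<Union>n. ?A n)"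
    by (rule finite_measure_UNION) (auto simp: disjoint_family_on_def)
  moreover have "(\<lambda>n. l ^ n / fact n * exp (- l)) sums (exp l * exp (- l))"
    using exp_converges[of l] by (intro sums_mult2) (simp add: field_simps)
  ultimately have "prob (\<Union>n. ?A n) = exp l * exp (- l)" unfolding pmf by (rule sums_unique2)
  hence "prob (\<Union>n. ?A n) = 1" by (simp add: exp_minus)
  hence "AE \<omega> in M. \<omega> \<in> (\<Union>n. ?A n)" by (subst prob_eq_1[symmetric]) measurable
  thus ?thesis by eventually_elim auto
qed

lemma (in prob_space) nn_integral_poisson:
  fixes N :: "'a \<Rightarrow> ennreal" and h :: "nat \<Rightarrow> real"
  assumes N: "N \<in> borel_measurable M" and l: "l \<ge> 0"
    and pmf: "\<And>n::nat. prob {\<omega>\<in>space M. N \<omega> = of_nat n} = l ^ n / fact n * exp (- l)"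
    and g: "\<And>n. g (of_nat n) = ennreal (h n)" and h: "\<And>n. h n \<ge> 0"
    and g_meas: "g \<in> borel_measurable borel"
    and s: "(\<lambda>n. h n * (l ^ n / fact n * exp (- l))) sums s"
  shows "(\<integral>\<^sup>+\<omega>. g (N \<omega>) \<partial>M) = ennreal s"
proof -
  have [measurable]: "N \<in> borel_measurable M" "g \<in> borel_measurable borel" by fact+
  let ?A = "\<lambda>n::nat. {\<omega>\<in>space M. N \<omega> = of_nat n}"
  have "(\<integral>\<^sup>+\<omega>. g (N \<omega>) \<partial>M) = (\<integral>\<^sup>+\<omega>. (\<Sum>n. ennreal (h n) * indicator (?A n) \<omega>) \<partial>M)"
  proof (rule nn_integral_cong_AE)
    show "AE \<omega> in M. g (N \<omega>) = (\<Sum>n. ennreal (h n) * indicator (?A n) \<omega>)"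
      using AE_poisson_finite[OF N l pmf] AE_space
    proof eventually_elim
      case (elim \<omega>)
      then obtain m :: nat where m: "N \<omega> = of_nat m" by blast
      have "(\<Sum>n. ennreal (h n) * indicator (?A n) \<omega>) = (\<Sum>n\<in>{m}. ennreal (h n) * indicator (?A n) \<omega>)"
        using m by (intro suminf_finite) (auto simp: indicator_def)
      thus ?case using m elim g by simp
    qed
  qed
  also have "\<dots> = (\<Sum>n. \<integral>\<^sup>+\<omega>. ennreal (h n) * indicator (?A n) \<omega> \<partial>M)"
    by (rule nn_integral_suminf) measurable
  also have "\<dots> = (\<Sum>n. ennreal (h n * (l ^ n / fact n * exp (- l))))"
  proof (rule arg_cong[where f = suminf], rule ext)
    fix n
    have "(\<integral>\<^sup>+\<omega>. ennreal (h n) * indicator (?A n) \<omega> \<partial>M) = ennreal (h n) * ennreal (prob (?A n))"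
      by (simp add: nn_integral_cmult_indicator emeasure_eq_measure)
    thus "(\<integral>\<^sup>+\<omega>. ennreal (h n) * indicator (?A n) \<omega> \<partial>M) = ennreal (h n * (l ^ n / fact n * exp (- l)))"
      by (simp only: pmf ennreal_mult'[OF h])
  qed
  also have "\<dots> = ennreal s" using h l s by (intro suminf_ennreal_eq) auto
  finally show ?thesis .
qed

lemma (in prob_space) poisson_mean:
  fixes N :: "'a \<Rightarrow> ennreal"
  assumes N: "N \<in> borel_measurable M" and l: "l \<ge> 0"
    and pmf: "\<And>n::nat. prob {\<omega>\<in>space M. N \<omega> = of_nat n} = l ^ n / fact n * exp (- l)"
  shows "(\<integral>\<^sup>+\<omega>. N \<omega> \<partial>M) = ennreal l"
proof (rule nn_integral_poisson[where g = "\<lambda>x. x" and h = real, OF N l pmf])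
  have "(\<lambda>n. l ^ n / fact n) sums exp l" using exp_converges[of l] by (simp add: field_simps)
  hence 1: "(\<lambda>n. l * exp (- l) * (l ^ n / fact n)) sums (l * exp (- l) * exp l)" by (rule sums_mult)
  have 2: "real (Suc n) * (l ^ Suc n / fact (Suc n) * exp (- l)) = l * exp (- l) * (l ^ n / fact n)" for n
    by (simp del: of_nat_Suc)
  have 3: "l * exp (- l) * exp l = l" by (simp add: exp_minus)
  have "(\<lambda>n. real (Suc n) * (l ^ Suc n / fact (Suc n) * exp (- l))) sums l"
    unfolding 2 using 1 unfolding 3 .
  hence "(\<lambda>n. real n * (l ^ n / fact n * exp (- l))) sums (l + real 0 * (l ^ 0 / fact 0 * exp (- l)))"
    by (subst (asm) sums_Suc_iff) simp
  thus "(\<lambda>n. real n * (l ^ n / fact n * exp (- l))) sums l" by simp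
qed (auto simp: ennreal_of_nat_eq_real_of_nat)

text \<open>The exponential moment bounds the mean of a Poisson variable above a high threshold, because
  \<open>n\<close> is at most \<open>exp n\<close> and the indicator of \<open>n > a\<close> is at most \<open>exp (n - a)\<close>.\<close>

lemma (in prob_space) poisson_excess:
  fixes N :: "'a \<Rightarrow> ennreal"
  assumes N: "N \<in> borel_measurable M" and l: "l \<ge> 0"
    and pmf: "\<And>n::nat. prob {\<omega>\<in>space M. N \<omega> = of_nat n} = l ^ n / fact n * exp (- l)"
    and a: "a \<ge> 0"
  shows "(\<integral>\<^sup>+\<omega>. (if N \<omega> > ennreal a then N \<omega> else 0) \<partial>M) \<le> ennreal (exp (l * (exp 2 - 1) - a))"
proof -
  have [measurable]: "N \<in> borel_measurable M" by fact
  define g where "g x = ennreal (exp (2 * enn2real x - a))" for x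
  have gm: "g \<in> borel_measurable borel" unfolding g_def by measurable
  have gn: "g (of_nat n) = ennreal (exp (2 * real n - a))" for n
    by (simp add: g_def ennreal_of_nat_eq_real_of_nat)
  have "(\<lambda>n. (l * exp 2) ^ n / fact n) sums exp (l * exp 2)" using exp_converges[of "l * exp 2"] by (simp add: field_simps)
  hence "(\<lambda>n. exp (- l - a) * ((l * exp 2) ^ n / fact n)) sums (exp (- l - a) * exp (l * exp 2))" by (rule sums_mult)
  moreover have "exp (- l - a) * ((l * exp 2) ^ n / fact n) = exp (2 * real n - a) * (l ^ n / fact n * exp (- l))" for n
    by (simp add: power_mult_distrib exp_diff exp_minus exp_of_nat_mult[symmetric] field_simps)
  moreover have "exp (- l - a) * exp (l * exp 2) = exp (l * (exp 2 - 1) - a)"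
    by (simp add: exp_add[symmetric] algebra_simps)
  ultimately have s: "(\<lambda>n. exp (2 * real n - a) * (l ^ n / fact n * exp (- l))) sums exp (l * (exp 2 - 1) - a)" by simp
  have "(\<integral>\<^sup>+\<omega>. (if N \<omega> > ennreal a then N \<omega> else 0) \<partial>M) \<le> (\<integral>\<^sup>+\<omega>. g (N \<omega>) \<partial>M)"
  proof (rule nn_integral_mono_AE)
    show "AE \<omega> in M. (if N \<omega> > ennreal a then N \<omega> else 0) \<le> g (N \<omega>)"
      using AE_poisson_finite[OF N l pmf]
    proof eventually_elim
      case (elim \<omega>)
      then obtain n :: nat where n: "N \<omega> = of_nat n" by blast
      show ?case
      proof (cases "N \<omega> > ennreal a")
        case True
        hence "real n > a" using n a by (simp add: ennreal_of_nat_eq_real_of_nat ennreal_less_iff)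
        hence "real n \<le> exp (2 * real n - a)"
          using exp_ge_add_one_self[of "2 * real n - a"] by linarith
        hence "(of_nat n :: ennreal) \<le> g (of_nat n)"
          unfolding gn by (simp add: ennreal_of_nat_eq_real_of_nat ennreal_leI)
        thus ?thesis using True n by simp
      qed simp
    qed
  qed
  also have "\<dots> = ennreal (exp (l * (exp 2 - 1) - a))"
    by (rule nn_integral_poisson[OF N l pmf gn _ gm s]) simp
  finally show ?thesis .
qed

section \<open>Thinning of the points\<close>

definition layer :: "real \<Rightarrow> nat \<Rightarrow> real set" where
  "layer K j = (if j = 0 then {K<..} else {K / 2 ^ j<..K / 2 ^ (j - 1)})"

text \<open>By \<open>poisson_excess\<close> the event that a Poisson variable with mean \<open>l\<close> is above
  \<open>l * (exp 2 - 1) + j + 2\<close> contributes at most \<open>exp (- (j + 2))\<close> to its mean, and these bounds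
  have a small sum. On the other hand the
  limits grow slowly enough for \<open>summable_layer_limit\<close>. The limit 0 in layer 0 makes all points above
  \<open>K\<close> heavy.\<close>

definition layer_limit :: "real measure \<Rightarrow> real \<Rightarrow> nat \<Rightarrow> real" where
  "layer_limit \<nu> K j = (if j = 0 then 0 else levy_mass \<nu> (layer K j) * (exp 2 - 1) + real j + 2)"

definition heavy_points :: "real measure \<Rightarrow> real \<Rightarrow> (nat \<Rightarrow> real) \<Rightarrow> nat set" where
  "heavy_points \<nu> K d = {k. 1 \<le> k \<and>
     (\<exists>j. d k \<in> layer K j \<and> weight_count d (layer K j) > ennreal (layer_limit \<nu> K j))}"

lemma layer_borel [measurable]: "layer K j \<in> sets borel"
  by (simp add: layer_def)

lemma layer_pos: "K > 0 \<Longrightarrow> layer K j \<subseteq> {K / 2 ^ j..}" "K > 0 \<Longrightarrow> K / 2 ^ j > 0"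
  by (auto simp: layer_def)

lemma layer_limit_nonneg: "layer_limit \<nu> K j \<ge> 0"
  by (simp add: layer_limit_def levy_mass_def)

lemma layer_upper: "x \<in> layer K j \<Longrightarrow> j \<noteq> 0 \<Longrightarrow> x \<le> K / 2 ^ (j - 1)"
  by (auto simp: layer_def)

lemma layer_disjoint:
  assumes K: "K > 0" and x: "x \<in> layer K i" "x \<in> layer K j"
  shows "i = j"
proof -
  have False if "i < j" "x \<in> layer K i" "x \<in> layer K j" for i j
  proof -
    have "K / 2 ^ (j - 1) \<le> K / 2 ^ i"
      using K that(1) by (intro divide_left_mono power_increasing) auto
    moreover have "x \<le> K / 2 ^ (j - 1)" using that by (auto simp: layer_def)
    moreover have "x > K / 2 ^ i" using that(2) K by (auto simp: layer_def split: if_splits)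
    ultimately show False by linarith
  qed
  thus ?thesis using x by (meson linorder_neqE_nat)
qed

lemma layer_cover:
  assumes K: "K > 0" and x: "x > 0"
  shows "\<exists>j. x \<in> layer K j"
proof -
  obtain n where "K / x < 2 ^ n" using real_arch_pow[of 2 "K / x"] by auto
  hence "K / 2 ^ n < x" using x by (simp add: field_simps)
  define j where "j = (LEAST n. K / 2 ^ n < x)"
  have j: "K / 2 ^ j < x" unfolding j_def by (rule LeastI) fact
  have "x \<le> K / 2 ^ (j - 1)" if "j \<noteq> 0"
    using not_less_Least[of "j - 1" "\<lambda>n. K / 2 ^ n < x"] that by (auto simp: j_def[symmetric])
  with j show ?thesis by (intro exI[of _ j]) (auto simp: layer_def)
qed

text \<open>The mass of a layer times the square of its lower end is at most the integral of \<open>x\<^sup>2\<close> over the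
  layer, so these products are summable by the integrability of \<open>min 1 (x\<^sup>2)\<close>; the linear part of
  the limits is dominated by the squares of the dyadic scales.\<close>

lemma summable_layer_limit:
  assumes \<nu>: "symmetric_levy_measure \<nu>" and K: "K > 0"
  shows "summable (\<lambda>j. layer_limit \<nu> K j * (K / 2 ^ (j - 1))\<^sup>2)"
proof -
  define B where "B j = {x. \<bar>x\<bar> \<in> layer K j}" for j
  define m where "m = max 1 (K\<^sup>2)"
  have B: "B j \<in> sets \<nu>" for j
    unfolding B_def using layer_pos[OF K, of j] by (intro levy_abs_set[OF \<nu>] layer_borel) force
  have mass: "emeasure \<nu> (B j) = ennreal (levy_mass \<nu> (layer K j))" for j
    unfolding B_def by (intro levy_mass_eq[OF \<nu> layer_borel layer_pos[OF K]])
  have pt: "(\<Sum>j. ennreal (if j = 0 then 0 else (K / 2 ^ j)\<^sup>2) * indicator (B j) x) \<le> ennreal m * ennreal (min 1 (x\<^sup>2))" for x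
  proof (cases "\<exists>j. x \<in> B j \<and> j \<noteq> 0")
    case True
    then obtain j where j: "x \<in> B j" "j \<noteq> 0" by blast
    have "(\<Sum>j. ennreal (if j = 0 then 0 else (K / 2 ^ j)\<^sup>2) * indicator (B j) x)
        = (\<Sum>j\<in>{j}. ennreal (if j = 0 then 0 else (K / 2 ^ j)\<^sup>2) * indicator (B j) x)"
      using j layer_disjoint[OF K] by (intro suminf_finite) (auto simp: B_def indicator_def)
    also have "\<dots> = ennreal ((K / 2 ^ j)\<^sup>2)" using j by simp
    also have "\<dots> \<le> ennreal (m * min 1 (x\<^sup>2))"
    proof (rule ennreal_leI)
      have "K / 2 ^ j \<le> \<bar>x\<bar>" using j layer_pos[OF K, of j] by (auto simp: B_def)
      hence 1: "(K / 2 ^ j)\<^sup>2 \<le> x\<^sup>2" using layer_pos(2)[OF K, of j] by (simp add: abs_le_square_iff[symmetric])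
      have "K / 2 ^ j \<le> K / 1" using K by (intro divide_left_mono) auto
      hence 2: "(K / 2 ^ j)\<^sup>2 \<le> K\<^sup>2" using layer_pos(2)[OF K, of j] by (intro power_mono) auto
      show "(K / 2 ^ j)\<^sup>2 \<le> m * min 1 (x\<^sup>2)"
      proof (cases "x\<^sup>2 \<le> 1")
        case True
        have "1 * x\<^sup>2 \<le> m * x\<^sup>2" by (intro mult_right_mono) (auto simp: m_def)
        thus ?thesis using 1 True by simp
      next
        case False
        thus ?thesis using 2 by (simp add: m_def)
      qed
    qed
    finally show ?thesis by (simp add: ennreal_mult m_def)
  next
    case False
    hence "(\<Sum>j. ennreal (if j = 0 then 0 else (K / 2 ^ j)\<^sup>2) * indicator (B j) x) = (\<Sum>j. 0)"
      by (intro arg_cong[where f = suminf]) (auto simp: indicator_def fun_eq_iff)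
    thus ?thesis by simp
  qed
  have "ennreal ((if j = 0 then 0 else (K / 2 ^ j)\<^sup>2) * levy_mass \<nu> (layer K j))
      = (\<integral>\<^sup>+x. ennreal (if j = 0 then 0 else (K / 2 ^ j)\<^sup>2) * indicator (B j) x \<partial>\<nu>)" for j
    by (subst nn_integral_cmult_indicator[OF B]) (simp only: mass, rule ennreal_mult', simp)
  hence "(\<Sum>j. ennreal ((if j = 0 then 0 else (K / 2 ^ j)\<^sup>2) * levy_mass \<nu> (layer K j)))
      = (\<Sum>j. \<integral>\<^sup>+x. ennreal (if j = 0 then 0 else (K / 2 ^ j)\<^sup>2) * indicator (B j) x \<partial>\<nu>)"
    by presburger
  also have "\<dots> = (\<integral>\<^sup>+x. (\<Sum>j. ennreal (if j = 0 then 0 else (K / 2 ^ j)\<^sup>2) * indicator (B j) x) \<partial>\<nu>)"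
    by (intro nn_integral_suminf[symmetric] borel_measurable_times_ennreal borel_measurable_const borel_measurable_indicator B)
  also have "\<dots> \<le> (\<integral>\<^sup>+x. ennreal m * ennreal (min 1 (x\<^sup>2)) \<partial>\<nu>)"
    by (intro nn_integral_mono pt)
  also have "\<dots> = ennreal m * (\<integral>\<^sup>+x. ennreal (min 1 (x\<^sup>2)) \<partial>\<nu>)"
    by (rule nn_integral_cmult) (intro levy_measurable[OF \<nu>]; measurable)
  also have "\<dots> < \<infinity>" using levy_integral[OF \<nu>] by (simp add: ennreal_mult_less_top)
  finally have "(\<Sum>j. ennreal ((if j = 0 then 0 else (K / 2 ^ j)\<^sup>2) * levy_mass \<nu> (layer K j))) \<noteq> \<top>" by simp
  hence s1: "summable (\<lambda>j. (if j = 0 then 0 else (K / 2 ^ j)\<^sup>2) * levy_mass \<nu> (layer K j))"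
    by (intro summable_suminf_not_top) (auto simp: levy_mass_def)
  have s2: "summable (\<lambda>j. (real j + 2) * (K / 2 ^ j)\<^sup>2)"
  proof (rule summable_comparison_test')
    show "summable (\<lambda>j. 2 * K\<^sup>2 * (1 / 2) ^ j)" by (intro summable_mult summable_geometric) simp
    fix j :: nat
    have "Suc j + 1 \<le> 2 ^ Suc j" by (induction j) auto
    hence "real (Suc j + 1) \<le> real (2 ^ Suc j)" by (rule of_nat_mono)
    hence "real j + 2 \<le> 2 * 2 ^ j" by simp
    hence "(real j + 2) * (K / 2 ^ j)\<^sup>2 \<le> (2 * 2 ^ j) * (K / 2 ^ j)\<^sup>2" by (intro mult_right_mono) auto
    also have "\<dots> = 2 * K\<^sup>2 * (1 / 2) ^ j" by (simp add: power2_eq_square power_divide)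
    finally show "norm ((real j + 2) * (K / 2 ^ j)\<^sup>2) \<le> 2 * K\<^sup>2 * (1 / 2) ^ j" by simp
  qed
  have bound: "norm (layer_limit \<nu> K j * (K / 2 ^ (j - 1))\<^sup>2) \<le>
    4 * ((exp 2 - 1) * ((if j = 0 then 0 else (K / 2 ^ j)\<^sup>2) * levy_mass \<nu> (layer K j)) + (real j + 2) * (K / 2 ^ j)\<^sup>2)" for j
  proof (cases j)
    case 0
    thus ?thesis by (simp add: layer_limit_def)
  next
    case (Suc i)
    have q: "K / 2 ^ i = 2 * (K / 2 ^ Suc i)" by simp
    have "layer_limit \<nu> K j * (K / 2 ^ (j - 1))\<^sup>2 =
      4 * ((exp 2 - 1) * ((K / 2 ^ j)\<^sup>2 * levy_mass \<nu> (layer K j)) + (real j + 2) * (K / 2 ^ j)\<^sup>2)"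
      using Suc unfolding layer_limit_def diff_Suc_1 Suc q power_mult_distrib by (simp only: if_False nat.distinct) (simp add: algebra_simps)
    moreover have "layer_limit \<nu> K j * (K / 2 ^ (j - 1))\<^sup>2 \<ge> 0" by (simp add: layer_limit_nonneg)
    ultimately show ?thesis using Suc by simp
  qed
  show ?thesis
    by (rule summable_comparison_test'[OF _ bound]) (intro summable_mult summable_add s1 s2)
qed

text \<open>A layer with a light point holds at most as many points as its limit, each at most the upper end of
  the layer. The summand for \<open>j = 0\<close>, where the exponent \<open>j - 1\<close> is truncated, vanishes because the
  limit is 0.\<close>

lemma light_points_bound:
  assumes \<nu>: "symmetric_levy_measure \<nu>" and K: "K > 0"
    and d: "\<And>k. d k \<ge> 0" and F: "finite F" "F \<inter> heavy_points \<nu> K d = {}" "0 \<notin> F"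
  shows "(\<Sum>k\<in>F. (d k)\<^sup>2) \<le> (\<Sum>j. layer_limit \<nu> K j * (K / 2 ^ (j - 1))\<^sup>2)"
proof -
  define G where "G = {k\<in>F. d k > 0}"
  have G: "finite G" "G \<subseteq> F" using F by (auto simp: G_def)
  have "\<exists>j. d k \<in> layer K j" if "k \<in> G" for k
    using that by (intro layer_cover[OF K]) (auto simp: G_def)
  then obtain j where j: "\<And>k. k \<in> G \<Longrightarrow> d k \<in> layer K (j k)" by metis
  define X where "X i = {k\<in>G. j k = i}" for i
  have light: "weight_count d (layer K (j k)) \<le> ennreal (layer_limit \<nu> K (j k))" if "k \<in> G" for k
  proof -
    have "k \<notin> heavy_points \<nu> K d" "1 \<le> k" using that F G by (auto simp: Suc_le_eq intro: gr0I)
    thus ?thesis using j[OF that] by (auto simp: heavy_points_def not_less)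
  qed
  have card: "real (card (X i)) \<le> layer_limit \<nu> K i" if "i \<in> j ` G" for i
  proof -
    have "ennreal (real (card (X i))) = emeasure (count_space UNIV) (X i)"
      using G by (subst emeasure_count_space) (auto simp: X_def ennreal_of_nat_eq_real_of_nat)
    also have "\<dots> \<le> weight_count d (layer K i)"
      unfolding weight_count_def using j F G by (intro emeasure_mono) (auto simp: X_def Suc_le_eq intro: gr0I)
    also have "\<dots> \<le> ennreal (layer_limit \<nu> K i)" using light that by auto
    finally show ?thesis using layer_limit_nonneg by (simp add: ennreal_le_iff)
  qed
  have pos: "i \<noteq> 0" if i: "i \<in> j ` G" for i
  proof
    assume "i = 0"
    obtain k where "k \<in> G" "i = j k" using i by blast
    hence "k \<in> X i" by (simp add: X_def)
    hence "card (X i) \<ge> 1" using G by (auto simp: X_def Suc_le_eq card_gt_0_iff)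
    moreover have "real (card (X i)) \<le> 0" using card[OF i] \<open>i = 0\<close> by (simp add: layer_limit_def)
    ultimately show False by simp
  qed
  have "(\<Sum>k\<in>F. (d k)\<^sup>2) = (\<Sum>k\<in>G. (d k)\<^sup>2)"
    using F d by (intro sum.mono_neutral_right) (auto simp: G_def not_less intro: antisym)
  also have "\<dots> = (\<Sum>i\<in>j ` G. \<Sum>k\<in>X i. (d k)\<^sup>2)"
    unfolding X_def using G by (intro sum.image_gen) auto
  also have "\<dots> \<le> (\<Sum>i\<in>j ` G. \<Sum>k\<in>X i. (K / 2 ^ (i - 1))\<^sup>2)"
  proof (intro sum_mono power_mono)
    fix i k assume i: "i \<in> j ` G" and k: "k \<in> X i"
    thus "d k \<le> K / 2 ^ (i - 1)" using j[of k] pos[OF i] by (intro layer_upper) (auto simp: X_def)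
  qed (rule d)
  also have "\<dots> \<le> (\<Sum>i\<in>j ` G. layer_limit \<nu> K i * (K / 2 ^ (i - 1))\<^sup>2)"
    using card by (auto intro!: sum_mono mult_right_mono)
  also have "\<dots> \<le> (\<Sum>j. layer_limit \<nu> K j * (K / 2 ^ (j - 1))\<^sup>2)"
    using G layer_limit_nonneg by (intro sum_le_suminf summable_layer_limit[OF \<nu> K]) auto
  finally show ?thesis .
qed

lemma thinning_scale_exists:
  assumes \<nu>: "symmetric_levy_measure \<nu>"
  shows "\<exists>K>0. levy_mass \<nu> {K<..} \<le> 1 / 4"
proof -
  define A where "A n = {x. \<bar>x\<bar> \<in> {real (Suc n)<..}}" for n
  have A: "A n \<in> sets \<nu>" for n unfolding A_def by (rule levy_abs_set[OF \<nu>]) auto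
  have mass: "emeasure \<nu> (A n) = ennreal (levy_mass \<nu> {real (Suc n)<..})" for n
    unfolding A_def by (rule levy_mass_eq[OF \<nu>, of _ "real (Suc n)"]) auto
  have "(\<lambda>n. emeasure \<nu> (A n)) \<longlonglongrightarrow> emeasure \<nu> (\<Inter>n. A n)"
    using A mass by (intro Lim_emeasure_decseq) (auto simp: A_def decseq_def)
  moreover have "(\<Inter>n. A n) = {}"
  proof (intro equals0I)
    fix x assume x: "x \<in> (\<Inter>n. A n)"
    obtain n where "\<bar>x\<bar> < real n" using reals_Archimedean2 by blast
    moreover have "x \<in> A n" using x by blast
    ultimately show False by (simp add: A_def)
  qed
  ultimately have "(\<lambda>n. emeasure \<nu> (A n)) \<longlonglongrightarrow> 0" by simp
  hence "\<forall>\<^sub>F n in sequentially. emeasure \<nu> (A n) < ennreal (1 / 4)"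
    by (rule order_tendstoD) simp
  then obtain n where "emeasure \<nu> (A n) < ennreal (1 / 4)" by (auto simp: eventually_sequentially)
  hence "levy_mass \<nu> {real (Suc n)<..} \<le> 1 / 4"
    unfolding mass by (subst (asm) ennreal_less_iff) (auto simp: levy_mass_def)
  thus ?thesis by (intro exI[of _ "real (Suc n)"]) auto
qed


lemma poisson_weight_count:
  assumes \<nu>: "symmetric_levy_measure \<nu>"
    and C: "poisson_points M \<nu> (\<lambda>\<omega> k. ereal (C \<omega> k))"
    and I: "I \<in> sets borel" "I \<subseteq> {t..}" "t > 0"
  shows "measure M {\<omega>\<in>space M. weight_count (\<lambda>k. \<bar>C \<omega> k\<bar>) I = of_nat n}
    = levy_mass \<nu> I ^ n / fact n * exp (- levy_mass \<nu> I)"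
proof -
  have "{x. \<bar>x\<bar> \<in> I} \<in> sets \<nu>" using I by (intro levy_abs_set[OF \<nu>]) auto
  thus ?thesis
    using C levy_emeasure_finite[OF \<nu> I] unfolding poisson_points_def weight_count_eq_point_count levy_mass_def by blast
qed

lemma poisson_points_real_measurable:
  assumes "poisson_points M \<mu> (\<lambda>\<omega> k. ereal (C \<omega> k))" "1 \<le> k"
  shows "(\<lambda>\<omega>. C \<omega> k) \<in> borel_measurable M"
proof -
  have "(\<lambda>\<omega>. real_of_ereal (ereal (C \<omega> k))) \<in> borel_measurable M"
    using assms by (intro borel_measurable_real_of_ereal) (auto simp: poisson_points_def)
  thus ?thesis by simp
qed

lemma poisson_weight_count_measurable:
  assumes C: "poisson_points M \<mu> (\<lambda>\<omega> k. ereal (C \<omega> k))" and I: "I \<in> sets borel"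
  shows "(\<lambda>\<omega>. weight_count (\<lambda>k. \<bar>C \<omega> k\<bar>) I) \<in> borel_measurable M"
proof -
  have "(\<lambda>\<omega>. weight_count (\<lambda>k. if 1 \<le> k then \<bar>C \<omega> k\<bar> else 0) I) \<in> borel_measurable M"
  proof (rule measurable_weight_count[OF I])
    fix k
    show "(\<lambda>\<omega>. if 1 \<le> k then \<bar>C \<omega> k\<bar> else 0) \<in> borel_measurable M"
      using poisson_points_real_measurable[OF C, of k] by (cases "1 \<le> k") auto
  qed
  moreover have "weight_count (\<lambda>k. if 1 \<le> k then \<bar>C \<omega> k\<bar> else 0) I = weight_count (\<lambda>k. \<bar>C \<omega> k\<bar>) I" for \<omega>
    unfolding weight_count_def by (rule arg_cong[where f = "emeasure _"]) auto
  ultimately show ?thesis by simp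
qed

text \<open>Layer 0 contributes its mean mass, at most 1/4 by the choice of \<open>K\<close>, and layer \<open>j\<close> at most
  \<open>(1/2) ^ (j + 2)\<close>.\<close>

lemma heavy_points_mean:
  assumes \<nu>: "symmetric_levy_measure \<nu>" and M: "prob_space M"
    and C: "poisson_points M \<nu> (\<lambda>\<omega> k. ereal (C \<omega> k))"
    and K: "K > 0" "levy_mass \<nu> {K<..} \<le> 1 / 4"
  shows "(\<integral>\<^sup>+\<omega>. emeasure (count_space UNIV) (heavy_points \<nu> K (\<lambda>k. \<bar>C \<omega> k\<bar>)) \<partial>M) \<le> ennreal (1 / 2)"
proof -
  interpret prob_space M by (rule M)
  define N where "N j \<omega> = weight_count (\<lambda>k. \<bar>C \<omega> k\<bar>) (layer K j)" for j \<omega>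
  define l where "l j = levy_mass \<nu> (layer K j)" for j
  have N [measurable]: "N j \<in> borel_measurable M" for j
    unfolding N_def by (rule poisson_weight_count_measurable[OF C layer_borel])
  have l: "l j \<ge> 0" for j by (simp add: l_def levy_mass_def)
  have pmf: "prob {\<omega>\<in>space M. N j \<omega> = of_nat n} = l j ^ n / fact n * exp (- l j)" for j n
    unfolding N_def l_def by (rule poisson_weight_count[OF \<nu> C layer_borel layer_pos[OF K(1)]])
  have split: "emeasure (count_space UNIV) (heavy_points \<nu> K (\<lambda>k. \<bar>C \<omega> k\<bar>))
      = (\<Sum>j. if N j \<omega> > ennreal (layer_limit \<nu> K j) then N j \<omega> else 0)" for \<omega>
  proof -
    define H where "H j = (if N j \<omega> > ennreal (layer_limit \<nu> K j) then {k. 1 \<le> k \<and> \<bar>C \<omega> k\<bar> \<in> layer K j} else {})" for j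
    have "disjoint_family H"
      using layer_disjoint[OF K(1)] by (auto simp: disjoint_family_on_def H_def)
    hence "(\<Sum>j. emeasure (count_space UNIV) (H j)) = emeasure (count_space UNIV) (\<Union>j. H j)"
      by (intro suminf_emeasure) auto
    moreover have "(\<Union>j. H j) = heavy_points \<nu> K (\<lambda>k. \<bar>C \<omega> k\<bar>)"
      by (auto simp: H_def heavy_points_def N_def split: if_splits)
    moreover have "emeasure (count_space UNIV) (H j) = (if N j \<omega> > ennreal (layer_limit \<nu> K j) then N j \<omega> else 0)" for j
      by (simp add: H_def N_def weight_count_def)
    ultimately show ?thesis by simp
  qed
  have excess: "(\<integral>\<^sup>+\<omega>. (if N j \<omega> > ennreal (layer_limit \<nu> K j) then N j \<omega> else 0) \<partial>M) \<le> ennreal ((1 / 2) ^ (j + 2))" for j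
  proof (cases "j = 0")
    case True
    have "(\<integral>\<^sup>+\<omega>. (if N j \<omega> > ennreal (layer_limit \<nu> K j) then N j \<omega> else 0) \<partial>M) \<le> (\<integral>\<^sup>+\<omega>. N j \<omega> \<partial>M)"
      by (rule nn_integral_mono) simp
    also have "\<dots> = ennreal (l j)" by (rule poisson_mean[OF N l pmf])
    also have "\<dots> \<le> ennreal (1 / 4)" using K(2) True by (intro ennreal_leI) (simp add: l_def layer_def)
    finally show ?thesis using True by (simp add: power2_eq_square)
  next
    case False
    have "(\<integral>\<^sup>+\<omega>. (if N j \<omega> > ennreal (layer_limit \<nu> K j) then N j \<omega> else 0) \<partial>M)
        \<le> ennreal (exp (l j * (exp 2 - 1) - layer_limit \<nu> K j))"
      by (rule poisson_excess[OF N l pmf layer_limit_nonneg])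
    also have "l j * (exp 2 - 1) - layer_limit \<nu> K j = real (j + 2) * (-1)"
      using False by (simp add: layer_limit_def l_def)
    also have "exp (real (j + 2) * (-1)) = exp (-1) ^ (j + 2)" by (rule exp_of_nat_mult)
    also have "ennreal \<dots> \<le> ennreal ((1 / 2) ^ (j + 2))"
    proof (intro ennreal_leI power_mono)
      have "2 \<le> exp (1::real)" using exp_ge_add_one_self[of 1] by simp
      thus "exp (-1) \<le> (1 / 2 :: real)" by (simp add: exp_minus field_simps)
    qed simp
    finally show ?thesis .
  qed
  have "(\<integral>\<^sup>+\<omega>. emeasure (count_space UNIV) (heavy_points \<nu> K (\<lambda>k. \<bar>C \<omega> k\<bar>)) \<partial>M)
      = (\<Sum>j. \<integral>\<^sup>+\<omega>. (if N j \<omega> > ennreal (layer_limit \<nu> K j) then N j \<omega> else 0) \<partial>M)"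
    unfolding split by (rule nn_integral_suminf) measurable
  also have "\<dots> \<le> (\<Sum>j. ennreal ((1 / 2) ^ (j + 2)))" by (intro suminf_le excess) auto
  also have "\<dots> = ennreal (1 / 2)"
  proof (rule suminf_ennreal_eq)
    have "(\<lambda>j. (1 / 2) ^ j * (1 / 4 :: real)) sums (1 / (1 - 1 / 2) * (1 / 4))"
      by (intro sums_mult2 geometric_sums) simp
    thus "(\<lambda>j. (1 / 2 :: real) ^ (j + 2)) sums (1 / 2)" by (simp add: power_add power2_eq_square)
  qed simp
  finally show ?thesis .
qed

section \<open>Subcritical branching\<close>

lemma kept_path_iff_nth:
  "kept_path K v w \<longleftrightarrow> (\<forall>i<length w. w ! i \<in> K (v @ take i w))"
proof (induction w arbitrary: v)
  case (Cons k w)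
  have "(\<forall>i<length (k # w). (k # w) ! i \<in> K (v @ take i (k # w))) \<longleftrightarrow>
    k \<in> K v \<and> (\<forall>i<length w. w ! i \<in> K ((v @ [k]) @ take i w))"
    by (simp add: All_less_Suc2)
  thus ?case using Cons by simp
qed simp

context prob_space
begin

context
  fixes X :: "nat list \<Rightarrow> 'a \<Rightarrow> 's" and S :: "'s measure" and H :: "nat \<Rightarrow> 's set"
  assumes indep: "indep_vars (\<lambda>_. S) X UNIV" and H: "\<And>k. H k \<in> sets S"
    and mean: "\<And>v. (\<integral>\<^sup>+\<omega>. emeasure (count_space UNIV) {k. X v \<omega> \<in> H k} \<partial>M) \<le> ennreal (1 / 2)"
begin

lemma vertex_variable_measurable: "X v \<in> measurable M S"
  using indep by (auto simp: indep_vars_def)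

lemma child_event_measurable: "{\<omega>\<in>space M. X v \<omega> \<in> H k} \<in> events"
proof -
  note [measurable] = vertex_variable_measurable H
  show ?thesis by measurable
qed

lemma kept_path_event: "{\<omega>\<in>space M. kept_path (\<lambda>u. {k. X u \<omega> \<in> H k}) v w} \<in> events"
  unfolding kept_path_iff_nth mem_Collect_eq using child_event_measurable by measurable

text \<open>A path visits distinct vertices, so the events along it are independent.\<close>

lemma prob_kept_path:
  "prob {\<omega>\<in>space M. kept_path (\<lambda>u. {k. X u \<omega> \<in> H k}) v w}
    = (\<Prod>i<length w. prob {\<omega>\<in>space M. X (v @ take i w) \<omega> \<in> H (w ! i)})"
proof (cases "w = []")
  case True
  thus ?thesis by (simp add: prob_space)
next
  case False
  let ?u = "\<lambda>i. v @ take i w"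
  let ?J = "?u ` {..<length w}"
  let ?A = "\<lambda>u. H (w ! (length u - length v))"
  have inj: "inj_on ?u {..<length w}"
    by (rule inj_onI) (auto dest: arg_cong[where f = length])
  have "{\<omega>\<in>space M. kept_path (\<lambda>u. {k. X u \<omega> \<in> H k}) v w} = (\<Inter>u\<in>?J. X u -` ?A u \<inter> space M)"
    using False by (auto simp: kept_path_iff_nth)
  also have "prob \<dots> = (\<Prod>u\<in>?J. prob (X u -` ?A u \<inter> space M))"
    using False H by (intro indep_varsD[OF indep]) auto
  also have "\<dots> = (\<Prod>i<length w. prob (X (?u i) -` ?A (?u i) \<inter> space M))"
    by (subst prod.reindex[OF inj]) simp
  also have "\<dots> = (\<Prod>i<length w. prob {\<omega>\<in>space M. X (?u i) \<omega> \<in> H (w ! i)})"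
    by (intro prod.cong refl arg_cong[where f = prob]) auto
  finally show ?thesis .
qed

lemma sum_prob_child_le:
  assumes "finite T"
  shows "(\<Sum>k\<in>T. prob {\<omega>\<in>space M. X v \<omega> \<in> H k}) \<le> 1 / 2"
proof -
  have "ennreal (\<Sum>k\<in>T. prob {\<omega>\<in>space M. X v \<omega> \<in> H k}) = (\<Sum>k\<in>T. emeasure M {\<omega>\<in>space M. X v \<omega> \<in> H k})"
    by (simp add: emeasure_eq_measure sum_ennreal)
  also have "\<dots> = (\<Sum>k\<in>T. \<integral>\<^sup>+\<omega>. indicator {\<omega>\<in>space M. X v \<omega> \<in> H k} \<omega> \<partial>M)"
    using child_event_measurable by simp
  also have "\<dots> = (\<integral>\<^sup>+\<omega>. (\<Sum>k\<in>T. indicator {\<omega>\<in>space M. X v \<omega> \<in> H k} \<omega>) \<partial>M)"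
    using child_event_measurable by (intro nn_integral_sum[symmetric]) auto
  also have "\<dots> \<le> (\<integral>\<^sup>+\<omega>. emeasure (count_space UNIV) {k. X v \<omega> \<in> H k} \<partial>M)"
  proof (rule nn_integral_mono)
    fix \<omega> assume "\<omega> \<in> space M"
    hence "(\<Sum>k\<in>T. indicator {\<omega>\<in>space M. X v \<omega> \<in> H k} \<omega>) = (of_nat (card {k\<in>T. X v \<omega> \<in> H k}) :: ennreal)"
      using assms by (simp add: indicator_def sum.If_cases Int_def)
    also have "\<dots> = emeasure (count_space UNIV) {k\<in>T. X v \<omega> \<in> H k}"
      using assms by (subst emeasure_count_space) auto
    also have "\<dots> \<le> emeasure (count_space UNIV) {k. X v \<omega> \<in> H k}" by (intro emeasure_mono) auto
    finally show "(\<Sum>k\<in>T. indicator {\<omega>\<in>space M. X v \<omega> \<in> H k} \<omega>) \<le> emeasure (count_space UNIV) {k. X v \<omega> \<in> H k}" .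
  qed
  also have "\<dots> \<le> ennreal (1 / 2)" by (rule mean)
  finally show ?thesis by (subst (asm) ennreal_le_iff) auto
qed

text \<open>With mean offspring at most 1/2 the total progeny has mean at most \<open>1 + 1/2 + 1/4 + \<dots> = 2\<close>. The
  bound is proved for finite sets of words by splitting off the first letter.\<close>

lemma sum_prob_kept_path_le:
  assumes "finite F"
  shows "(\<Sum>w\<in>F. prob {\<omega>\<in>space M. kept_path (\<lambda>u. {k. X u \<omega> \<in> H k}) v w}) \<le> 2"
proof -
  define p where "p v w = prob {\<omega>\<in>space M. kept_path (\<lambda>u. {k. X u \<omega> \<in> H k}) v w}" for v w
  define q where "q v k = prob {\<omega>\<in>space M. X v \<omega> \<in> H k}" for v k
  have p_Nil: "p v [] = 1" for v by (simp add: p_def prob_space)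
  have p_Cons: "p v (k # w) = q v k * p (v @ [k]) w" for v k w
    unfolding p_def q_def prob_kept_path list.size add_0_right add_Suc_right prod.lessThan_Suc_shift
    by simp
  have "(\<Sum>w\<in>F. p v w) \<le> 2" if "finite F" "\<And>w. w \<in> F \<Longrightarrow> length w \<le> n" for n F v
    using that
  proof (induction n arbitrary: F v)
    case 0
    hence "F \<subseteq> {[]}" by auto
    hence "(\<Sum>w\<in>F. p v w) \<le> (\<Sum>w\<in>{[]}. p v w)" by (intro sum_mono2) (auto simp: p_def)
    thus ?case by (simp add: p_Nil)
  next
    case (Suc n)
    define T where "T = hd ` (F - {[]})"
    define G where "G k = {w. k # w \<in> F}" for k
    have fin: "finite T" "finite (G k)" for k
    proof -
      show "finite T" using Suc.prems by (simp add: T_def)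
      show "finite (G k)" unfolding G_def using finite_vimageI[OF Suc.prems(1), of "Cons k"]
        by (simp add: vimage_def)
    qed
    have "F \<subseteq> insert [] (\<Union>k\<in>T. Cons k ` G k)"
    proof
      fix w assume "w \<in> F"
      show "w \<in> insert [] (\<Union>k\<in>T. Cons k ` G k)"
      proof (cases w)
        case (Cons k w')
        hence "k \<in> T" using \<open>w \<in> F\<close> by (force simp: T_def)
        thus ?thesis using Cons \<open>w \<in> F\<close> by (auto simp: G_def)
      qed simp
    qed
    hence "(\<Sum>w\<in>F. p v w) \<le> (\<Sum>w\<in>insert [] (\<Union>k\<in>T. Cons k ` G k). p v w)"
      using fin by (intro sum_mono2) (auto simp: p_def)
    also have "\<dots> = 1 + (\<Sum>w\<in>(\<Union>k\<in>T. Cons k ` G k). p v w)"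
      using fin by (subst sum.insert) (auto simp: p_Nil)
    also have "(\<Sum>w\<in>(\<Union>k\<in>T. Cons k ` G k). p v w) = (\<Sum>k\<in>T. \<Sum>w\<in>Cons k ` G k. p v w)"
      using fin by (intro sum.UNION_disjoint) auto
    also have "\<dots> = (\<Sum>k\<in>T. q v k * (\<Sum>w\<in>G k. p (v @ [k]) w))"
      by (intro sum.cong refl) (simp add: sum.reindex p_Cons sum_distrib_left)
    also have "\<dots> \<le> (\<Sum>k\<in>T. q v k * 2)"
    proof (intro sum_mono mult_left_mono)
      fix k
      show "(\<Sum>w\<in>G k. p (v @ [k]) w) \<le> 2"
        using Suc.prems(2) by (intro Suc.IH fin) (fastforce simp: G_def)
    qed (simp add: q_def)
    also have "\<dots> \<le> 1" using sum_prob_child_le[OF fin(1), of v] by (simp add: q_def sum_distrib_right[symmetric])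
    finally show ?case by simp
  qed
  from this[of F "Max (length ` F)" v] show ?thesis using assms by (simp add: p_def)
qed

text \<open>The expected number of kept words is at most 2 by monotone convergence along finite sets that
  exhaust all words, and an infinite number would have infinite expectation.\<close>

lemma AE_finite_kept_paths:
  "AE \<omega> in M. \<forall>v. finite {w. kept_path (\<lambda>u. {k. X u \<omega> \<in> H k}) v w}"
proof (rule AE_all_countable[THEN iffD2], rule allI)
  fix v
  let ?E = "\<lambda>w. {\<omega>\<in>space M. kept_path (\<lambda>u. {k. X u \<omega> \<in> H k}) v w}"
  define F :: "nat \<Rightarrow> nat list set" where "F n = from_nat ` {..n}" for n
  have F: "finite (F n)" for n by (simp add: F_def)
  define g :: "nat \<Rightarrow> 'a \<Rightarrow> ennreal" where "g n \<omega> = (\<Sum>w\<in>F n. indicator (?E w) \<omega>)" for n \<omega>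
  have g [measurable]: "g n \<in> borel_measurable M" for n
    unfolding g_def using kept_path_event by measurable
  have int: "(\<integral>\<^sup>+\<omega>. g n \<omega> \<partial>M) \<le> 2" for n
  proof -
    have "(\<integral>\<^sup>+\<omega>. g n \<omega> \<partial>M) = (\<Sum>w\<in>F n. emeasure M (?E w))"
      unfolding g_def using kept_path_event by (subst nn_integral_sum) auto
    also have "\<dots> = ennreal (\<Sum>w\<in>F n. prob (?E w))" by (simp add: emeasure_eq_measure sum_ennreal)
    also have "\<dots> \<le> ennreal 2" by (intro ennreal_leI sum_prob_kept_path_le F)
    finally show ?thesis by simp
  qed
  have "incseq g"
    unfolding g_def by (intro incseq_SucI le_funI sum_mono2) (auto simp: F_def)
  hence "(\<integral>\<^sup>+\<omega>. (SUP n. g n \<omega>) \<partial>M) = (SUP n. \<integral>\<^sup>+\<omega>. g n \<omega> \<partial>M)"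
    by (intro nn_integral_monotone_convergence_SUP g)
  also have "\<dots> \<le> 2" by (intro SUP_least int)
  also have "\<dots> < \<infinity>" by simp
  finally have "(\<integral>\<^sup>+\<omega>. (SUP n. g n \<omega>) \<partial>M) \<noteq> \<infinity>" by simp
  hence "AE \<omega> in M. (SUP n. g n \<omega>) \<noteq> \<infinity>" by (intro nn_integral_PInf_AE) auto
  thus "AE \<omega> in M. finite {w. kept_path (\<lambda>u. {k. X u \<omega> \<in> H k}) v w}"
    using AE_space
  proof eventually_elim
    case (elim \<omega>)
    let ?W = "{w. kept_path (\<lambda>u. {k. X u \<omega> \<in> H k}) v w}"
    show ?case
    proof (rule ccontr)
      assume inf: "infinite ?W"
      have large: "of_nat m \<le> (SUP n. g n \<omega>)" for m
      proof -
        obtain B where B: "B \<subseteq> ?W" "finite B" "card B = m" using infinite_arbitrarily_large[OF inf] by blast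
        define n where "n = Max (insert 0 (to_nat ` B))"
        have "B \<subseteq> F n"
        proof
          fix w assume "w \<in> B"
          hence "to_nat w \<le> n" using B(2) by (auto simp: n_def intro!: Max_ge)
          thus "w \<in> F n" unfolding F_def by (intro image_eqI[of _ _ "to_nat w"]) auto
        qed
        have "of_nat m = (\<Sum>w\<in>B. indicator (?E w) \<omega> :: ennreal)"
          using B elim by (auto simp: indicator_def subset_iff)
        also have "\<dots> \<le> g n \<omega>" unfolding g_def using \<open>B \<subseteq> F n\<close> F by (intro sum_mono2) auto
        also have "\<dots> \<le> (SUP n. g n \<omega>)" by (rule SUP_upper) simp
        finally show ?thesis .
      qed
      have "(SUP n. g n \<omega>) < \<top>" using elim(1) unfolding infinity_ennreal_def top.not_eq_extremum .
      then obtain m where "(SUP n. g n \<omega>) < of_nat m" using ennreal_Ex_less_of_nat by blast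
      thus False using large[of m] by simp
    qed
  qed
qed

end

end

section \<open>Decreasing rearrangement\<close>

text \<open>Countably many levels determine the counts, and they keep the supremum in \<open>rearrange\<close>
  measurable.\<close>

definition pos_rats :: "real set" where
  "pos_rats = {t \<in> \<rat>. t > 0}"

lemma countable_pos_rats: "countable pos_rats"
  unfolding pos_rats_def by (rule countable_subset[OF _ countable_rat]) auto

definition tail_counts :: "(nat \<Rightarrow> real) \<Rightarrow> real \<Rightarrow> ennreal" where
  "tail_counts d = (\<lambda>t\<in>pos_rats. weight_count d {t..})"

text \<open>The \<open>k\<close>-th largest value is the supremum of the levels above which there are at least \<open>k\<close> points,
  and 0 if there is no such level. Entry 0 carries the weight \<open>\<sigma>\<close> of the nonrandom edge.\<close>

definition rearrange :: "real \<Rightarrow> (real \<Rightarrow> ennreal) \<Rightarrow> nat \<Rightarrow> real" where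
  "rearrange \<sigma> n k = (if k = 0 then \<sigma>
     else real_of_ereal (SUP t\<in>pos_rats. if of_nat k \<le> n t then ereal t else 0))"

lemma rearrange_measurable:
  "rearrange \<sigma> \<in> measurable (PiM pos_rats (\<lambda>_. borel)) (PiM UNIV (\<lambda>_. borel))"
proof (rule measurable_PiM_single')
  fix k :: nat
  note [measurable] = measurable_component_singleton
  have sup: "(\<lambda>n. SUP t\<in>pos_rats. if of_nat k \<le> n t then ereal t else 0) \<in> borel_measurable (PiM pos_rats (\<lambda>_. borel :: ennreal measure))"
    by (rule borel_measurable_SUP[OF countable_pos_rats]) measurable
  show "(\<lambda>n. rearrange \<sigma> n k) \<in> borel_measurable (PiM pos_rats (\<lambda>_. borel))"
  proof (cases "k = 0")
    case True
    hence "rearrange \<sigma> n k = \<sigma>" for n by (simp add: rearrange_def)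
    thus ?thesis by simp
  next
    case False
    thus ?thesis using borel_measurable_real_of_ereal[OF sup] by (simp only: rearrange_def if_False)
  qed
qed auto

lemma pos_rats_dense: "a \<ge> 0 \<Longrightarrow> a < b \<Longrightarrow> \<exists>t\<in>pos_rats. a < t \<and> t < b"
  using Rats_dense_in_real[of a b] by (force simp: pos_rats_def)

lemma rearrange_eqI:
  assumes k: "k \<noteq> 0" and x: "x \<ge> 0"
    and iff: "\<And>t. t \<in> pos_rats \<Longrightarrow> of_nat k \<le> n t \<longleftrightarrow> t \<le> x"
  shows "rearrange \<sigma> n k = x"
proof -
  have "(SUP t\<in>pos_rats. if of_nat k \<le> n t then ereal t else 0) = ereal x"
  proof (rule antisym)
    show "(SUP t\<in>pos_rats. if of_nat k \<le> n t then ereal t else 0) \<le> ereal x"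
      using x by (intro SUP_least) (auto simp: iff)
    show "ereal x \<le> (SUP t\<in>pos_rats. if of_nat k \<le> n t then ereal t else 0)"
    proof (rule dense_le)
      fix y :: ereal assume "y < ereal x"
      obtain t where t: "t \<in> pos_rats" "y \<le> (if t \<le> x then ereal t else 0)"
      proof (cases "x = 0 \<or> y < 0")
        case True
        have "y \<le> 0" using True \<open>y < ereal x\<close> by (auto simp: zero_ereal_def intro: less_imp_le)
        obtain t where "t \<in> pos_rats" using pos_rats_dense[of 0 1] by auto
        moreover from this have "0 \<le> (if t \<le> x then ereal t else 0)" by (simp add: pos_rats_def)
        ultimately show thesis using \<open>y \<le> 0\<close> that[of t] order_trans by blast
      next
        case False
        then obtain r where r: "y = ereal r" "0 \<le> r" "r < x"
          using \<open>y < ereal x\<close> by (cases y) auto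
        obtain t where "t \<in> pos_rats" "r < t" "t < x" using pos_rats_dense[of r x] r by auto
        thus thesis using r that[of t] by auto
      qed
      thus "y \<le> (SUP t\<in>pos_rats. if of_nat k \<le> n t then ereal t else 0)"
        using iff by (intro SUP_upper2[of t]) auto
    qed
  qed
  thus ?thesis using k by (simp add: rearrange_def)
qed

lemma le_weight_count_iff:
  "of_nat k \<le> weight_count d I \<longleftrightarrow> (finite {i. 1 \<le> i \<and> d i \<in> I} \<longrightarrow> k \<le> card {i. 1 \<le> i \<and> d i \<in> I})"
  by (cases "finite {i. 1 \<le> i \<and> d i \<in> I}") (auto simp: weight_count_def emeasure_count_space)

lemma rearrange_decreasing:
  assumes pos: "\<And>k. k \<ge> 1 \<Longrightarrow> d k \<ge> 0" and dec: "\<And>k. k \<ge> 1 \<Longrightarrow> d (Suc k) \<le> d k" and k: "k \<ge> 1"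
  shows "rearrange \<sigma> (tail_counts d) k = d k"
proof (rule rearrange_eqI)
  fix t assume t: "t \<in> pos_rats"
  have mono: "d j \<le> d i" if "1 \<le> i" "i \<le> j" for i j
    using that(2,1) by (induction j rule: dec_induct) (auto intro: order_trans[OF dec])
  let ?A = "{i. 1 \<le> i \<and> d i \<in> {t..}}"
  have "(finite ?A \<longrightarrow> k \<le> card ?A) \<longleftrightarrow> t \<le> d k"
  proof
    assume "t \<le> d k"
    hence "{1..k} \<subseteq> ?A" using mono by (auto intro: order_trans)
    thus "finite ?A \<longrightarrow> k \<le> card ?A" using card_mono[of ?A "{1..k}"] by auto
  next
    assume *: "finite ?A \<longrightarrow> k \<le> card ?A"
    show "t \<le> d k"
    proof (rule ccontr)
      assume "\<not> t \<le> d k"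
      hence sub: "?A \<subseteq> {1..<k}" using mono[OF k] by (force simp: not_le)
      hence "finite ?A" "card ?A \<le> k - 1" using card_mono[OF _ sub] finite_subset[OF sub] by auto
      thus False using * k by auto
    qed
  qed
  thus "of_nat k \<le> tail_counts d t \<longleftrightarrow> t \<le> d k"
    using t by (simp add: tail_counts_def le_weight_count_iff)
qed (use pos k in auto)

text \<open>The rank of a point, with ties broken by the index, matches the positive points with the
  positive entries of the rearrangement.\<close>

lemma rearrange_bij:
  assumes pos: "\<And>k. d k \<ge> 0" and fin: "\<And>t. t > 0 \<Longrightarrow> finite {i. 1 \<le> i \<and> d i \<in> {t..}}"
  shows "\<exists>\<pi>. bij_betw \<pi> {k. 1 \<le> k \<and> d k > 0} {k. 1 \<le> k \<and> rearrange \<sigma> (tail_counts d) k > 0} \<and>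
    (\<forall>k. 1 \<le> k \<longrightarrow> d k > 0 \<longrightarrow> rearrange \<sigma> (tail_counts d) (\<pi> k) = d k)"
proof -
  define P where "P = {k. 1 \<le> k \<and> d k > 0}"
  \<comment> \<open>The points not after \<open>k\<close> in the decreasing order; the rank \<open>\<pi> k\<close> is their number.\<close>
  define B where "B k = {i. 1 \<le> i \<and> (d i > d k \<or> d i = d k \<and> i \<le> k)}" for k
  define \<pi> where "\<pi> k = card (B k)" for k
  have finB: "finite (B k)" if "k \<in> P" for k
    by (rule finite_subset[OF _ fin[of "d k"]]) (use that in \<open>auto simp: B_def P_def\<close>)
  have B_self: "k \<in> B k" if "k \<in> P" for k using that by (auto simp: B_def P_def)
  have \<pi>1: "\<pi> k \<ge> 1" if "k \<in> P" for k
    using B_self[OF that] finB[OF that] by (auto simp: \<pi>_def Suc_le_eq card_gt_0_iff)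
  have val: "rearrange \<sigma> (tail_counts d) (\<pi> k) = d k" if k: "k \<in> P" for k
  proof (rule rearrange_eqI)
    show "\<pi> k \<noteq> 0" using \<pi>1[OF k] by simp
    show "0 \<le> d k" by (rule pos)
    fix t assume t: "t \<in> pos_rats"
    let ?A = "{i. 1 \<le> i \<and> d i \<in> {t..}}"
    have A: "finite ?A" using fin[of t] t by (simp add: pos_rats_def)
    have "\<pi> k \<le> card ?A \<longleftrightarrow> t \<le> d k"
    proof
      assume "t \<le> d k"
      hence "B k \<subseteq> ?A" by (auto simp: B_def)
      thus "\<pi> k \<le> card ?A" unfolding \<pi>_def by (rule card_mono[OF A])
    next
      assume le: "\<pi> k \<le> card ?A"
      show "t \<le> d k"
      proof (rule ccontr)
        assume "\<not> t \<le> d k"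
        hence "?A \<subset> B k" using B_self[OF k] by (auto simp: B_def not_le)
        hence "card ?A < \<pi> k" unfolding \<pi>_def by (rule psubset_card_mono[OF finB[OF k]])
        thus False using le by simp
      qed
    qed
    thus "of_nat (\<pi> k) \<le> tail_counts d t \<longleftrightarrow> t \<le> d k"
      using t A by (simp add: tail_counts_def le_weight_count_iff)
  qed
  have inj: "inj_on \<pi> P"
  proof (rule linorder_inj_onI')
    have less: "\<pi> i \<noteq> \<pi> j" if "i \<in> P" "j \<in> P" "B i \<subset> B j" for i j
      using psubset_card_mono[OF finB[OF that(2)] that(3)] by (simp add: \<pi>_def)
    fix i j assume ij: "i \<in> P" "j \<in> P" "i < j"
    show "\<pi> i \<noteq> \<pi> j"
    proof (cases "d i \<ge> d j")
      case True
      hence "B i \<subseteq> B j" "j \<notin> B i" using ij by (auto simp: B_def)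
      thus ?thesis using B_self[OF ij(2)] by (intro less ij) auto
    next
      case False
      hence "B j \<subseteq> B i" "i \<notin> B j" by (auto simp: B_def)
      hence "B j \<subset> B i" using B_self[OF ij(1)] by blast
      from less[OF ij(2,1) this] show ?thesis by simp
    qed
  qed
  have "\<pi> ` P = {k. 1 \<le> k \<and> rearrange \<sigma> (tail_counts d) k > 0}"
  proof (intro equalityI subsetI)
    fix r assume "r \<in> \<pi> ` P"
    thus "r \<in> {k. 1 \<le> k \<and> rearrange \<sigma> (tail_counts d) k > 0}"
      using \<pi>1 val by (auto simp: P_def)
  next
    fix r assume "r \<in> {k. 1 \<le> k \<and> rearrange \<sigma> (tail_counts d) k > 0}"
    hence r: "1 \<le> r" "rearrange \<sigma> (tail_counts d) r > 0" by auto
    have "\<exists>t\<in>pos_rats. of_nat r \<le> tail_counts d t"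
    proof (rule ccontr)
      assume "\<not> ?thesis"
      hence "(SUP t\<in>pos_rats. if of_nat r \<le> tail_counts d t then ereal t else 0) = (SUP t\<in>pos_rats. 0)"
        by (intro SUP_cong) auto
      also have "\<dots> = 0" using pos_rats_dense[of 0 1] by (intro SUP_const) auto
      finally show False using r by (simp add: rearrange_def)
    qed
    then obtain t where t: "t \<in> pos_rats" "of_nat r \<le> tail_counts d t" by blast
    let ?A = "{i. 1 \<le> i \<and> d i \<in> {t..}}"
    have A: "finite ?A" "?A \<subseteq> P" using fin[of t] t(1) by (auto simp: pos_rats_def P_def)
    have card: "r \<le> card ?A" using t A by (simp add: tail_counts_def le_weight_count_iff)
    have "\<pi> ` ?A \<subseteq> {1..card ?A}"
    proof
      fix x assume "x \<in> \<pi> ` ?A"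
      then obtain k where k: "k \<in> ?A" "x = \<pi> k" by blast
      have "B k \<subseteq> ?A" using k(1) by (auto simp: B_def)
      hence "\<pi> k \<le> card ?A" unfolding \<pi>_def by (rule card_mono[OF A(1)])
      moreover have "1 \<le> \<pi> k" using \<pi>1 k(1) A(2) by blast
      ultimately show "x \<in> {1..card ?A}" using k(2) by simp
    qed
    moreover have "card (\<pi> ` ?A) = card {1..card ?A}"
      using inj_on_subset[OF inj A(2)] by (simp add: card_image)
    ultimately have "\<pi> ` ?A = {1..card ?A}" by (intro card_subset_eq) auto
    hence "r \<in> \<pi> ` ?A" using r card by auto
    thus "r \<in> \<pi> ` P" using A(2) by blast
  qed
  with inj have "bij_betw \<pi> P {k. 1 \<le> k \<and> rearrange \<sigma> (tail_counts d) k > 0}" by (simp add: bij_betw_def)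
  thus ?thesis using val by (intro exI[of _ \<pi>]) (auto simp: P_def)
qed

section \<open>The counts determine the law\<close>

lemma distr_poisson_eq:
  fixes N :: "'a \<Rightarrow> ennreal" and N' :: "'b \<Rightarrow> ennreal"
  assumes M: "prob_space M" "N \<in> borel_measurable M"
    "\<And>n::nat. measure M {\<omega>\<in>space M. N \<omega> = of_nat n} = l ^ n / fact n * exp (- l)"
    and M': "prob_space M'" "N' \<in> borel_measurable M'"
    "\<And>n::nat. measure M' {\<omega>\<in>space M'. N' \<omega> = of_nat n} = l ^ n / fact n * exp (- l)"
    and l: "l \<ge> 0"
  shows "distr M borel N = distr M' borel N'"
proof (rule measure_eqI)
  fix A assume "A \<in> sets (distr M borel N)"
  hence A [measurable]: "A \<in> sets borel" by simp
  define h where "h n = (indicator A (of_nat n :: ennreal) :: real)" for n :: nat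
  have "summable (\<lambda>n. h n * (l ^ n / fact n * exp (- l)))"
  proof (rule summable_comparison_test')
    have "summable (\<lambda>n. l ^ n / fact n)" using summable_exp[of l] by (simp add: field_simps)
    thus "summable (\<lambda>n. l ^ n / fact n * exp (- l))" by (rule summable_mult2)
    show "norm (h n * (l ^ n / fact n * exp (- l))) \<le> l ^ n / fact n * exp (- l)" for n
      using l by (auto simp: h_def indicator_def)
  qed
  hence s: "(\<lambda>n. h n * (l ^ n / fact n * exp (- l))) sums (\<Sum>n. h n * (l ^ n / fact n * exp (- l)))" by (rule summable_sums)
  have g: "indicator A (of_nat n :: ennreal) = ennreal (h n)" for n by (simp add: h_def indicator_def)
  have gm: "(indicator A :: ennreal \<Rightarrow> ennreal) \<in> borel_measurable borel" by measurable
  have h: "h n \<ge> 0" for n by (simp add: h_def)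
  have "emeasure (distr M borel N) A = (\<integral>\<^sup>+\<omega>. indicator A (N \<omega>) \<partial>M)"
    using M(2) by (simp add: nn_integral_distr[symmetric])
  also have "\<dots> = ennreal (\<Sum>n. h n * (l ^ n / fact n * exp (- l)))"
    by (rule prob_space.nn_integral_poisson[OF M(1,2) l M(3) g h gm s])
  also have "\<dots> = (\<integral>\<^sup>+\<omega>. indicator A (N' \<omega>) \<partial>M')"
    by (rule prob_space.nn_integral_poisson[OF M'(1,2) l M'(3) g h gm s, symmetric])
  also have "\<dots> = emeasure (distr M' borel N') A"
    using M'(2) by (simp add: nn_integral_distr[symmetric])
  finally show "emeasure (distr M borel N) A = emeasure (distr M' borel N') A" .
qed simp

lemma tail_counts_measurable:
  assumes C: "poisson_points M \<mu> (\<lambda>\<omega> k. ereal (C \<omega> k))"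
  shows "(\<lambda>\<omega>. tail_counts (\<lambda>k. \<bar>C \<omega> k\<bar>)) \<in> measurable M (PiM pos_rats (\<lambda>_. borel))"
  unfolding tail_counts_def
  by (rule measurable_restrict) (rule poisson_weight_count_measurable[OF C], simp)

text \<open>For finitely many levels the annuli between consecutive levels have independent Poisson counts,
  and the count above a level is a sum of these. Numbering the annulus of a point by the number of
  levels below it avoids sorting the levels.\<close>

lemma tail_counts_law:
  fixes C :: "'a \<Rightarrow> nat \<Rightarrow> real" and C' :: "'b \<Rightarrow> nat \<Rightarrow> real"
  assumes \<nu>: "symmetric_levy_measure \<nu>"
    and M: "prob_space M" "poisson_points M \<nu> (\<lambda>\<omega> k. ereal (C \<omega> k))"
    and M': "prob_space M'" "poisson_points M' \<nu> (\<lambda>\<omega> k. ereal (C' \<omega> k))"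
  shows "distr M (PiM pos_rats (\<lambda>_. borel)) (\<lambda>\<omega>. tail_counts (\<lambda>k. \<bar>C \<omega> k\<bar>))
    = distr M' (PiM pos_rats (\<lambda>_. borel)) (\<lambda>\<omega>. tail_counts (\<lambda>k. \<bar>C' \<omega> k\<bar>))" (is "?P = ?Q")
proof (rule measure_eqI_PiM_infinite)
  show "sets ?P = sets (PiM pos_rats (\<lambda>_. borel))" "sets ?Q = sets (PiM pos_rats (\<lambda>_. borel))" by simp_all
  interpret P: prob_space ?P by (rule prob_space.prob_space_distr[OF M(1) tail_counts_measurable[OF M(2)]])
  show "finite_measure ?P" by unfold_locales
next
  fix A :: "real \<Rightarrow> ennreal set" and J
  assume J: "finite J" "J \<subseteq> pos_rats" and A: "\<And>i. i \<in> J \<Longrightarrow> A i \<in> sets borel"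
  define r where "r x = card {t\<in>J. t \<le> x}" for x :: real
  define I where "I j = (if j = 0 then {} else {x. x > 0 \<and> r x = j})" for j :: nat
  have I_borel: "I j \<in> sets borel" for j
  proof -
    have "real (r x) = (\<Sum>t\<in>J. if t \<le> x then 1 else 0)" for x
      using J(1) by (simp add: r_def sum.If_cases Int_def)
    moreover have "I j = (if j = 0 then {} else {x. x > 0 \<and> real (r x) = real j})" by (simp add: I_def)
    ultimately show ?thesis by simp
  qed
  obtain t0 where t0: "t0 > 0" "\<And>t. t \<in> J \<Longrightarrow> t0 \<le> t"
  proof (cases "J = {}")
    case False
    show thesis using J False Min_in[OF J(1) False] by (intro that[of "Min J"]) (auto simp: pos_rats_def)
  qed (use that[of 1] in auto)
  have I_sub: "I j \<subseteq> {t0..}" for j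
  proof
    fix x assume "x \<in> I j"
    hence "r x \<noteq> 0" by (auto simp: I_def split: if_splits)
    hence "{t\<in>J. t \<le> x} \<noteq> {}" unfolding r_def by (metis card.empty)
    thus "x \<in> {t0..}" using t0 by (auto intro: order_trans)
  qed
  have level: "t \<le> x \<longleftrightarrow> r t \<le> r x" if "t \<in> J" for t x
  proof
    assume "t \<le> x"
    thus "r t \<le> r x" unfolding r_def using J(1) by (intro card_mono) auto
  next
    assume le: "r t \<le> r x"
    show "t \<le> x"
    proof (rule ccontr)
      assume "\<not> t \<le> x"
      hence "{s\<in>J. s \<le> x} \<subset> {s\<in>J. s \<le> t}" using that by auto
      hence "r x < r t" unfolding r_def using J(1) by (intro psubset_card_mono) auto
      thus False using le by simp
    qed
  qed
  have r_pos: "r t \<ge> 1" if "t \<in> J" for t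
    using that J(1) by (auto simp: r_def Suc_le_eq card_gt_0_iff)
  have r_le: "r x \<le> card J" for x unfolding r_def using J(1) by (intro card_mono) auto
  have decomp: "weight_count d {t..} = (\<Sum>j=r t..card J. weight_count d (I j))" if t: "t \<in> J" for d t
  proof -
    have "x \<in> {t..} \<longleftrightarrow> (\<exists>j\<in>{r t..card J}. x \<in> I j)" for x
    proof
      assume "x \<in> {t..}"
      moreover from this have "r t \<le> r x" using level[OF t, of x] by simp
      moreover have "t > 0" using t J(2) by (auto simp: pos_rats_def)
      ultimately have "x \<in> I (r x)" "r x \<in> {r t..card J}"
        using r_pos[OF t] r_le by (auto simp: I_def)
      thus "\<exists>j\<in>{r t..card J}. x \<in> I j" by blast
    next
      assume "\<exists>j\<in>{r t..card J}. x \<in> I j"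
      hence "r t \<le> r x" by (auto simp: I_def split: if_splits)
      thus "x \<in> {t..}" using level[OF t, of x] by simp
    qed
    hence "{i. 1 \<le> i \<and> d i \<in> {t..}} = (\<Union>j\<in>{r t..card J}. {i. 1 \<le> i \<and> d i \<in> I j})" by blast
    moreover have "(\<Sum>j=r t..card J. emeasure (count_space UNIV) {i. 1 \<le> i \<and> d i \<in> I j})
        = emeasure (count_space UNIV) (\<Union>j\<in>{r t..card J}. {i. 1 \<le> i \<and> d i \<in> I j})"
      by (rule sum_emeasure) (auto simp: disjoint_family_on_def I_def split: if_splits)
    ultimately show ?thesis by (simp add: weight_count_def)
  qed
  define E where "E = {x \<in> space (PiM UNIV (\<lambda>_::nat. borel :: ennreal measure)). \<forall>t\<in>J. (\<Sum>j=r t..card J. x j) \<in> A t}"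
  have E: "E \<in> sets (PiM UNIV (\<lambda>_::nat. borel :: ennreal measure))"
    unfolding E_def
  proof (rule sets.sets_Collect_finite_All[OF _ J(1)])
    fix t assume "t \<in> J"
    have "(\<lambda>x. \<Sum>j=r t..card J. x j) \<in> borel_measurable (PiM UNIV (\<lambda>_::nat. borel :: ennreal measure))"
      by (rule borel_measurable_sum) simp
    from measurable_sets[OF this A[OF \<open>t \<in> J\<close>]]
    show "{x \<in> space (PiM UNIV (\<lambda>_::nat. borel :: ennreal measure)). (\<Sum>j=r t..card J. x j) \<in> A t}
        \<in> sets (PiM UNIV (\<lambda>_::nat. borel :: ennreal measure))"
      by (simp only: vimage_def Int_def mem_Collect_eq conj_commute)
  qed
  have law: "distr N (PiM pos_rats (\<lambda>_. borel)) (\<lambda>\<omega>. tail_counts (\<lambda>k. \<bar>D \<omega> k\<bar>)) (prod_emb pos_rats (\<lambda>_. borel) J (Pi\<^sub>E J A))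
      = emeasure (PiM UNIV (\<lambda>j. distr N borel (\<lambda>\<omega>. weight_count (\<lambda>k. \<bar>D \<omega> k\<bar>) (I j)))) E"
    if N: "prob_space N" "poisson_points N \<nu> (\<lambda>\<omega> k. ereal (D \<omega> k))" for N :: "'c measure" and D
  proof -
    interpret prob_space N by (rule N(1))
    let ?c = "\<lambda>j \<omega>. weight_count (\<lambda>k. \<bar>D \<omega> k\<bar>) (I j)"
    have c: "?c j \<in> borel_measurable N" for j by (rule poisson_weight_count_measurable[OF N(2) I_borel])
    define B where "B j = {x. \<bar>x\<bar> \<in> I j}" for j
    have "I j \<subseteq> {0<..}" for j by (auto simp: I_def)
    hence "range B \<subseteq> sets \<nu>"
      unfolding B_def by (intro image_subsetI levy_abs_set[OF \<nu> I_borel])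
    moreover have "disjoint_family B" by (auto simp: disjoint_family_on_def B_def I_def split: if_splits)
    ultimately have "indep_vars (\<lambda>_. borel) (\<lambda>j \<omega>. point_count (\<lambda>k. ereal (D \<omega> k)) (B j)) UNIV"
      using N(2) unfolding poisson_points_def by blast
    hence indep: "indep_vars (\<lambda>_. borel) ?c UNIV" by (simp only: weight_count_eq_point_count B_def)
    have joint: "distr N (PiM UNIV (\<lambda>_. borel)) (\<lambda>\<omega>. \<lambda>j\<in>UNIV. ?c j \<omega>) = PiM UNIV (\<lambda>j. distr N borel (?c j))"
      by (rule indep_vars_iff_distr_eq_PiM'[THEN iffD1, OF _ _ indep]) (rule UNIV_not_empty, rule c)
    let ?emb = "prod_emb pos_rats (\<lambda>_. borel :: ennreal measure) J (Pi\<^sub>E J A)"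
    have emb: "?emb \<in> sets (PiM pos_rats (\<lambda>_. borel))"
      by (rule sets_PiM_I[OF J]) (rule ballI, rule A)
    have "distr N (PiM pos_rats (\<lambda>_. borel)) (\<lambda>\<omega>. tail_counts (\<lambda>k. \<bar>D \<omega> k\<bar>)) ?emb
      = emeasure N ((\<lambda>\<omega>. tail_counts (\<lambda>k. \<bar>D \<omega> k\<bar>)) -` ?emb \<inter> space N)"
      by (rule emeasure_distr[OF tail_counts_measurable[OF N(2)] emb])
    also have "(\<lambda>\<omega>. tail_counts (\<lambda>k. \<bar>D \<omega> k\<bar>)) -` ?emb \<inter> space N = (\<lambda>\<omega>. \<lambda>j\<in>UNIV. ?c j \<omega>) -` E \<inter> space N"
    proof -
      have tc: "tail_counts d t = (\<Sum>j=r t..card J. weight_count d (I j))" if "t \<in> J" for d t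
        unfolding decomp[OF that, symmetric] tail_counts_def using that J(2) by (simp add: subset_iff)
      have "tail_counts d \<in> ?emb \<longleftrightarrow> (\<forall>t\<in>J. tail_counts d t \<in> A t)" for d
        using J(2) by (auto simp: prod_emb_def PiE_iff tail_counts_def Int_absorb1[OF J(2)])
      moreover have "(\<forall>t\<in>J. tail_counts d t \<in> A t) \<longleftrightarrow> (\<lambda>j\<in>UNIV. weight_count d (I j)) \<in> E" for d
        unfolding E_def mem_Collect_eq restrict_UNIV using tc by (simp add: space_PiM del: vimage_Collect_eq)
      ultimately have mem: "tail_counts d \<in> ?emb \<longleftrightarrow> (\<lambda>j\<in>UNIV. weight_count d (I j)) \<in> E" for d by simp
      show ?thesis unfolding vimage_def by (simp only: mem)
    qed
    also have "emeasure N \<dots> = emeasure (distr N (PiM UNIV (\<lambda>_. borel)) (\<lambda>\<omega>. \<lambda>j\<in>UNIV. ?c j \<omega>)) E"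
      by (rule emeasure_distr[OF measurable_restrict[OF c] E, symmetric])
    finally show ?thesis unfolding joint .
  qed
  have "distr M borel (\<lambda>\<omega>. weight_count (\<lambda>k. \<bar>C \<omega> k\<bar>) (I j)) = distr M' borel (\<lambda>\<omega>. weight_count (\<lambda>k. \<bar>C' \<omega> k\<bar>) (I j))" for j
  proof (rule distr_poisson_eq[OF M(1) _ _ M'(1)])
    show "levy_mass \<nu> (I j) \<ge> 0" by (simp add: levy_mass_def)
  qed (rule poisson_weight_count_measurable[OF M(2) I_borel] poisson_weight_count_measurable[OF M'(2) I_borel]
    poisson_weight_count[OF \<nu> M(2) I_borel I_sub t0(1)] poisson_weight_count[OF \<nu> M'(2) I_borel I_sub t0(1)])+
  thus "emeasure ?P (prod_emb pos_rats (\<lambda>_. borel) J (Pi\<^sub>E J A)) = emeasure ?Q (prod_emb pos_rats (\<lambda>_. borel) J (Pi\<^sub>E J A))"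
    unfolding law[OF M] law[OF M'] by simp
qed

section \<open>Mixtures over the points\<close>

text \<open>The right hand side of the recursion; entry 0 of \<open>d\<close> is the weight of the nonrandom edge.\<close>

definition schur_map :: "complex \<Rightarrow> (nat \<Rightarrow> real) \<Rightarrow> (nat \<Rightarrow> complex) \<Rightarrow> complex" where
  "schur_map z d r = - inverse (z + (\<Sum>\<^sub>\<infinity>k. complex_of_real ((d k)\<^sup>2) * r k))"

text \<open>In this form the value 0 of a divergent sum is covered, so that the sum is measurable on the
  whole space.\<close>

lemma infsum_nat_complex:
  fixes f :: "nat \<Rightarrow> complex"
  shows "(\<Sum>\<^sub>\<infinity>k. f k) = (if (\<Sum>k. ennreal (cmod (f k))) < \<top> then \<Sum>k. f k else 0)"
proof -
  have "f summable_on UNIV \<longleftrightarrow> (\<lambda>k. cmod (f k)) summable_on UNIV"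
    by (rule summable_on_iff_abs_summable_on_complex)
  also have "\<dots> \<longleftrightarrow> summable (\<lambda>k. cmod (f k))" by (rule summable_on_UNIV_nonneg_real_iff) simp
  also have "\<dots> \<longleftrightarrow> (\<Sum>k. ennreal (cmod (f k))) < \<top>"
  proof
    assume "summable (\<lambda>k. cmod (f k))"
    hence "(\<Sum>k. ennreal (cmod (f k))) \<noteq> \<top>" by (rule ennreal_suminf_neq_top) simp
    thus "(\<Sum>k. ennreal (cmod (f k))) < \<top>" by (simp only: top.not_eq_extremum)
  next
    assume "(\<Sum>k. ennreal (cmod (f k))) < \<top>"
    hence "(\<Sum>k. ennreal (cmod (f k))) \<noteq> \<top>" by (simp only: top.not_eq_extremum)
    thus "summable (\<lambda>k. cmod (f k))" by (intro summable_suminf_not_top) simp_all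
  qed
  finally have iff: "f summable_on UNIV \<longleftrightarrow> (\<Sum>k. ennreal (cmod (f k))) < \<top>" .
  show ?thesis
  proof (cases "f summable_on UNIV")
    case True
    hence "f sums (\<Sum>\<^sub>\<infinity>k. f k)" by (intro has_sum_imp_sums) simp
    thus ?thesis using True iff by (simp add: sums_unique)
  next
    case False
    thus ?thesis using iff by (simp add: infsum_not_exists)
  qed
qed

lemma borel_measurable_infsum_nat:
  fixes f :: "nat \<Rightarrow> 'a \<Rightarrow> complex"
  assumes [measurable]: "\<And>k. f k \<in> borel_measurable M"
  shows "(\<lambda>\<omega>. \<Sum>\<^sub>\<infinity>k. f k \<omega>) \<in> borel_measurable M"
  unfolding infsum_nat_complex by measurable

lemma measurable_schur_map:
  "(\<lambda>(d, r). schur_map z d r) \<in> borel_measurable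
    ((PiM UNIV (\<lambda>_. borel) :: (nat \<Rightarrow> real) measure) \<Otimes>\<^sub>M (PiM UNIV (\<lambda>_. borel) :: (nat \<Rightarrow> complex) measure))"
proof -
  have [measurable]: "(\<lambda>p. \<Sum>\<^sub>\<infinity>k. complex_of_real ((fst p k)\<^sup>2) * snd p k) \<in> borel_measurable
    ((PiM UNIV (\<lambda>_. borel) :: (nat \<Rightarrow> real) measure) \<Otimes>\<^sub>M (PiM UNIV (\<lambda>_. borel) :: (nat \<Rightarrow> complex) measure))"
    by (rule borel_measurable_infsum_nat) measurable
  show ?thesis unfolding schur_map_def case_prod_beta by measurable
qed

lemma sets_PiM_borel_cong:
  "sets \<rho> = sets borel \<Longrightarrow> sets (PiM I (\<lambda>_. \<rho>)) = sets (PiM I (\<lambda>_. borel))"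
  by (rule sets_PiM_cong) auto

text \<open>Identically distributed independent variables can be relabelled along the bijection \<open>\<pi>\<close> without
  changing their joint law, and labels outside of \<open>P\<close> and \<open>S\<close> do not enter the sums.\<close>

lemma schur_map_relabel:
  fixes \<rho> :: "complex measure"
  assumes \<rho>: "prob_space \<rho>" "sets \<rho> = sets borel"
    and bij: "bij_betw \<pi> P S" and val: "\<And>k. k \<in> P \<Longrightarrow> s (\<pi> k) = d k"
    and d0: "\<And>k. k \<notin> P \<Longrightarrow> d k = 0" and s0: "\<And>k. k \<notin> S \<Longrightarrow> s k = 0"
    and B: "B \<in> sets borel"
  shows "emeasure (PiM UNIV (\<lambda>_. \<rho>)) (schur_map z d -` B) = emeasure (PiM UNIV (\<lambda>_. \<rho>)) (schur_map z s -` B)"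
proof -
  define \<tau> where "\<tau> = inv_into P \<pi>"
  have \<tau>: "bij_betw \<tau> S P" unfolding \<tau>_def by (rule bij_betw_inv_into[OF bij])
  have \<tau>_val: "d (\<tau> j) = s j" if "j \<in> S" for j
  proof -
    have "\<tau> j \<in> P" using \<tau> that by (auto simp: bij_betw_def)
    moreover have "\<pi> (\<tau> j) = j" unfolding \<tau>_def using bij that by (simp add: bij_betw_def f_inv_into_f)
    ultimately show ?thesis using val[of "\<tau> j"] by simp
  qed
  define \<Phi> where "\<Phi> x = - inverse (z + (\<Sum>\<^sub>\<infinity>j. if j \<in> S then complex_of_real ((s j)\<^sup>2) * x j else 0))" for x :: "nat \<Rightarrow> complex"
  have \<Phi>_eq: "\<Phi> x = - inverse (z + (\<Sum>\<^sub>\<infinity>j\<in>S. complex_of_real ((s j)\<^sup>2) * x j))" for x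
    unfolding \<Phi>_def by (intro arg_cong[where f = "\<lambda>y. - inverse (z + y)"] infsum_cong_neutral) auto
  have \<Phi>_meas: "\<Phi> \<in> borel_measurable (PiM S (\<lambda>_. \<rho>))"
  proof -
    have "(\<lambda>x. \<Sum>\<^sub>\<infinity>j. if j \<in> S then complex_of_real ((s j)\<^sup>2) * x j else 0) \<in> borel_measurable (PiM S (\<lambda>_. borel))"
    proof (rule borel_measurable_infsum_nat)
      fix j
      show "(\<lambda>x. if j \<in> S then complex_of_real ((s j)\<^sup>2) * x j else 0) \<in> borel_measurable (PiM S (\<lambda>_. borel))"
        by (cases "j \<in> S") simp_all
    qed
    hence "\<Phi> \<in> borel_measurable (PiM S (\<lambda>_. borel))" unfolding \<Phi>_def by measurable
    thus ?thesis using measurable_cong_sets[OF sets_PiM_borel_cong[OF \<rho>(2)] refl] by blast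
  qed
  have space: "space \<rho> = UNIV" using sets_eq_imp_space_eq[OF \<rho>(2)] by simp
  have d_eq: "schur_map z d r = \<Phi> (\<lambda>j\<in>S. r (\<tau> j))" for r
  proof -
    have "(\<Sum>\<^sub>\<infinity>k. complex_of_real ((d k)\<^sup>2) * r k) = (\<Sum>\<^sub>\<infinity>k\<in>P. complex_of_real ((d k)\<^sup>2) * r k)"
      using d0 by (intro infsum_cong_neutral) auto
    also have "\<dots> = (\<Sum>\<^sub>\<infinity>j\<in>S. complex_of_real ((d (\<tau> j))\<^sup>2) * r (\<tau> j))"
      by (rule infsum_reindex_bij_betw[OF \<tau>, symmetric])
    also have "\<dots> = (\<Sum>\<^sub>\<infinity>j\<in>S. complex_of_real ((s j)\<^sup>2) * (\<lambda>j\<in>S. r (\<tau> j)) j)"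
      by (intro infsum_cong) (simp add: \<tau>_val)
    finally show ?thesis by (simp add: schur_map_def \<Phi>_eq)
  qed
  have s_eq: "schur_map z s r = \<Phi> (\<lambda>j\<in>S. r j)" for r
  proof -
    have "(\<Sum>\<^sub>\<infinity>k. complex_of_real ((s k)\<^sup>2) * r k) = (\<Sum>\<^sub>\<infinity>j\<in>S. complex_of_real ((s j)\<^sup>2) * (\<lambda>j\<in>S. r j) j)"
      using s0 by (intro infsum_cong_neutral) auto
    thus ?thesis by (simp add: schur_map_def \<Phi>_eq)
  qed
  have law: "emeasure (PiM UNIV (\<lambda>_. \<rho>)) {r. \<Phi> (\<lambda>j\<in>S. r (f j)) \<in> B} = emeasure (PiM S (\<lambda>_. \<rho>)) (\<Phi> -` B \<inter> space (PiM S (\<lambda>_. \<rho>)))"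
    if f: "inj_on f S" for f :: "nat \<Rightarrow> nat"
  proof -
    have "emeasure (PiM S (\<lambda>_. \<rho>)) (\<Phi> -` B \<inter> space (PiM S (\<lambda>_. \<rho>)))
        = emeasure (distr (PiM UNIV (\<lambda>_. \<rho>)) (PiM S (\<lambda>_. \<rho>)) (\<lambda>r. \<lambda>j\<in>S. r (f j))) (\<Phi> -` B \<inter> space (PiM S (\<lambda>_. \<rho>)))"
      using distr_PiM_reindex[of UNIV "\<lambda>_. \<rho>" f S] \<rho>(1) f by simp
    also have "\<dots> = emeasure (PiM UNIV (\<lambda>_. \<rho>)) ((\<lambda>r. \<lambda>j\<in>S. r (f j)) -` (\<Phi> -` B \<inter> space (PiM S (\<lambda>_. \<rho>))) \<inter> space (PiM UNIV (\<lambda>_. \<rho>)))"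
      by (intro emeasure_distr measurable_restrict measurable_component_singleton measurable_sets[OF \<Phi>_meas B]) simp
    also have "(\<lambda>r. \<lambda>j\<in>S. r (f j)) -` (\<Phi> -` B \<inter> space (PiM S (\<lambda>_. \<rho>))) \<inter> space (PiM UNIV (\<lambda>_. \<rho>)) = {r. \<Phi> (\<lambda>j\<in>S. r (f j)) \<in> B}"
      by (auto simp: space_PiM space)
    finally show ?thesis by simp
  qed
  have "inj_on \<tau> S" using \<tau> by (simp add: bij_betw_def)
  from law[OF this] law[of "\<lambda>j. j"] show ?thesis
    by (simp add: vimage_def d_eq s_eq)
qed

lemma rearrange_nonneg: "k \<noteq> 0 \<Longrightarrow> rearrange \<sigma> n k \<ge> 0"
proof -
  obtain t where t: "t \<in> pos_rats" using pos_rats_dense[of 0 1] by auto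
  have "0 \<le> (SUP t\<in>pos_rats. if of_nat k \<le> n t then ereal t else 0)"
    by (rule SUP_upper2[OF t]) (use t in \<open>auto simp: pos_rats_def\<close>)
  thus "k \<noteq> 0 \<Longrightarrow> rearrange \<sigma> n k \<ge> 0" by (simp add: rearrange_def real_of_ereal_pos)
qed

lemma tail_counts_cong: "(\<And>k. 1 \<le> k \<Longrightarrow> d k = d' k) \<Longrightarrow> tail_counts d = tail_counts d'"
  unfolding tail_counts_def weight_count_def
  by (intro restrict_ext arg_cong[where f = "emeasure _"]) auto

lemma schur_map_rearrange:
  fixes \<rho> :: "complex measure"
  assumes \<rho>: "prob_space \<rho>" "sets \<rho> = sets borel"
    and d: "\<And>k. d k \<ge> 0" and fin: "\<And>t. t > 0 \<Longrightarrow> finite {i. 1 \<le> i \<and> d i \<in> {t..}}"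
    and B: "B \<in> sets borel"
  shows "emeasure (PiM UNIV (\<lambda>_. \<rho>)) (schur_map z d -` B)
    = emeasure (PiM UNIV (\<lambda>_. \<rho>)) (schur_map z (rearrange (d 0) (tail_counts d)) -` B)"
proof -
  let ?s = "rearrange (d 0) (tail_counts d)"
  obtain \<pi> where \<pi>: "bij_betw \<pi> {k. 1 \<le> k \<and> d k > 0} {k. 1 \<le> k \<and> ?s k > 0}"
    "\<And>k. 1 \<le> k \<Longrightarrow> d k > 0 \<Longrightarrow> ?s (\<pi> k) = d k"
    using rearrange_bij[OF d fin, of "d 0"] by blast
  have bij: "bij_betw (\<lambda>k. if k = 0 then 0 else \<pi> k) (insert 0 {k. 1 \<le> k \<and> d k > 0}) (insert 0 {k. 1 \<le> k \<and> ?s k > 0})"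
  proof -
    have "bij_betw (\<lambda>k. if k = 0 then 0 else \<pi> k) {k. 1 \<le> k \<and> d k > 0} {k. 1 \<le> k \<and> ?s k > 0}"
      by (rule bij_betw_cong[THEN iffD2, OF _ \<pi>(1)]) auto
    from notIn_Un_bij_betw[OF _ _ this, of 0] show ?thesis by simp
  qed
  show ?thesis
  proof (rule schur_map_relabel[OF \<rho> bij _ _ _ B])
    fix k assume "k \<in> insert 0 {k. 1 \<le> k \<and> d k > 0}"
    thus "?s (if k = 0 then 0 else \<pi> k) = d k" using \<pi>(2) by (auto simp: rearrange_def[of _ _ 0])
  next
    fix k assume "k \<notin> insert 0 {k. 1 \<le> k \<and> d k > 0}"
    thus "d k = 0" using d[of k] by (auto simp: Suc_le_eq)
  next
    fix k assume "k \<notin> insert 0 {k. 1 \<le> k \<and> ?s k > 0}"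
    thus "?s k = 0" using rearrange_nonneg[of k "d 0" "tail_counts d"] by (auto simp: Suc_le_eq)
  qed
qed

text \<open>The predicate \<open>indep_var\<close> relates variables with values in one type. The product form of the joint
  law also covers the real weights together with the complex resolvents.\<close>

lemma (in prob_space) indep_var_joint_distr:
  assumes indep: "indep_var S X T Y" and \<phi>: "\<phi> \<in> measurable T T'"
  shows "distr M (S \<Otimes>\<^sub>M T') (\<lambda>\<omega>. (X \<omega>, \<phi> (Y \<omega>))) = distr M S X \<Otimes>\<^sub>M distr M T' (\<lambda>\<omega>. \<phi> (Y \<omega>))"
proof -
  have rv: "X \<in> measurable M S" "Y \<in> measurable M T"
    and joint: "distr M S X \<Otimes>\<^sub>M distr M T Y = distr M (S \<Otimes>\<^sub>M T) (\<lambda>\<omega>. (X \<omega>, Y \<omega>))"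
    using indep unfolding indep_var_distribution_eq by blast+
  have \<phi>Y: "(\<lambda>\<omega>. \<phi> (Y \<omega>)) \<in> measurable M T'" by (rule measurable_compose[OF rv(2) \<phi>])
  have T': "distr M T' (\<lambda>\<omega>. \<phi> (Y \<omega>)) = distr (distr M T Y) T' \<phi>"
    by (subst distr_distr[OF \<phi> rv(2)]) (simp add: o_def)
  interpret Y: prob_space "distr (distr M T Y) T' \<phi>"
    unfolding T'[symmetric] by (rule prob_space_distr[OF \<phi>Y])
  have "distr M S X \<Otimes>\<^sub>M distr M T' (\<lambda>\<omega>. \<phi> (Y \<omega>)) = distr (distr M S X) S (\<lambda>x. x) \<Otimes>\<^sub>M distr (distr M T Y) T' \<phi>"
    unfolding T' by (simp add: distr_id2)
  also have "\<dots> = distr (distr M S X \<Otimes>\<^sub>M distr M T Y) (S \<Otimes>\<^sub>M T') (\<lambda>(x, y). (x, \<phi> y))"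
  proof (rule pair_measure_distr)
    show "(\<lambda>x. x) \<in> measurable (distr M S X) S" by (rule measurable_ident_sets) (rule sets_distr)
    show "\<phi> \<in> measurable (distr M T Y) T'" by (subst measurable_distr_eq1) (rule \<phi>)
    show "sigma_finite_measure (distr (distr M T Y) T' \<phi>)" by unfold_locales
  qed
  also have "\<dots> = distr M (S \<Otimes>\<^sub>M T') ((\<lambda>(x, y). (x, \<phi> y)) \<circ> (\<lambda>\<omega>. (X \<omega>, Y \<omega>)))"
  proof -
    have "(\<lambda>(x, y). (x, \<phi> y)) \<in> measurable (S \<Otimes>\<^sub>M T) (S \<Otimes>\<^sub>M T')"
    proof -
      have "(\<lambda>p. (fst p, \<phi> (snd p))) \<in> measurable (S \<Otimes>\<^sub>M T) (S \<Otimes>\<^sub>M T')"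
        by (rule measurable_Pair[OF measurable_fst measurable_compose[OF measurable_snd \<phi>]])
      thus ?thesis by (simp only: split_beta')
    qed
    from distr_distr[OF this measurable_Pair[OF rv]] show ?thesis unfolding joint .
  qed
  finally show ?thesis by (simp add: o_def)
qed

text \<open>By Fubini the law is obtained by fixing the weights and integrating over the independent copies
  first; only this inner probability depends on the labelling of the weights.\<close>

lemma (in prob_space) schur_map_mixture:
  fixes R :: "nat \<Rightarrow> 'a \<Rightarrow> complex" and d :: "'a \<Rightarrow> nat \<Rightarrow> real"
  assumes d: "d \<in> measurable M (PiM UNIV (\<lambda>_. borel))"
    and joint: "distr M (PiM UNIV (\<lambda>_. borel) \<Otimes>\<^sub>M PiM UNIV (\<lambda>_. borel)) (\<lambda>\<omega>. (\<lambda>k\<in>UNIV. R k \<omega>, d \<omega>))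
      = distr M (PiM UNIV (\<lambda>_. borel)) (\<lambda>\<omega>. \<lambda>k\<in>UNIV. R k \<omega>) \<Otimes>\<^sub>M distr M (PiM UNIV (\<lambda>_. borel)) d"
    and R: "indep_vars (\<lambda>_. borel) R UNIV" "\<And>k. distr M borel (R k) = \<rho>"
    and B: "B \<in> sets borel"
  shows "emeasure (distr M borel (\<lambda>\<omega>. schur_map z (d \<omega>) (\<lambda>k. R k \<omega>))) B
    = (\<integral>\<^sup>+\<omega>. emeasure (PiM UNIV (\<lambda>_. \<rho>)) (schur_map z (d \<omega>) -` B) \<partial>M)"
proof -
  let ?D = "PiM UNIV (\<lambda>_. borel) :: (nat \<Rightarrow> real) measure"
  let ?Q = "PiM UNIV (\<lambda>_. borel) :: (nat \<Rightarrow> complex) measure"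
  let ?R = "\<lambda>\<omega>. \<lambda>k\<in>UNIV. R k \<omega>"
  have Rm: "R k \<in> borel_measurable M" for k using R(1) unfolding indep_vars_def2 by blast
  have rv: "?R \<in> measurable M ?Q" "d \<in> measurable M ?D"
    by (rule measurable_restrict[OF Rm]) (rule d)
  have \<rho>: "prob_space \<rho>" unfolding R(2)[of 0, symmetric] by (rule prob_space_distr[OF Rm])
  have \<rho>_sets: "sets \<rho> = sets borel" unfolding R(2)[of 0, symmetric] by simp
  have law_R: "distr M ?Q ?R = PiM UNIV (\<lambda>_. \<rho>)"
    using indep_vars_iff_distr_eq_PiM'[THEN iffD1, OF UNIV_not_empty Rm R(1)] unfolding R(2) .
  interpret Q: prob_space "distr M ?Q ?R" by (rule prob_space_distr[OF rv(1)])
  interpret D: prob_space "distr M ?D d" by (rule prob_space_distr[OF rv(2)])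
  interpret QD: pair_sigma_finite "distr M ?Q ?R" "distr M ?D d" ..
  have swap: "(\<lambda>(r, x). schur_map z x r) \<in> borel_measurable (?Q \<Otimes>\<^sub>M ?D)"
    using measurable_pair_swap[OF measurable_schur_map[of z]] by (simp only: prod.case)
  let ?E = "(\<lambda>(r, x). schur_map z x r) -` B \<inter> space (?Q \<Otimes>\<^sub>M ?D)"
  have E: "?E \<in> sets (?Q \<Otimes>\<^sub>M ?D)" by (rule measurable_sets[OF swap B])
  have "emeasure (distr M borel (\<lambda>\<omega>. schur_map z (d \<omega>) (\<lambda>k. R k \<omega>))) B
      = emeasure (distr M borel ((\<lambda>(r, x). schur_map z x r) \<circ> (\<lambda>\<omega>. (?R \<omega>, d \<omega>)))) B"
    by (simp only: o_def prod.case restrict_UNIV)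
  also have "\<dots> = emeasure (distr (distr M (?Q \<Otimes>\<^sub>M ?D) (\<lambda>\<omega>. (?R \<omega>, d \<omega>))) borel (\<lambda>(r, x). schur_map z x r)) B"
    by (subst distr_distr[OF swap measurable_Pair[OF rv]]) rule
  also have "\<dots> = emeasure (distr M ?Q ?R \<Otimes>\<^sub>M distr M ?D d) ?E"
  proof -
    have "(\<lambda>(r, x). schur_map z x r) \<in> borel_measurable (distr M (?Q \<Otimes>\<^sub>M ?D) (\<lambda>\<omega>. (?R \<omega>, d \<omega>)))"
      using swap by (simp only: measurable_distr_eq1)
    from emeasure_distr[OF this B] show ?thesis unfolding joint[symmetric] by (simp only: space_distr)
  qed
  also have "\<dots> = (\<integral>\<^sup>+x. emeasure (distr M ?Q ?R) ((\<lambda>r. (r, x)) -` ?E) \<partial>distr M ?D d)"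
  proof (rule QD.emeasure_pair_measure_alt2)
    show "?E \<in> sets (distr M ?Q ?R \<Otimes>\<^sub>M distr M ?D d)"
      unfolding joint[symmetric] sets_distr by (rule E)
  qed
  also have "\<dots> = (\<integral>\<^sup>+\<omega>. emeasure (distr M ?Q ?R) ((\<lambda>r. (r, d \<omega>)) -` ?E) \<partial>M)"
  proof (rule nn_integral_distr[OF rv(2)])
    have "?E \<in> sets (distr M ?Q ?R \<Otimes>\<^sub>M distr M ?D d)"
      unfolding joint[symmetric] sets_distr by (rule E)
    from QD.measurable_emeasure_Pair2[OF this]
    show "(\<lambda>x. emeasure (distr M ?Q ?R) ((\<lambda>r. (r, x)) -` ?E)) \<in> borel_measurable (distr M ?D d)" .
  qed
  also have "(\<lambda>\<omega>. (\<lambda>r. (r, d \<omega>)) -` ?E) = (\<lambda>\<omega>. schur_map z (d \<omega>) -` B)"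
    by (auto simp: space_pair_measure space_PiM fun_eq_iff)
  finally show ?thesis unfolding law_R .
qed

lemma measurable_schur_map_prob:
  fixes \<rho> :: "complex measure"
  assumes \<rho>: "prob_space \<rho>" "sets \<rho> = sets borel" and B: "B \<in> sets borel"
  shows "(\<lambda>d. emeasure (PiM UNIV (\<lambda>_. \<rho>)) (schur_map z d -` B)) \<in> borel_measurable (PiM UNIV (\<lambda>_. borel))"
proof -
  let ?D = "PiM UNIV (\<lambda>_. borel) :: (nat \<Rightarrow> real) measure" and ?P = "PiM UNIV (\<lambda>_ :: nat. \<rho>)"
  let ?Q = "PiM UNIV (\<lambda>_. borel) :: (nat \<Rightarrow> complex) measure"
  interpret P: prob_space ?P using \<rho>(1) by (intro prob_space_PiM)
  let ?E = "(\<lambda>(d, r). schur_map z d r) -` B \<inter> space (?D \<Otimes>\<^sub>M ?Q)"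
  have "?E \<in> sets (?D \<Otimes>\<^sub>M ?Q)" by (rule measurable_sets[OF measurable_schur_map B])
  moreover have "sets (?D \<Otimes>\<^sub>M ?P) = sets (?D \<Otimes>\<^sub>M ?Q)"
    by (intro sets_pair_measure_cong refl sets_PiM_borel_cong \<rho>)
  ultimately have E: "?E \<in> sets (?D \<Otimes>\<^sub>M ?P)" by (simp only:)
  have "(\<lambda>d. emeasure ?P (Pair d -` ?E)) \<in> borel_measurable ?D"
    by (rule P.measurable_emeasure_Pair[OF E])
  moreover have "Pair d -` ?E = schur_map z d -` B" for d
  proof (rule set_eqI)
    fix r :: "nat \<Rightarrow> complex"
    have "(d, r) \<in> space (?D \<Otimes>\<^sub>M ?Q)" by (simp add: space_pair_measure space_PiM)
    thus "r \<in> Pair d -` ?E \<longleftrightarrow> r \<in> schur_map z d -` B"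
      by (simp only: vimage_eq Int_iff prod.case simp_thms)
  qed
  ultimately show ?thesis by (simp only:)
qed

lemma measurable_PiM_UNIV_single:
  "(\<And>i. (\<lambda>x. f x i) \<in> measurable N (M i)) \<Longrightarrow> f \<in> measurable N (PiM UNIV M)"
proof (rule measurable_PiM_single')
  assume f: "\<And>i. (\<lambda>x. f x i) \<in> measurable N (M i)"
  show "(\<lambda>x. f x i) \<in> measurable N (M i)" for i by (rule f)
  show "f \<in> space N \<rightarrow> (\<Pi>\<^sub>E i\<in>UNIV. space (M i))"
    using measurable_space[OF f] by (intro funcsetI PiE_I) simp_all
qed

section \<open>Trees with Poisson weights\<close>

lemma kept_path_subtree: "kept_path (\<lambda>v. K (k # v)) v w \<longleftrightarrow> kept_path K (k # v) w"
  by (induction w arbitrary: v) auto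

lemma summable_of_finite_heavy_points:
  assumes \<nu>: "symmetric_levy_measure \<nu>" and K: "K > 0" and d: "\<And>k. d k \<ge> 0"
    and fin: "finite (heavy_points \<nu> K d)"
  shows "(\<lambda>k. (d k)\<^sup>2) summable_on UNIV"
proof (rule nonneg_bdd_above_summable_on)
  let ?\<kappa> = "\<Sum>j. layer_limit \<nu> K j * (K / 2 ^ (j - 1))\<^sup>2"
  let ?H = "insert 0 (heavy_points \<nu> K d)"
  show "bdd_above (sum (\<lambda>k. (d k)\<^sup>2) ` {F. F \<subseteq> UNIV \<and> finite F})"
  proof (rule bdd_aboveI2)
    fix F :: "nat set" assume "F \<in> {F. F \<subseteq> UNIV \<and> finite F}"
    hence F: "finite F" by simp
    have "(\<Sum>k\<in>F. (d k)\<^sup>2) \<le> (\<Sum>k\<in>?H \<union> (F - ?H). (d k)\<^sup>2)"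
      using F fin by (intro sum_mono2) auto
    also have "\<dots> = (\<Sum>k\<in>?H. (d k)\<^sup>2) + (\<Sum>k\<in>F - ?H. (d k)\<^sup>2)"
      using F fin by (intro sum.union_disjoint) auto
    also have "(\<Sum>k\<in>F - ?H. (d k)\<^sup>2) \<le> ?\<kappa>"
      using F by (intro light_points_bound[OF \<nu> K d]) auto
    finally show "(\<Sum>k\<in>F. (d k)\<^sup>2) \<le> (\<Sum>k\<in>?H. (d k)\<^sup>2) + ?\<kappa>" by simp
  qed
qed simp

text \<open>The nonrandom edge is never heavy and adds \<open>\<sigma>\<^sup>2\<close> to the bound for the light points.\<close>

lemma heavy_tree_resolvent_set:
  assumes \<nu>: "symmetric_levy_measure \<nu>" and K: "K > 0"
    and c: "\<And>v k. c v k \<ge> 0" "\<And>v. c v 0 = \<sigma>"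
    and fin: "\<And>v. finite {w. kept_path (\<lambda>v. heavy_points \<nu> K (c v)) v w}"
    and z: "Im z > 0"
  shows "z \<in> resolvent_set (op_closure (tree_rel c))"
proof (rule tree_resolvent_set[OF _ fin z])
  fix v and F :: "nat set"
  assume F: "finite F" "F \<inter> heavy_points \<nu> K (c v) = {}"
  have "(\<Sum>k\<in>F. (c v k)\<^sup>2) \<le> (\<Sum>k\<in>insert 0 (F - {0}). (c v k)\<^sup>2)"
    using F by (intro sum_mono2) auto
  also have "\<dots> = \<sigma>\<^sup>2 + (\<Sum>k\<in>F - {0}. (c v k)\<^sup>2)" using F c(2) by (subst sum.insert) auto
  also have "(\<Sum>k\<in>F - {0}. (c v k)\<^sup>2) \<le> (\<Sum>j. layer_limit \<nu> K j * (K / 2 ^ (j - 1))\<^sup>2)"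
    using F by (intro light_points_bound[OF \<nu> K c(1)]) auto
  finally show "(\<Sum>k\<in>F. (c v k)\<^sup>2) \<le> \<sigma>\<^sup>2 + (\<Sum>j. layer_limit \<nu> K j * (K / 2 ^ (j - 1))\<^sup>2)" by simp
qed

lemma heavy_tree_recursion:
  assumes \<nu>: "symmetric_levy_measure \<nu>" and K: "K > 0"
    and c: "\<And>v k. c v k \<ge> 0" "\<And>v. c v 0 = \<sigma>"
    and fin: "\<And>v. finite {w. kept_path (\<lambda>v. heavy_points \<nu> K (c v)) v w}"
    and z: "Im z > 0"
  shows "tree_resolvent z c = schur_map z (c []) (\<lambda>k. tree_resolvent z (\<lambda>v. c (k # v)))"
  unfolding schur_map_def
proof (rule tree_resolvent_recursion[OF z])
  have "(\<lambda>k. [k]) ` heavy_points \<nu> K (c []) \<subseteq> {w. kept_path (\<lambda>v. heavy_points \<nu> K (c v)) [] w}" by auto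
  hence "finite ((\<lambda>k. [k]) ` heavy_points \<nu> K (c []))" by (rule finite_subset[OF _ fin])
  hence "finite (heavy_points \<nu> K (c []))" by (rule finite_imageD) (auto simp: inj_on_def)
  thus "(\<lambda>k. (c [] k)\<^sup>2) summable_on UNIV" by (intro summable_of_finite_heavy_points[OF \<nu> K c(1)])
  show "z \<in> resolvent_set (op_closure (tree_rel c))"
    by (rule heavy_tree_resolvent_set[OF \<nu> K c fin z])
  show "z \<in> resolvent_set (op_closure (tree_rel (\<lambda>v. c (k # v))))" for k
  proof (rule heavy_tree_resolvent_set[where c = "\<lambda>v. c (k # v)" and \<sigma> = \<sigma>, OF \<nu> K _ _ _ z])
    fix v
    show "0 \<le> c (k # v) l" "c (k # v) 0 = \<sigma>" for l by (rule c)+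
    show "finite {w. kept_path (\<lambda>v. heavy_points \<nu> K (c (k # v))) v w}"
      using fin[of "k # v"] kept_path_subtree[of "\<lambda>v. heavy_points \<nu> K (c v)" k v] by simp
  qed
qed

lemma heavy_points_measurable:
  "{x \<in> space (PiM UNIV (\<lambda>_. borel)). k \<in> heavy_points \<nu> K x} \<in> sets (PiM UNIV (\<lambda>_. borel))"
proof -
  have [measurable]: "(\<lambda>x. weight_count x (layer K j)) \<in> borel_measurable (PiM UNIV (\<lambda>_. borel))" for j
    by (rule measurable_weight_count) auto
  show ?thesis unfolding heavy_points_def mem_Collect_eq by measurable
qed

section \<open>Reciprocal points\<close>

definition recip_set :: "real set \<Rightarrow> real set" where
  "recip_set B = {x. x \<noteq> 0 \<and> 1 / x \<in> B}"

lemma recip_measurable: "(\<lambda>x. 1 / x) \<in> measurable punctured_borel punctured_borel"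
  unfolding punctured_borel_def
  by (rule measurable_restrict_space3) auto

lemma space_punctured_borel: "space punctured_borel = - {0}"
  by (simp add: punctured_borel_def space_restrict_space)

lemma recip_set_sets: "B \<in> sets punctured_borel \<Longrightarrow> recip_set B \<in> sets punctured_borel"
  using measurable_sets[OF recip_measurable, of B]
  by (simp add: vimage_def Int_def space_punctured_borel recip_set_def conj_commute)

lemma emeasure_reciprocal_measure:
  assumes \<nu>: "symmetric_levy_measure \<nu>" and B: "B \<in> sets \<nu>"
  shows "emeasure (reciprocal_measure \<nu>) (recip_set B) = emeasure \<nu> B"
proof -
  note s = levy_sets[OF \<nu>]
  have "emeasure (reciprocal_measure \<nu>) (recip_set B) = emeasure \<nu> ((\<lambda>x. 1 / x) -` recip_set B \<inter> space \<nu>)"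
    unfolding reciprocal_measure_def
    using B by (intro emeasure_distr) (simp_all add: s recip_set_sets recip_measurable measurable_cong_sets[OF s refl])
  also have "(\<lambda>x. 1 / x) -` recip_set B \<inter> space \<nu> = B"
    using sets.sets_into_space[OF B] by (auto simp: recip_set_def levy_space[OF \<nu>])
  finally show ?thesis .
qed

text \<open>The entries 0, \<open>\<infinity>\<close> and \<open>- \<infinity>\<close> are all turned into 0, and neither they nor 0 are points of the
  punctured line.\<close>

lemma point_count_reciprocal:
  assumes "0 \<notin> B"
  shows "point_count (\<lambda>k. ereal (real_of_ereal (1 / x k))) B = point_count x (recip_set B)"
proof -
  have "ereal (real_of_ereal (1 / y)) \<in> ereal ` B \<longleftrightarrow> y \<in> ereal ` recip_set B" for y :: ereal
  proof (cases y)
    case (real r)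
    show ?thesis
    proof (cases "r = 0")
      case True
      have "1 / y = \<infinity>" using True real by (simp add: divide_ereal_def flip: zero_ereal_def)
      have "real_of_ereal (1 / y) = 0" unfolding \<open>1 / y = \<infinity>\<close> by simp
      moreover have "ereal 0 \<notin> ereal ` B" "y \<notin> ereal ` recip_set B"
        using assms real True by (auto simp: recip_set_def)
      ultimately show ?thesis by (simp only: simp_thms)
    next
      case False
      hence "1 / y = ereal (1 / r)" using real by (simp add: one_ereal_def)
      thus ?thesis using real False by (auto simp: recip_set_def)
    qed
  qed (use assms in \<open>auto simp: recip_set_def\<close>)
  thus ?thesis unfolding point_count_def by simp
qed

lemma poisson_points_reciprocal:
  assumes \<nu>: "symmetric_levy_measure \<nu>" and X: "poisson_points M (reciprocal_measure \<nu>) X"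
  shows "poisson_points M \<nu> (\<lambda>\<omega> k. ereal (real_of_ereal (1 / X \<omega> k)))"
proof -
  have sets: "sets (reciprocal_measure \<nu>) = sets \<nu>"
    using levy_sets[OF \<nu>] by (simp add: reciprocal_measure_def)
  have B0: "0 \<notin> B" if "B \<in> sets \<nu>" for B
    using sets.sets_into_space[OF that] levy_space[OF \<nu>] by auto
  have RB: "recip_set B \<in> sets (reciprocal_measure \<nu>)" if "B \<in> sets \<nu>" for B
    using that recip_set_sets levy_sets[OF \<nu>] sets by simp
  have em: "emeasure (reciprocal_measure \<nu>) (recip_set B) = emeasure \<nu> B" if "B \<in> sets \<nu>" for B
    by (rule emeasure_reciprocal_measure[OF \<nu> that])
  have me: "measure (reciprocal_measure \<nu>) (recip_set B) = measure \<nu> B" if "B \<in> sets \<nu>" for B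
    using em[OF that] by (simp add: measure_def)
  have pc: "point_count (\<lambda>k. ereal (real_of_ereal (1 / X \<omega> k))) B = point_count (X \<omega>) (recip_set B)" if "B \<in> sets \<nu>" for B \<omega>
    by (rule point_count_reciprocal[OF B0[OF that]])
  have X1: "(\<lambda>\<omega>. X \<omega> k) \<in> borel_measurable M" if "k \<ge> 1" for k
    using X that unfolding poisson_points_def by blast
  have X2: "measure M {\<omega>\<in>space M. point_count (X \<omega>) B = of_nat n} = measure (reciprocal_measure \<nu>) B ^ n / fact n * exp (- measure (reciprocal_measure \<nu>) B)"
    if "B \<in> sets (reciprocal_measure \<nu>)" "emeasure (reciprocal_measure \<nu>) B < \<infinity>" for B n
    using X that unfolding poisson_points_def by blast
  have X3: "AE \<omega> in M. point_count (X \<omega>) B = \<infinity>"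
    if "B \<in> sets (reciprocal_measure \<nu>)" "emeasure (reciprocal_measure \<nu>) B = \<infinity>" for B
    using X that unfolding poisson_points_def by blast
  have X4: "prob_space.indep_vars M (\<lambda>_. borel) (\<lambda>i \<omega>. point_count (X \<omega>) (B i)) UNIV"
    if "range B \<subseteq> sets (reciprocal_measure \<nu>)" "disjoint_family B" for B :: "nat \<Rightarrow> real set"
    using X that unfolding poisson_points_def by blast
  show ?thesis
    unfolding poisson_points_def
  proof (intro conjI allI impI ballI)
    fix k :: nat assume "1 \<le> k"
    note [measurable] = X1[OF this]
    show "(\<lambda>\<omega>. ereal (real_of_ereal (1 / X \<omega> k))) \<in> borel_measurable M" by measurable
  next
    fix B n assume B: "B \<in> sets \<nu>" "emeasure \<nu> B < \<infinity>"
    show "measure M {\<omega>\<in>space M. point_count (\<lambda>k. ereal (real_of_ereal (1 / X \<omega> k))) B = of_nat n}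
      = measure \<nu> B ^ n / fact n * exp (- measure \<nu> B)"
      unfolding pc[OF B(1)] me[OF B(1), symmetric] by (rule X2) (use RB em B in auto)
  next
    fix B assume B: "B \<in> sets \<nu>" "emeasure \<nu> B = \<infinity>"
    show "AE \<omega> in M. point_count (\<lambda>k. ereal (real_of_ereal (1 / X \<omega> k))) B = \<infinity>"
      unfolding pc[OF B(1)] by (rule X3) (use RB em B in auto)
  next
    fix B :: "nat \<Rightarrow> real set" assume B: "range B \<subseteq> sets \<nu> \<and> disjoint_family B"
    have "disjoint_family (\<lambda>i. recip_set (B i))"
      using B by (fastforce simp: disjoint_family_on_def recip_set_def)
    moreover have "range (\<lambda>i. recip_set (B i)) \<subseteq> sets (reciprocal_measure \<nu>)" using B RB by auto
    ultimately have "prob_space.indep_vars M (\<lambda>_. borel) (\<lambda>i \<omega>. point_count (X \<omega>) (recip_set (B i))) UNIV"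
      by (intro X4)
    moreover have "point_count (\<lambda>k. ereal (real_of_ereal (1 / X \<omega> k))) (B i) = point_count (X \<omega>) (recip_set (B i))" for i \<omega>
      using B by (intro pc) auto
    ultimately show "prob_space.indep_vars M (\<lambda>_. borel) (\<lambda>i \<omega>. point_count (\<lambda>k. ereal (real_of_ereal (1 / X \<omega> k))) (B i)) UNIV"
      by simp
  qed
qed

lemma abs_reciprocal_antimono:
  fixes x y :: ereal
  assumes "x \<notin> {0, - \<infinity>}" "y \<notin> {0, - \<infinity>}" "\<bar>x\<bar> \<le> \<bar>y\<bar>"
  shows "\<bar>real_of_ereal (1 / y)\<bar> \<le> \<bar>real_of_ereal (1 / x)\<bar>"
proof (cases y)
  case (real b)
  then obtain a where a: "x = ereal a" using assms by (cases x) auto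
  have ab: "a \<noteq> 0" "b \<noteq> 0" "\<bar>a\<bar> \<le> \<bar>b\<bar>" using assms a real by auto
  hence "1 / y = ereal (1 / b)" "1 / x = ereal (1 / a)" using a real by (simp_all add: one_ereal_def)
  thus ?thesis using ab by (simp add: frac_le abs_divide)
qed (use assms in \<open>auto simp: real_of_ereal_pos\<close>)

section \<open>The recursive distributional equation\<close>

definition edge_weight :: "('a \<Rightarrow> nat list \<Rightarrow> nat list \<Rightarrow> ereal) \<Rightarrow> nat list \<Rightarrow> 'a \<Rightarrow> nat \<Rightarrow> real" where
  "edge_weight W v \<omega> k = real_of_ereal (1 / W \<omega> v (v @ [k]))"

text \<open>Unlike the labelled weights, these values are functions of the counts by definition.\<close>

definition sorted_weight :: "real \<Rightarrow> ('a \<Rightarrow> nat list \<Rightarrow> nat list \<Rightarrow> ereal) \<Rightarrow> nat list \<Rightarrow> 'a \<Rightarrow> nat \<Rightarrow> real" where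
  "sorted_weight \<sigma> W v \<omega> = rearrange \<sigma> (tail_counts (\<lambda>k. \<bar>edge_weight W v \<omega> k\<bar>))"

locale poisson_tree = prob_space M for M :: "'a measure" +
  fixes \<sigma> :: real and \<nu> :: "real measure" and W :: "'a \<Rightarrow> nat list \<Rightarrow> nat list \<Rightarrow> ereal" and z :: complex
  assumes \<sigma>: "\<sigma> \<ge> 0" and \<nu>: "symmetric_levy_measure \<nu>"
    and pwist: "pwist M \<sigma> (reciprocal_measure \<nu>) W" and z: "Im z > 0"
begin

abbreviation "seq_space \<equiv> PiM UNIV (\<lambda>_. borel) :: (nat \<Rightarrow> real) measure"
abbreviation "Z \<equiv> sorted_weight \<sigma> W"
abbreviation "\<rho> \<equiv> distr M borel (root_resolvent W z)"

lemma W_sym: "\<omega> \<in> space M \<Longrightarrow> W \<omega> u v = W \<omega> v u"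
  and W_zero: "\<omega> \<in> space M \<Longrightarrow> W \<omega> v (v @ [0]) = 1 / ereal \<sigma>"
  and W_poisson: "poisson_points M (reciprocal_measure \<nu>) (\<lambda>\<omega> k. W \<omega> v (v @ [k]))"
  and W_sorted: "AE \<omega> in M. \<forall>k\<ge>1. W \<omega> v (v @ [k]) \<notin> {0, - \<infinity>} \<and> \<bar>W \<omega> v (v @ [k])\<bar> \<le> \<bar>W \<omega> v (v @ [Suc k])\<bar>"
  and W_indep: "indep_vars (\<lambda>_. PiM (sets (reciprocal_measure \<nu>)) (\<lambda>_. borel))
       (\<lambda>v \<omega>. \<lambda>B\<in>sets (reciprocal_measure \<nu>). point_count (\<lambda>k. W \<omega> v (v @ [k])) B) UNIV"
  using pwist unfolding pwist_def by blast+

lemma edge_weight_zero: "\<omega> \<in> space M \<Longrightarrow> edge_weight W v \<omega> 0 = \<sigma>"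
proof -
  assume "\<omega> \<in> space M"
  hence "edge_weight W v \<omega> 0 = real_of_ereal (1 / (1 / ereal \<sigma>))" by (simp add: edge_weight_def W_zero)
  also have "\<dots> = \<sigma>"
    by (cases "\<sigma> = 0") (simp_all add: divide_ereal_def one_ereal_def flip: zero_ereal_def)
  finally show ?thesis .
qed

lemma edge_weight_poisson: "poisson_points M \<nu> (\<lambda>\<omega> k. ereal (edge_weight W v \<omega> k))"
  unfolding edge_weight_def by (rule poisson_points_reciprocal[OF \<nu> W_poisson])

lemma edge_weight_measurable: "(\<lambda>\<omega>. edge_weight W v \<omega> k) \<in> borel_measurable M"
proof (cases "k = 0")
  case True
  have "(\<lambda>\<omega>. edge_weight W v \<omega> k) \<in> borel_measurable M \<longleftrightarrow> (\<lambda>\<omega>. \<sigma>) \<in> borel_measurable M"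
    unfolding True by (rule measurable_cong) (rule edge_weight_zero)
  thus ?thesis by (rule iffD2) (rule borel_measurable_const)
next
  case False
  hence "1 \<le> k" by simp
  from poisson_points_real_measurable[where C = "edge_weight W v", OF edge_weight_poisson this] show ?thesis .
qed

lemma root_resolvent_eq: "\<omega> \<in> space M \<Longrightarrow> root_resolvent W z' \<omega> = tree_resolvent z' (\<lambda>v k. edge_weight W v \<omega> k)"
  unfolding edge_weight_def by (rule root_resolvent_eq_tree_resolvent) (rule W_sym)

lemma root_resolvent_measurable: "root_resolvent W z \<in> borel_measurable M"
proof -
  have "(\<lambda>\<omega> v k. edge_weight W v \<omega> k) \<in> measurable M weight_space"
    unfolding weight_space_def
    by (intro measurable_PiM_UNIV_single edge_weight_measurable)
  hence "(\<lambda>\<omega>. tree_resolvent z (\<lambda>v k. edge_weight W v \<omega> k)) \<in> borel_measurable M"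
    by (rule measurable_compose[OF _ measurable_tree_resolvent[OF z]])
  thus ?thesis by (subst measurable_cong[OF root_resolvent_eq])
qed

text \<open>The edges are listed by increasing absolute value, so the absolute conductances already decrease.\<close>

lemma sorted_weight_AE: "AE \<omega> in M. \<forall>v k. Z v \<omega> k = \<bar>edge_weight W v \<omega> k\<bar>"
proof -
  have "AE \<omega> in M. \<forall>v. \<forall>k\<ge>1. W \<omega> v (v @ [k]) \<notin> {0, - \<infinity>} \<and> \<bar>W \<omega> v (v @ [k])\<bar> \<le> \<bar>W \<omega> v (v @ [Suc k])\<bar>"
    using W_sorted by (simp add: AE_all_countable)
  thus ?thesis using AE_space
  proof eventually_elim
    case (elim \<omega>)
    show ?case
    proof (intro allI)
      fix v k
      show "Z v \<omega> k = \<bar>edge_weight W v \<omega> k\<bar>"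
      proof (cases "k = 0")
        case True
        thus ?thesis using edge_weight_zero[OF elim(2), of v] \<sigma> by (simp add: sorted_weight_def rearrange_def)
      next
        case False
        have "\<bar>edge_weight W v \<omega> (Suc j)\<bar> \<le> \<bar>edge_weight W v \<omega> j\<bar>" if "j \<ge> 1" for j
          unfolding edge_weight_def using elim(1)[rule_format, of j v] elim(1)[rule_format, of "Suc j" v] that
          by (intro abs_reciprocal_antimono) auto
        thus ?thesis unfolding sorted_weight_def using False by (intro rearrange_decreasing) auto
      qed
    qed
  qed
qed

lemma sorted_weight_zero: "Z v \<omega> 0 = \<sigma>"
  by (simp add: sorted_weight_def rearrange_def)

lemma sorted_weight_nonneg: "Z v \<omega> k \<ge> 0"
  using \<sigma> rearrange_nonneg[of k] by (cases "k = 0") (auto simp: sorted_weight_def rearrange_def[of _ _ 0])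

text \<open>The rearranged weights are functions of the counts, so they inherit the independence over the
  vertices, whereas the signs of the weights need not be independent.\<close>

lemma sorted_weight_indep: "indep_vars (\<lambda>_. seq_space) Z UNIV"
proof -
  let ?S = "sets (reciprocal_measure \<nu>)"
  define T where "T t = recip_set {x. \<bar>x\<bar> \<in> {t..}}" for t
  have sets: "?S = sets \<nu>" using levy_sets[OF \<nu>] by (simp add: reciprocal_measure_def)
  have T: "T t \<in> ?S" if "t \<in> pos_rats" for t
  proof -
    have "{x. \<bar>x\<bar> \<in> {t..}} \<in> sets \<nu>"
      using that by (intro levy_abs_set[OF \<nu>]) (auto simp: pos_rats_def)
    thus ?thesis unfolding T_def sets using recip_set_sets by (simp add: levy_sets[OF \<nu>])
  qed
  have "(\<lambda>p. \<lambda>t\<in>pos_rats. p (T t)) \<in> measurable (PiM ?S (\<lambda>_. borel :: ennreal measure)) (PiM pos_rats (\<lambda>_. borel))"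
    by (intro measurable_restrict measurable_component_singleton T)
  from measurable_compose[OF this rearrange_measurable[of \<sigma>]]
  have "(\<lambda>p. rearrange \<sigma> (\<lambda>t\<in>pos_rats. p (T t))) \<in> measurable (PiM ?S (\<lambda>_. borel :: ennreal measure)) seq_space" .
  from indep_vars_compose2[OF W_indep this]
  have "indep_vars (\<lambda>_. seq_space) (\<lambda>v \<omega>. rearrange \<sigma> (\<lambda>t\<in>pos_rats. (\<lambda>B\<in>?S. point_count (\<lambda>k. W \<omega> v (v @ [k])) B) (T t))) UNIV" .
  moreover have "(\<lambda>t\<in>pos_rats. (\<lambda>B\<in>?S. point_count (\<lambda>k. W \<omega> v (v @ [k])) B) (T t)) = tail_counts (\<lambda>k. \<bar>edge_weight W v \<omega> k\<bar>)" for v \<omega>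
    unfolding tail_counts_def
  proof (rule restrict_ext)
    fix t assume t: "t \<in> pos_rats"
    have "weight_count (\<lambda>k. \<bar>edge_weight W v \<omega> k\<bar>) {t..} = point_count (\<lambda>k. W \<omega> v (v @ [k])) (T t)"
      unfolding weight_count_eq_point_count T_def edge_weight_def
      by (rule point_count_reciprocal) (use t in \<open>auto simp: pos_rats_def\<close>)
    thus "(\<lambda>B\<in>?S. point_count (\<lambda>k. W \<omega> v (v @ [k])) B) (T t) = weight_count (\<lambda>k. \<bar>edge_weight W v \<omega> k\<bar>) {t..}"
      using T[OF t] by simp
  qed
  ultimately show ?thesis unfolding sorted_weight_def[abs_def] by simp
qed

lemma sorted_weight_measurable: "Z v \<in> measurable M seq_space"
  using sorted_weight_indep unfolding indep_vars_def2 by blast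

lemma sorted_weight_law: "distr M seq_space (Z v) = distr M seq_space (Z u)"
proof -
  have "distr M seq_space (Z v) = distr (distr M (PiM pos_rats (\<lambda>_. borel)) (\<lambda>\<omega>. tail_counts (\<lambda>k. \<bar>edge_weight W v \<omega> k\<bar>))) seq_space (rearrange \<sigma>)" for v
    unfolding sorted_weight_def[abs_def]
    by (subst distr_distr[OF rearrange_measurable tail_counts_measurable[OF edge_weight_poisson]]) (simp add: o_def)
  moreover have "distr M (PiM pos_rats (\<lambda>_. borel)) (\<lambda>\<omega>. tail_counts (\<lambda>k. \<bar>edge_weight W v \<omega> k\<bar>))
      = distr M (PiM pos_rats (\<lambda>_. borel)) (\<lambda>\<omega>. tail_counts (\<lambda>k. \<bar>edge_weight W u \<omega> k\<bar>))"
    by (intro tail_counts_law[OF \<nu>] prob_space_axioms edge_weight_poisson)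
  ultimately show ?thesis by simp
qed

lemma sorted_tree_measurable: "(\<lambda>\<omega> v. Z (f v) \<omega>) \<in> measurable M weight_space"
  unfolding weight_space_def
  by (rule measurable_PiM_UNIV_single) (rule sorted_weight_measurable)

text \<open>For \<open>f = Cons k\<close> this says that a subtree has the same law as the whole tree.\<close>

lemma sorted_tree_law:
  assumes "inj f"
  shows "distr M weight_space (\<lambda>\<omega> v. Z (f v) \<omega>) = distr M weight_space (\<lambda>\<omega> v. Z v \<omega>)"
proof -
  have *: "distr M weight_space (\<lambda>\<omega> v. Z (f v) \<omega>) = PiM UNIV (\<lambda>_. distr M seq_space (Z []))" if "inj f" for f :: "nat list \<Rightarrow> nat list"
  proof -
    let ?L = "distr M seq_space (Z [])"
    have L: "prob_space ?L" by (rule prob_space_distr[OF sorted_weight_measurable])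
    have L_eq: "distr M seq_space (Z v) = ?L" for v by (rule sorted_weight_law)
    have "distr M (PiM UNIV (\<lambda>_. seq_space)) (\<lambda>\<omega>. \<lambda>v\<in>UNIV. Z v \<omega>) = PiM UNIV (\<lambda>v. distr M seq_space (Z v))"
      by (rule indep_vars_iff_distr_eq_PiM'[THEN iffD1, OF UNIV_not_empty sorted_weight_measurable sorted_weight_indep])
    also have "(\<lambda>v. distr M seq_space (Z v)) = (\<lambda>_. ?L)" by (rule ext) (rule L_eq)
    finally have all: "distr M (PiM UNIV (\<lambda>_. seq_space)) (\<lambda>\<omega>. \<lambda>v\<in>UNIV. Z v \<omega>) = PiM UNIV (\<lambda>_. ?L)" .
    have "distr (PiM UNIV (\<lambda>_. ?L)) (PiM UNIV (\<lambda>_. ?L)) (\<lambda>x. \<lambda>v\<in>UNIV. x (f v)) = PiM UNIV (\<lambda>_. ?L)"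
      using distr_PiM_reindex[of UNIV "\<lambda>_. ?L" f UNIV] L that by simp
    moreover have "distr (PiM UNIV (\<lambda>_. ?L)) (PiM UNIV (\<lambda>_. ?L)) (\<lambda>x. \<lambda>v\<in>UNIV. x (f v))
        = distr (PiM UNIV (\<lambda>_. ?L)) weight_space (\<lambda>x. \<lambda>v\<in>UNIV. x (f v))"
      unfolding weight_space_def by (intro distr_cong sets_PiM_cong refl) simp
    moreover have "distr (PiM UNIV (\<lambda>_. ?L)) weight_space (\<lambda>x. \<lambda>v\<in>UNIV. x (f v)) = distr M weight_space (\<lambda>\<omega> v. Z (f v) \<omega>)"
    proof -
      have "(\<lambda>x. \<lambda>v\<in>UNIV. x (f v)) \<in> measurable (PiM UNIV (\<lambda>_. seq_space)) weight_space"
        unfolding weight_space_def by (intro measurable_restrict measurable_component_singleton) simp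
      moreover have "(\<lambda>\<omega>. \<lambda>v\<in>UNIV. Z v \<omega>) \<in> measurable M (PiM UNIV (\<lambda>_. seq_space))"
        by (intro measurable_restrict sorted_weight_measurable)
      ultimately show ?thesis unfolding all[symmetric] by (subst distr_distr) (auto simp: o_def restrict_UNIV)
    qed
    ultimately show ?thesis by simp
  qed
  show ?thesis using *[OF assms] *[of "\<lambda>v. v"] by simp
qed

lemma root_resolvent_AE: "AE \<omega> in M. root_resolvent W z \<omega> = tree_resolvent z (\<lambda>v. Z v \<omega>)"
  using sorted_weight_AE AE_space
proof eventually_elim
  case (elim \<omega>)
  hence "tree_resolvent z (\<lambda>v. Z v \<omega>) = tree_resolvent z (\<lambda>v k. \<bar>edge_weight W v \<omega> k\<bar>)"
    by (intro arg_cong[where f = "tree_resolvent z"]) (simp add: fun_eq_iff)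
  thus ?case using elim by (simp add: tree_resolvent_abs root_resolvent_eq)
qed

lemma finite_heavy_paths:
  assumes K: "K > 0" "levy_mass \<nu> {K<..} \<le> 1 / 4"
  shows "AE \<omega> in M. \<forall>v. finite {w. kept_path (\<lambda>v. heavy_points \<nu> K (Z v \<omega>)) v w}"
proof -
  define H where "H k = {x \<in> space seq_space. k \<in> heavy_points \<nu> K x}" for k
  have H: "H k \<in> sets seq_space" for k unfolding H_def by (rule heavy_points_measurable)
  have H_iff: "{k. x \<in> H k} = heavy_points \<nu> K x" for x by (auto simp: H_def space_PiM)
  have "(\<integral>\<^sup>+\<omega>. emeasure (count_space UNIV) {k. Z v \<omega> \<in> H k} \<partial>M) \<le> ennreal (1 / 2)" for v
  proof -
    have "(\<integral>\<^sup>+\<omega>. emeasure (count_space UNIV) {k. Z v \<omega> \<in> H k} \<partial>M)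
        = (\<integral>\<^sup>+\<omega>. emeasure (count_space UNIV) (heavy_points \<nu> K (\<lambda>k. \<bar>edge_weight W v \<omega> k\<bar>)) \<partial>M)"
    proof (rule nn_integral_cong_AE)
      show "AE \<omega> in M. emeasure (count_space UNIV) {k. Z v \<omega> \<in> H k}
          = emeasure (count_space UNIV) (heavy_points \<nu> K (\<lambda>k. \<bar>edge_weight W v \<omega> k\<bar>))"
        using sorted_weight_AE
      proof eventually_elim
        case (elim \<omega>)
        hence "Z v \<omega> = (\<lambda>k. \<bar>edge_weight W v \<omega> k\<bar>)" by (simp add: fun_eq_iff)
        thus ?case by (simp only: H_iff)
      qed
    qed
    also have "\<dots> \<le> ennreal (1 / 2)"
      by (rule heavy_points_mean[OF \<nu> prob_space_axioms edge_weight_poisson K])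
    finally show ?thesis .
  qed
  from AE_finite_kept_paths[OF sorted_weight_indep H this] show ?thesis by (simp only: H_iff)
qed

text \<open>Almost surely the recursion holds at the root. The root resolvents \<open>Rk k\<close> of the subtrees are
  functions of disjoint families of vertices, hence independent of each other and of the weights at
  the root.\<close>

lemma root_resolvent_law:
  assumes B: "B \<in> sets borel"
  shows "emeasure \<rho> B = (\<integral>\<^sup>+x. emeasure (PiM UNIV (\<lambda>_. \<rho>)) (schur_map z x -` B) \<partial>distr M seq_space (Z []))"
proof -
  define Rk where "Rk k \<omega> = tree_resolvent z (\<lambda>v. Z (k # v) \<omega>)" for k \<omega>
  note tm = measurable_tree_resolvent[OF z]
  have \<rho>_eq: "\<rho> = distr M borel (\<lambda>\<omega>. tree_resolvent z (\<lambda>v. Z v \<omega>))"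
    by (rule distr_cong_AE[OF refl refl root_resolvent_AE root_resolvent_measurable])
      (rule measurable_compose[OF sorted_tree_measurable[of "\<lambda>v. v"] tm])
  have Rk_law: "distr M borel (Rk k) = \<rho>" for k
  proof -
    have "distr M borel (Rk k) = distr (distr M weight_space (\<lambda>\<omega> v. Z (k # v) \<omega>)) borel (tree_resolvent z)"
      unfolding Rk_def by (subst distr_distr[OF tm sorted_tree_measurable]) (simp add: o_def)
    also have "\<dots> = distr (distr M weight_space (\<lambda>\<omega> v. Z v \<omega>)) borel (tree_resolvent z)"
      by (subst sorted_tree_law) auto
    also have "\<dots> = \<rho>"
      unfolding \<rho>_eq by (subst distr_distr[OF tm sorted_tree_measurable[of "\<lambda>v. v"]]) (simp add: o_def)
    finally show ?thesis .
  qed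
  have sub: "(\<lambda>x. tree_resolvent z (\<lambda>v. x (k # v))) \<in> borel_measurable (PiM A (\<lambda>_. seq_space))"
    if "\<And>v. k # v \<in> A" for k and A :: "nat list set"
  proof -
    have "(\<lambda>x v. x (k # v)) \<in> measurable (PiM A (\<lambda>_. seq_space)) weight_space"
      unfolding weight_space_def
      by (rule measurable_PiM_UNIV_single) (rule measurable_component_singleton, rule that)
    thus ?thesis by (rule measurable_compose[OF _ tm])
  qed
  have Rk_indep: "indep_vars (\<lambda>_. borel) Rk UNIV"
  proof -
    have "indep_vars (\<lambda>k. PiM (range (Cons k)) (\<lambda>_. seq_space)) (\<lambda>k \<omega>. restrict (\<lambda>v. Z v \<omega>) (range (Cons k))) UNIV"
      by (rule indep_vars_restrict[OF sorted_weight_indep]) (auto simp: disjoint_family_on_def)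
    from indep_vars_compose2[OF this sub]
    have "indep_vars (\<lambda>_. borel) (\<lambda>k \<omega>. tree_resolvent z (\<lambda>v. restrict (\<lambda>v. Z v \<omega>) (range (Cons k)) (k # v))) UNIV" by simp
    thus ?thesis by (simp add: Rk_def[abs_def])
  qed
  let ?Q = "PiM UNIV (\<lambda>_. borel) :: (nat \<Rightarrow> complex) measure"
  have joint: "distr M (?Q \<Otimes>\<^sub>M seq_space) (\<lambda>\<omega>. (\<lambda>k\<in>UNIV. Rk k \<omega>, Z [] \<omega>))
      = distr M ?Q (\<lambda>\<omega>. \<lambda>k\<in>UNIV. Rk k \<omega>) \<Otimes>\<^sub>M distr M seq_space (Z [])"
  proof -
    let ?A = "- {[]} :: nat list set"
    let ?P = "PiM ?A (\<lambda>_. seq_space)" and ?E = "PiM {[]} (\<lambda>_ :: nat list. seq_space)"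
    let ?X = "\<lambda>\<omega>. restrict (\<lambda>v. Z v \<omega>) ?A" and ?Y = "\<lambda>\<omega>. restrict (\<lambda>v. Z v \<omega>) {[]}"
    let ?f = "\<lambda>x. \<lambda>k\<in>UNIV. tree_resolvent z (\<lambda>v. x (k # v))"
    have f: "?f \<in> measurable ?P ?Q" 
    proof (rule measurable_restrict)
      fix k :: nat
      have mem: "k # v \<in> ?A" for v by simp
      show "(\<lambda>x. tree_resolvent z (\<lambda>v. x (k # v))) \<in> borel_measurable ?P" by (rule sub[OF mem])
    qed
    have indep: "indep_var ?P ?X ?E ?Y"
      by (rule indep_var_restrict[OF sorted_weight_indep]) simp_all
    have g: "(\<lambda>x. x []) \<in> measurable ?E seq_space" by (rule measurable_component_singleton) simp
    have rvX: "?X \<in> measurable M ?P" and rvY: "?Y \<in> measurable M ?E"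
      by (intro measurable_restrict sorted_weight_measurable)+
    from indep_var_joint_distr[OF indep g]
    have j: "distr M (?P \<Otimes>\<^sub>M seq_space) (\<lambda>\<omega>. (?X \<omega>, Z [] \<omega>)) = distr M ?P ?X \<Otimes>\<^sub>M distr M seq_space (Z [])"
      by simp
    interpret D: prob_space "distr M seq_space (Z [])" by (rule prob_space_distr[OF sorted_weight_measurable])
    have "distr M ?Q (\<lambda>\<omega>. \<lambda>k\<in>UNIV. Rk k \<omega>) = distr (distr M ?P ?X) ?Q ?f"
      by (subst distr_distr[OF f rvX]) (simp add: o_def Rk_def)
    moreover have "distr M seq_space (Z []) = distr (distr M seq_space (Z [])) seq_space (\<lambda>x. x)"
      by (simp add: distr_id2)
    moreover have "distr (distr M ?P ?X) ?Q ?f \<Otimes>\<^sub>M distr (distr M seq_space (Z [])) seq_space (\<lambda>x. x)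
      = distr (distr M ?P ?X \<Otimes>\<^sub>M distr M seq_space (Z [])) (?Q \<Otimes>\<^sub>M seq_space) (\<lambda>(x, y). (?f x, y))"
    proof (rule pair_measure_distr)
      show "?f \<in> measurable (distr M ?P ?X) ?Q" by (subst measurable_distr_eq1) (rule f)
      show "(\<lambda>x. x) \<in> measurable (distr M seq_space (Z [])) seq_space" by (rule measurable_ident_sets) (rule sets_distr)
      show "sigma_finite_measure (distr (distr M seq_space (Z [])) seq_space (\<lambda>x. x))"
        using D.sigma_finite_measure_axioms by (simp add: distr_id2)
    qed
    moreover have "distr (distr M ?P ?X \<Otimes>\<^sub>M distr M seq_space (Z [])) (?Q \<Otimes>\<^sub>M seq_space) (\<lambda>(x, y). (?f x, y))
      = distr M (?Q \<Otimes>\<^sub>M seq_space) (\<lambda>\<omega>. (\<lambda>k\<in>UNIV. Rk k \<omega>, Z [] \<omega>))"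
    proof -
      have "(\<lambda>p. (?f (fst p), snd p)) \<in> measurable (?P \<Otimes>\<^sub>M seq_space) (?Q \<Otimes>\<^sub>M seq_space)"
        by (rule measurable_Pair[OF measurable_compose[OF measurable_fst f] measurable_snd])
      hence "(\<lambda>(x, y). (?f x, y)) \<in> measurable (?P \<Otimes>\<^sub>M seq_space) (?Q \<Otimes>\<^sub>M seq_space)"
        by (simp only: split_beta')
      from distr_distr[OF this measurable_Pair[OF rvX sorted_weight_measurable]]
      show ?thesis unfolding j[symmetric] by (simp add: o_def Rk_def)
    qed
    ultimately show ?thesis by simp
  qed
  obtain K where K: "K > 0" "levy_mass \<nu> {K<..} \<le> 1 / 4" using thinning_scale_exists[OF \<nu>] by blast
  have "AE \<omega> in M. root_resolvent W z \<omega> = schur_map z (Z [] \<omega>) (\<lambda>k. Rk k \<omega>)"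
    using root_resolvent_AE finite_heavy_paths[OF K]
  proof eventually_elim
    case (elim \<omega>)
    thus ?case unfolding Rk_def
      using heavy_tree_recursion[OF \<nu> K(1), of "\<lambda>v. Z v \<omega>" \<sigma>, OF sorted_weight_nonneg sorted_weight_zero elim(2)[rule_format] z] by simp
  qed
  moreover have "(\<lambda>\<omega>. schur_map z (Z [] \<omega>) (\<lambda>k. Rk k \<omega>)) \<in> borel_measurable M"
  proof -
    have Rkm: "(\<lambda>\<omega>. \<lambda>k\<in>UNIV. Rk k \<omega>) \<in> measurable M ?Q"
      using Rk_indep unfolding indep_vars_def2 by (intro measurable_restrict) blast
    from measurable_compose[OF measurable_Pair[OF sorted_weight_measurable Rkm] measurable_schur_map]
    show ?thesis by (simp add: restrict_UNIV)
  qed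
  ultimately have "\<rho> = distr M borel (\<lambda>\<omega>. schur_map z (Z [] \<omega>) (\<lambda>k. Rk k \<omega>))"
    by (intro distr_cong_AE root_resolvent_measurable) auto
  hence "emeasure \<rho> B = (\<integral>\<^sup>+\<omega>. emeasure (PiM UNIV (\<lambda>_. \<rho>)) (schur_map z (Z [] \<omega>) -` B) \<partial>M)"
    using schur_map_mixture[OF sorted_weight_measurable joint Rk_indep Rk_law B] by simp
  also have "\<dots> = (\<integral>\<^sup>+x. emeasure (PiM UNIV (\<lambda>_. \<rho>)) (schur_map z x -` B) \<partial>distr M seq_space (Z []))"
  proof (rule nn_integral_distr[OF sorted_weight_measurable, symmetric])
    have "(\<lambda>x. emeasure (PiM UNIV (\<lambda>_. \<rho>)) (schur_map z x -` B)) \<in> borel_measurable seq_space"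
      by (rule measurable_schur_map_prob[OF prob_space_distr[OF root_resolvent_measurable] _ B]) simp
    thus "(\<lambda>x. emeasure (PiM UNIV (\<lambda>_. \<rho>)) (schur_map z x -` B)) \<in> borel_measurable (distr M seq_space (Z []))"
      by (simp only: measurable_distr_eq1)
  qed
  finally show ?thesis .
qed

lemma heavy_points_cong:
  assumes "\<And>k. 1 \<le> k \<Longrightarrow> d k = d' k"
  shows "heavy_points \<nu>' K d = heavy_points \<nu>' K d'"
proof -
  have "weight_count d I = weight_count d' I" for I
    unfolding weight_count_def using assms by (intro arg_cong[where f = "emeasure _"]) auto
  thus ?thesis using assms unfolding heavy_points_def by auto
qed

text \<open>Let \<open>D\<close> be the sequence of the absolute values of the points with \<open>\<sigma>\<close> at index 0. Its decreasing
  rearrangement has the law of the weights at the root of the tree, and the probability that remains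
  after fixing \<open>D\<close> is the same for \<open>D\<close> and its rearrangement.\<close>

proposition recursive_distributional_equation:
  fixes N :: "'b measure" and R :: "nat \<Rightarrow> 'b \<Rightarrow> complex" and C :: "nat \<Rightarrow> 'b \<Rightarrow> real"
  assumes N: "prob_space N"
    and R: "\<And>k. R k \<in> borel_measurable N" "\<And>k. distr N borel (R k) = \<rho>"
    and R_indep: "prob_space.indep_vars N (\<lambda>_. borel) R UNIV"
    and C: "poisson_points N \<nu> (\<lambda>\<omega> k. ereal (C k \<omega>))"
    and indep: "prob_space.indep_var N (PiM UNIV (\<lambda>_. borel)) (\<lambda>\<omega>. \<lambda>k\<in>UNIV. R k \<omega>)
        (PiM {1..} (\<lambda>_. borel)) (\<lambda>\<omega>. \<lambda>k\<in>{1..}. complex_of_real (C k \<omega>))"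
  shows "AE \<omega> in N. (\<lambda>k. complex_of_real (\<bar>C k \<omega>\<bar>\<^sup>2) * R k \<omega>) summable_on {1..}"
    and "\<rho> = distr N borel (\<lambda>\<omega>. - inverse (z + complex_of_real (\<sigma>\<^sup>2) * R 0 \<omega> +
          (\<Sum>\<^sub>\<infinity>k\<in>{1..}. complex_of_real (\<bar>C k \<omega>\<bar>\<^sup>2) * R k \<omega>)))"
proof -
  interpret N: prob_space N by (rule N)
  define \<phi> where "\<phi> x k = (if k = 0 then \<sigma> else \<bar>Re (x k)\<bar>)" for x :: "nat \<Rightarrow> complex" and k
  define D where "D \<omega> = \<phi> (\<lambda>k\<in>{1..}. complex_of_real (C k \<omega>))" for \<omega>
  have D_eq: "D \<omega> k = (if k = 0 then \<sigma> else \<bar>C k \<omega>\<bar>)" for \<omega> k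
    by (simp add: D_def \<phi>_def)
  have D_nonneg: "D \<omega> k \<ge> 0" for \<omega> k using \<sigma> by (simp add: D_eq)
  have \<phi>: "\<phi> \<in> measurable (PiM {1..} (\<lambda>_. borel)) seq_space"
  proof (rule measurable_PiM_UNIV_single)
    fix k
    show "(\<lambda>x. \<phi> x k) \<in> borel_measurable (PiM {1..} (\<lambda>_. borel))"
    proof (cases "k = 0")
      case False
      have "(\<lambda>x. x k) \<in> borel_measurable (PiM {1..} (\<lambda>_. borel :: complex measure))"
        using False by (intro measurable_component_singleton) simp
      hence "(\<lambda>x. \<bar>Re (x k)\<bar>) \<in> borel_measurable (PiM {1..} (\<lambda>_. borel :: complex measure))" by measurable
      thus ?thesis using False by (simp add: \<phi>_def)
    qed (simp add: \<phi>_def)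
  qed
  have D_meas: "D \<in> measurable N seq_space"
    unfolding D_def
    by (rule measurable_compose[OF _ \<phi>]) (use indep in \<open>simp add: N.indep_var_distribution_eq\<close>)
  have joint: "distr N (PiM UNIV (\<lambda>_. borel) \<Otimes>\<^sub>M seq_space) (\<lambda>\<omega>. (\<lambda>k\<in>UNIV. R k \<omega>, D \<omega>))
      = distr N (PiM UNIV (\<lambda>_. borel)) (\<lambda>\<omega>. \<lambda>k\<in>UNIV. R k \<omega>) \<Otimes>\<^sub>M distr N seq_space D"
    unfolding D_def[abs_def] by (rule N.indep_var_joint_distr[OF indep \<phi>])

  have finite_counts: "AE \<omega> in N. \<forall>t>0. finite {i. 1 \<le> i \<and> D \<omega> i \<in> {t..}}"
  proof -
    have "AE \<omega> in N. \<exists>m::nat. weight_count (\<lambda>k. \<bar>C k \<omega>\<bar>) {1 / Suc n..} = of_nat m" for n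
    proof (rule N.AE_poisson_finite)
      show "(\<lambda>\<omega>. weight_count (\<lambda>k. \<bar>C k \<omega>\<bar>) {1 / Suc n..}) \<in> borel_measurable N"
        by (rule poisson_weight_count_measurable[OF C]) simp
      show "levy_mass \<nu> {1 / Suc n..} \<ge> 0" by (simp add: levy_mass_def)
      show "N.prob {\<omega>\<in>space N. weight_count (\<lambda>k. \<bar>C k \<omega>\<bar>) {1 / Suc n..} = of_nat m}
          = levy_mass \<nu> {1 / Suc n..} ^ m / fact m * exp (- levy_mass \<nu> {1 / Suc n..})" for m
        by (rule poisson_weight_count[OF \<nu> C, of _ "1 / Suc n"]) simp_all
    qed
    hence "AE \<omega> in N. \<forall>n. \<exists>m::nat. weight_count (\<lambda>k. \<bar>C k \<omega>\<bar>) {1 / Suc n..} = of_nat m"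
      by (simp add: AE_all_countable)
    thus ?thesis
    proof eventually_elim
      case (elim \<omega>)
      show ?case
      proof (intro allI impI)
        fix t :: real assume "t > 0"
        then obtain n where n: "1 / Suc n < t" using nat_approx_posE by blast
        obtain m :: nat where "weight_count (\<lambda>k. \<bar>C k \<omega>\<bar>) {1 / Suc n..} = of_nat m" using elim by blast
        hence "emeasure (count_space UNIV) {k. 1 \<le> k \<and> \<bar>C k \<omega>\<bar> \<in> {1 / Suc n..}} \<noteq> \<infinity>"
          by (simp add: weight_count_def)
        hence "finite {k. 1 \<le> k \<and> \<bar>C k \<omega>\<bar> \<in> {1 / Suc n..}}"
          by (metis emeasure_count_space_infinite top_greatest subset_UNIV infinity_ennreal_def)
        thus "finite {i. 1 \<le> i \<and> D \<omega> i \<in> {t..}}"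
          by (rule rev_finite_subset) (use n in \<open>auto simp: D_eq\<close>)
      qed
    qed
  qed

  obtain K where K: "K > 0" "levy_mass \<nu> {K<..} \<le> 1 / 4" using thinning_scale_exists[OF \<nu>] by blast
  have D_summable: "AE \<omega> in N. (\<lambda>k. (D \<omega> k)\<^sup>2) summable_on UNIV"
  proof -
    have heavy: "heavy_points \<nu> K (\<lambda>k. \<bar>C k \<omega>\<bar>) = heavy_points \<nu> K (D \<omega>)" for \<omega>
      by (rule heavy_points_cong) (simp add: D_eq)
    have H: "{\<omega>\<in>space N. k \<in> heavy_points \<nu> K (D \<omega>)} \<in> sets N" for k
      using measurable_sets[OF D_meas heavy_points_measurable[of k \<nu> K]]
      by (simp add: vimage_def Int_def space_PiM conj_commute)
    have "emeasure (count_space UNIV) (heavy_points \<nu> K (D \<omega>)) = (\<Sum>k. indicator {\<omega>\<in>space N. k \<in> heavy_points \<nu> K (D \<omega>)} \<omega>)"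
      if "\<omega> \<in> space N" for \<omega>
    proof -
      have "emeasure (count_space UNIV) (heavy_points \<nu> K (D \<omega>)) = (\<integral>\<^sup>+k. indicator (heavy_points \<nu> K (D \<omega>)) k \<partial>count_space UNIV)"
        by simp
      also have "\<dots> = (\<Sum>k. indicator (heavy_points \<nu> K (D \<omega>)) k)" by (rule nn_integral_count_space_nat)
      finally show ?thesis using that by (simp add: indicator_def)
    qed
    moreover have "(\<lambda>\<omega>. \<Sum>k. indicator {\<omega>\<in>space N. k \<in> heavy_points \<nu> K (D \<omega>)} \<omega> :: ennreal) \<in> borel_measurable N"
      by (intro borel_measurable_suminf_order borel_measurable_indicator H)
    ultimately have "(\<lambda>\<omega>. emeasure (count_space UNIV) (heavy_points \<nu> K (D \<omega>))) \<in> borel_measurable N"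
      by (subst measurable_cong) auto
    moreover have "(\<integral>\<^sup>+\<omega>. emeasure (count_space UNIV) (heavy_points \<nu> K (D \<omega>)) \<partial>N) \<le> ennreal (1 / 2)"
      using heavy_points_mean[OF \<nu> N C K] by (simp add: heavy)
    hence "(\<integral>\<^sup>+\<omega>. emeasure (count_space UNIV) (heavy_points \<nu> K (D \<omega>)) \<partial>N) \<noteq> \<infinity>"
      by (metis ennreal_less_top infinity_ennreal_def leD)
    ultimately have "AE \<omega> in N. emeasure (count_space UNIV) (heavy_points \<nu> K (D \<omega>)) \<noteq> \<infinity>"
      by (rule nn_integral_PInf_AE)
    thus ?thesis
    proof eventually_elim
      case (elim \<omega>)
      hence "finite (heavy_points \<nu> K (D \<omega>))"
        by (metis emeasure_count_space_infinite top_greatest subset_UNIV infinity_ennreal_def)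
      thus ?case by (rule summable_of_finite_heavy_points[OF \<nu> K(1) D_nonneg])
    qed
  qed
  have R_bound: "AE \<omega> in N. \<forall>k. cmod (R k \<omega>) \<le> 1 / Im z"
  proof -
    have bound_set: "{x \<in> space borel. cmod x \<le> 1 / Im z} \<in> sets borel" by measurable
    have "AE \<omega> in M. cmod (root_resolvent W z \<omega>) \<le> 1 / Im z"
      by (rule AE_I2) (simp add: root_resolvent_eq cmod_tree_resolvent_le z)
    hence "AE x in \<rho>. cmod x \<le> 1 / Im z"
      by (subst AE_distr_iff[OF root_resolvent_measurable bound_set])
    hence "AE \<omega> in N. cmod (R k \<omega>) \<le> 1 / Im z" for k
      unfolding R(2)[of k, symmetric] by (subst (asm) AE_distr_iff[OF R(1) bound_set])
    thus ?thesis by (simp add: AE_all_countable)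
  qed
  have all_summable: "AE \<omega> in N. (\<lambda>k. complex_of_real ((D \<omega> k)\<^sup>2) * R k \<omega>) summable_on UNIV"
    using D_summable R_bound
  proof eventually_elim
    case (elim \<omega>)
    have "(\<lambda>k. (D \<omega> k)\<^sup>2 * (1 / Im z)) summable_on UNIV"
      by (rule summable_on_cmult_left[OF elim(1)])
    thus ?case
    proof (rule abs_summable_summable[OF summable_on_comparison_test])
      fix k
      have "norm (complex_of_real ((D \<omega> k)\<^sup>2) * R k \<omega>) = (D \<omega> k)\<^sup>2 * cmod (R k \<omega>)"
        by (simp add: norm_mult norm_power)
      also have "\<dots> \<le> (D \<omega> k)\<^sup>2 * (1 / Im z)" using elim(2) by (intro mult_left_mono) auto
      finally show "norm (complex_of_real ((D \<omega> k)\<^sup>2) * R k \<omega>) \<le> (D \<omega> k)\<^sup>2 * (1 / Im z)" .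
    qed auto
  qed
  have on_points: "(\<lambda>k. complex_of_real ((D \<omega> k)\<^sup>2) * R k \<omega>) summable_on {1..}
      \<longleftrightarrow> (\<lambda>k. complex_of_real (\<bar>C k \<omega>\<bar>\<^sup>2) * R k \<omega>) summable_on {1..}" for \<omega>
    by (rule summable_on_cong) (simp add: D_eq)
  show summable: "AE \<omega> in N. (\<lambda>k. complex_of_real (\<bar>C k \<omega>\<bar>\<^sup>2) * R k \<omega>) summable_on {1..}"
    using all_summable
  proof eventually_elim
    case (elim \<omega>)
    hence "(\<lambda>k. complex_of_real ((D \<omega> k)\<^sup>2) * R k \<omega>) summable_on {1..}"
      by (rule summable_on_subset_banach) simp
    thus ?case by (simp only: on_points)
  qed

  let ?rhs = "\<lambda>\<omega>. - inverse (z + complex_of_real (\<sigma>\<^sup>2) * R 0 \<omega> +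
          (\<Sum>\<^sub>\<infinity>k\<in>{1..}. complex_of_real (\<bar>C k \<omega>\<bar>\<^sup>2) * R k \<omega>))"
  have rhs_AE: "AE \<omega> in N. schur_map z (D \<omega>) (\<lambda>k. R k \<omega>) = ?rhs \<omega>"
    using summable
  proof eventually_elim
    case (elim \<omega>)
    have "(\<Sum>\<^sub>\<infinity>k. complex_of_real ((D \<omega> k)\<^sup>2) * R k \<omega>)
        = (\<Sum>\<^sub>\<infinity>k\<in>insert 0 {1..}. complex_of_real ((D \<omega> k)\<^sup>2) * R k \<omega>)"
      by (rule infsum_cong_neutral) (auto simp: Suc_le_eq)
    also have "\<dots> = complex_of_real ((D \<omega> 0)\<^sup>2) * R 0 \<omega> + (\<Sum>\<^sub>\<infinity>k\<in>{1..}. complex_of_real ((D \<omega> k)\<^sup>2) * R k \<omega>)"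
      using elim by (intro infsum_insert) (simp_all only: on_points, simp)
    also have "(\<Sum>\<^sub>\<infinity>k\<in>{1..}. complex_of_real ((D \<omega> k)\<^sup>2) * R k \<omega>) = (\<Sum>\<^sub>\<infinity>k\<in>{1..}. complex_of_real (\<bar>C k \<omega>\<bar>\<^sup>2) * R k \<omega>)"
      by (rule infsum_cong) (simp add: D_eq)
    finally show ?case by (simp add: schur_map_def D_eq add.assoc)
  qed
  have C_meas: "C k \<in> borel_measurable N" if "1 \<le> k" for k
    using poisson_points_real_measurable[of N \<nu> "\<lambda>\<omega> k. C k \<omega>", OF C that] .
  have rhs_meas: "?rhs \<in> borel_measurable N"
  proof -
    have "(\<lambda>\<omega>. \<Sum>\<^sub>\<infinity>k. if 1 \<le> k then complex_of_real (\<bar>C k \<omega>\<bar>\<^sup>2) * R k \<omega> else 0) \<in> borel_measurable N"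
    proof (rule borel_measurable_infsum_nat)
      fix k
      note [measurable] = R(1)
      show "(\<lambda>\<omega>. if 1 \<le> k then complex_of_real (\<bar>C k \<omega>\<bar>\<^sup>2) * R k \<omega> else 0) \<in> borel_measurable N"
      proof (cases "1 \<le> k")
        case True
        note [measurable] = C_meas[OF True]
        have "(\<lambda>\<omega>. complex_of_real (\<bar>C k \<omega>\<bar>\<^sup>2) * R k \<omega>) \<in> borel_measurable N" by measurable
        thus ?thesis using True by (simp only: if_True)
      qed (simp only: if_False borel_measurable_const)
    qed
    moreover have "(\<Sum>\<^sub>\<infinity>k. if 1 \<le> k then complex_of_real (\<bar>C k \<omega>\<bar>\<^sup>2) * R k \<omega> else 0)
        = (\<Sum>\<^sub>\<infinity>k\<in>{1..}. complex_of_real (\<bar>C k \<omega>\<bar>\<^sup>2) * R k \<omega>)" for \<omega>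
      by (rule infsum_cong_neutral) auto
    ultimately have [measurable]: "(\<lambda>\<omega>. \<Sum>\<^sub>\<infinity>k\<in>{1..}. complex_of_real (\<bar>C k \<omega>\<bar>\<^sup>2) * R k \<omega>) \<in> borel_measurable N" by (simp only:)
    note [measurable] = R(1)
    show ?thesis by measurable
  qed
  have schur_meas: "(\<lambda>\<omega>. schur_map z (D \<omega>) (\<lambda>k. R k \<omega>)) \<in> borel_measurable N"
  proof -
    have "(\<lambda>\<omega> k. R k \<omega>) \<in> measurable N (PiM UNIV (\<lambda>_. borel))"
      by (rule measurable_PiM_UNIV_single) (rule R(1))
    from measurable_compose[OF measurable_Pair[OF D_meas this] measurable_schur_map]
    show ?thesis by (simp only: prod.case)
  qed
  have \<rho>: "prob_space \<rho>" "sets \<rho> = sets borel"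
    by (rule prob_space_distr[OF root_resolvent_measurable]) simp
  have "\<rho> = distr N borel (\<lambda>\<omega>. schur_map z (D \<omega>) (\<lambda>k. R k \<omega>))"
  proof (rule measure_eqI)
    fix B assume "B \<in> sets \<rho>"
    hence B: "B \<in> sets borel" by simp
    let ?h = "\<lambda>x. emeasure (PiM UNIV (\<lambda>_. \<rho>)) (schur_map z x -` B)"
    let ?S = "\<lambda>\<omega>. rearrange \<sigma> (tail_counts (\<lambda>k. \<bar>C k \<omega>\<bar>))"
    have S_meas: "?S \<in> measurable N seq_space"
      by (rule measurable_compose[OF tail_counts_measurable[OF C] rearrange_measurable])
    have h_meas: "?h \<in> borel_measurable seq_space" by (rule measurable_schur_map_prob[OF \<rho> B])
    have "emeasure (distr N borel (\<lambda>\<omega>. schur_map z (D \<omega>) (\<lambda>k. R k \<omega>))) B = (\<integral>\<^sup>+\<omega>. ?h (D \<omega>) \<partial>N)"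
      by (rule N.schur_map_mixture[OF D_meas joint R_indep R(2) B])
    also have "\<dots> = (\<integral>\<^sup>+\<omega>. ?h (?S \<omega>) \<partial>N)"
    proof (rule nn_integral_cong_AE)
      show "AE \<omega> in N. ?h (D \<omega>) = ?h (?S \<omega>)"
        using finite_counts
      proof eventually_elim
        case (elim \<omega>)
        have "?h (D \<omega>) = ?h (rearrange (D \<omega> 0) (tail_counts (D \<omega>)))"
          using elim by (intro schur_map_rearrange[OF \<rho> D_nonneg _ B]) blast
        moreover have "tail_counts (D \<omega>) = tail_counts (\<lambda>k. \<bar>C k \<omega>\<bar>)"
          by (rule tail_counts_cong) (simp add: D_eq)
        moreover have "D \<omega> 0 = \<sigma>" by (simp add: D_eq)
        ultimately show ?case by (simp only:)
      qed
    qed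
    also have "\<dots> = (\<integral>\<^sup>+x. ?h x \<partial>distr N seq_space ?S)"
      by (rule nn_integral_distr[OF S_meas, symmetric]) (simp only: measurable_distr_eq1 h_meas)
    also have "distr N seq_space ?S = distr M seq_space (Z [])"
    proof -
      have "distr N seq_space ?S = distr (distr N (PiM pos_rats (\<lambda>_. borel)) (\<lambda>\<omega>. tail_counts (\<lambda>k. \<bar>C k \<omega>\<bar>))) seq_space (rearrange \<sigma>)"
        by (subst distr_distr[OF rearrange_measurable tail_counts_measurable[OF C]]) (simp add: o_def)
      also have "distr N (PiM pos_rats (\<lambda>_. borel)) (\<lambda>\<omega>. tail_counts (\<lambda>k. \<bar>C k \<omega>\<bar>))
          = distr M (PiM pos_rats (\<lambda>_. borel)) (\<lambda>\<omega>. tail_counts (\<lambda>k. \<bar>edge_weight W [] \<omega> k\<bar>))"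
        by (rule tail_counts_law[OF \<nu> N C prob_space_axioms edge_weight_poisson])
      also have "distr \<dots> seq_space (rearrange \<sigma>) = distr M seq_space (Z [])"
        unfolding sorted_weight_def[abs_def]
        by (subst distr_distr[OF rearrange_measurable tail_counts_measurable[OF edge_weight_poisson]]) (simp add: o_def)
      finally show ?thesis .
    qed
    also have "(\<integral>\<^sup>+x. ?h x \<partial>distr M seq_space (Z [])) = emeasure \<rho> B"
      by (rule root_resolvent_law[OF B, symmetric])
    finally show "emeasure \<rho> B = emeasure (distr N borel (\<lambda>\<omega>. schur_map z (D \<omega>) (\<lambda>k. R k \<omega>))) B" by (rule sym)
  qed simp
  also have "\<dots> = distr N borel ?rhs"
    by (rule distr_cong_AE[OF refl refl rhs_AE schur_meas rhs_meas])
  finally show "\<rho> = distr N borel ?rhs" .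
qed

end

theorem proposition1p4:
  fixes \<sigma> :: real and \<nu> :: "real measure" and M :: "'a measure"
    and W :: "'a \<Rightarrow> nat list \<Rightarrow> nat list \<Rightarrow> ereal" and z :: complex
  assumes "\<sigma> \<ge> 0"
    and "symmetric_levy_measure \<nu>"
    and "prob_space M"
    and "pwist M \<sigma> (reciprocal_measure \<nu>) W"
    and "Im z > 0"
  shows "root_resolvent W z \<in> borel_measurable M \<and>
    (\<forall>\<omega>\<in>space M. root_resolvent W (- cnj z) \<omega> = - cnj (root_resolvent W z \<omega>)) \<and>
    (\<forall>(M' :: 'b measure) (R :: nat \<Rightarrow> 'b \<Rightarrow> complex) (C :: nat \<Rightarrow> 'b \<Rightarrow> real).
      prob_space M' \<and>
      (\<forall>k. R k \<in> borel_measurable M' \<and> distr M' borel (R k) = distr M borel (root_resolvent W z)) \<and>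
      prob_space.indep_vars M' (\<lambda>_. borel) R UNIV \<and>
      poisson_points M' \<nu> (\<lambda>\<omega> k. ereal (C k \<omega>)) \<and>
      prob_space.indep_var M' (PiM UNIV (\<lambda>_. borel)) (\<lambda>\<omega>. \<lambda>k\<in>UNIV. R k \<omega>)
        (PiM {1..} (\<lambda>_. borel)) (\<lambda>\<omega>. \<lambda>k\<in>{1..}. complex_of_real (C k \<omega>))
      \<longrightarrow>
      (AE \<omega> in M'. (\<lambda>k. complex_of_real (\<bar>C k \<omega>\<bar>\<^sup>2) * R k \<omega>) summable_on {1..}) \<and>
      distr M borel (root_resolvent W z) =
        distr M' borel (\<lambda>\<omega>. - inverse (z + complex_of_real (\<sigma>\<^sup>2) * R 0 \<omega> +
          (\<Sum>\<^sub>\<infinity>k\<in>{1..}. complex_of_real (\<bar>C k \<omega>\<bar>\<^sup>2) * R k \<omega>))))"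
proof -
  interpret poisson_tree M \<sigma> \<nu> W z
    using assms by (simp add: poisson_tree_def poisson_tree_axioms_def)
  show ?thesis
  proof (intro conjI ballI allI impI)
    show "root_resolvent W z \<in> borel_measurable M" by (rule root_resolvent_measurable)
    show "root_resolvent W (- cnj z) \<omega> = - cnj (root_resolvent W z \<omega>)" if "\<omega> \<in> space M" for \<omega>
      unfolding root_resolvent_eq[OF that] by (rule tree_resolvent_reflect)
  qed (elim conjE, rule recursive_distributional_equation; blast)+
qed

end
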